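(* Let $q:\mathbb{R}\to(0,\infty)$ be a fixed positive polynomial of degree $2m$, $m\in\mathbb{N}$, with associated weights $\rho_\kappa=q^{-\kappa/(2m)}$, $\kappa\in\mathbb{R}$, and let $\gamma>0$ be fixed. For any $\upsilon\in\mathbb{R}$, $1<p<\infty$ and real $\alpha>1/p$, there is a constant $C_{\upsilon,\alpha,p}>0$ such that $$\big|I_{\rho_\upsilon}(f)-Q_{\rho_\upsilon,n}(f)\big|\le C_{\upsilon,\alpha,p}\,n^{-\alpha}\,\|f\|_{W^{\alpha,p}_{\rho_{p(\upsilon-2-2\alpha)+2}}(\mathbb{R})}$$ for all $f\in W^{\alpha,p}_{\rho_{p(\upsilon-2-2\alpha)+2}}(\mathbb{R})$ and all $n\in\mathbb{N}$; that is, $C_{\upsilon,\alpha,p}$ is independent of $f$ and $n$ (it may depend on $q$ and $\gamma$).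
   Context: $\mathbb{N}=\{1,2,\dots\}$. Functions are complex-valued; polynomials have real coefficients. Weights: for the fixed strictly positive polynomial $q$ of degree $2m$ on $\mathbb{R}$, $\rho_\kappa(x)=(q(x))^{-\kappa/(2m)}$ for $x\in\mathbb{R}$ and $\kappa\in\mathbb{R}$. $L^p_{\rho_\kappa}(\mathbb{R})$ is the space of Lebesgue measurable functions with finite norm $\|f\|_{L^p_{\rho_\kappa}(\mathbb{R})}=\big(\int_{\mathbb{R}}|f(x)|^p\rho_\kappa(x)\,dx\big)^{1/p}$. Weighted Sobolev space (uniform weight): for real $\alpha\ge0$ and $1<p<\infty$, $W^{\alpha,p}_{\rho_\kappa}(\mathbb{R})$ is the weighted Bessel potential space of all $f\in L^p_{\rho_\kappa}(\mathbb{R})$ with $$\big\|\mathscr{F}^{-1}\big((1+|\cdot|^2)^{\alpha/2}\mathscr{F}f\big)\big\|_{L^p_{\rho_\kappa}(\mathbb{R})}<\infty,$$ this quantity being the norm, where $\mathscr{F}$ is the one-dimensional Fourier transform (on tempered distributions). For integer $\alpha\ge 0$ this coincides, with equivalent norms, with the space of $f\in L^p_{\rho_\kappa}(\mathbb{R})$ with $\big(\sum_{\tau=0}^\alpha\int_{\mathbb{R}}|f^{(\tau)}(x)|^p\rho_\kappa(x)\,dx\big)^{1/p}<\infty$ (weak derivatives). Change of variables: for fixed $\gamma>0$, $\phi(\theta)=-\gamma\cot(\theta/2)$, $\theta\in(0,2\pi)$, so $\phi'(\theta)=\gamma/(2\sin^2(\theta/2))$. Integral and Möbius-transformed trapezoidal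 rule: $$I_{\rho_\upsilon}(f)=\int_{\mathbb{R}}f(x)\rho_\upsilon(x)\,dx,\qquad Q_{\rho_\upsilon,n}(f)=\frac{2\pi}{n}\sum_{j=1}^n f(\phi(\theta_j))\,\rho_\upsilon(\phi(\theta_j))\,\phi'(\theta_j),\qquad \theta_j=\frac{2\pi j}{n}-\frac{\pi}{n}.$$ Since $\alpha>1/p$, $f$ has a continuous representative, which is used to evaluate $Q_{\rho_\upsilon,n}(f)$. *)

theory Defs
  imports "HOL-Analysis.Analysis" "HOL-Computational_Algebra.Polynomial"
begin

definition weight :: "real poly \<Rightarrow> real \<Rightarrow> real \<Rightarrow> real" where
  "weight q \<kappa> x = poly q x powr (- \<kappa> / real (degree q))"


section \<open>Weighted Lebesgue spaces\<close>

text \<open>Elements are functions, not classes modulo almost-everywhere equality.\<close>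

definition weighted_Lp :: "real poly \<Rightarrow> real \<Rightarrow> real \<Rightarrow> (real \<Rightarrow> complex) set" where
  "weighted_Lp q \<kappa> p =
     {f \<in> borel_measurable lebesgue. integrable lebesgue (\<lambda>x. norm (f x) powr p * weight q \<kappa> x)}"

definition weighted_Lp_norm :: "real poly \<Rightarrow> real \<Rightarrow> real \<Rightarrow> (real \<Rightarrow> complex) \<Rightarrow> real" where
  "weighted_Lp_norm q \<kappa> p f =
     (LINT x|lebesgue. norm (f x) powr p * weight q \<kappa> x) powr (1 / p)"


section \<open>Fourier transform on tempered distributions\<close>

definition vderiv :: "(real \<Rightarrow> complex) \<Rightarrow> real \<Rightarrow> complex" where
  "vderiv f = (\<lambda>x. vector_derivative f (at x))"

definition schwartz :: "(real \<Rightarrow> complex) set" where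
  "schwartz = {f. (\<forall>k x. (vderiv ^^ k) f differentiable (at x)) \<and>
                  (\<forall>j k. bounded (range (\<lambda>x. x ^ j *\<^sub>R (vderiv ^^ k) f x)))}"

definition fourier :: "(real \<Rightarrow> complex) \<Rightarrow> real \<Rightarrow> complex" where
  "fourier f \<xi> = (LINT x|lebesgue. exp (- \<i> * of_real (\<xi> * x)) * f x)"

definition inverse_fourier :: "(real \<Rightarrow> complex) \<Rightarrow> real \<Rightarrow> complex" where
  "inverse_fourier f x =
     of_real (1 / (2 * pi)) * (LINT \<xi>|lebesgue. exp (\<i> * of_real (\<xi> * x)) * f \<xi>)"

text \<open>
  Distributions are represented by functionals on all functions, of which only the
  values on \<^const>\<open>schwartz\<close> matter: equality of distributions is tested there, and the
  operations below, defined by duality, only evaluate their argument at Schwartz functions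
  when given Schwartz functions (the multipliers in use have polynomially bounded
  derivatives).  Continuity need not be imposed, since these operations are only applied to
  functions in \<^const>\<open>weighted_Lp\<close>; for a strictly positive \<^term>\<open>q\<close> the weight and
  its reciprocal are polynomially bounded, so such functions are tempered distributions.
\<close>

type_synonym distr = "(real \<Rightarrow> complex) \<Rightarrow> complex"

definition regular_distr :: "(real \<Rightarrow> complex) \<Rightarrow> distr" where
  "regular_distr f \<phi> = (LINT x|lebesgue. f x * \<phi> x)"

definition fourier_distr :: "distr \<Rightarrow> distr" where
  "fourier_distr T \<phi> = T (fourier \<phi>)"

definition inverse_fourier_distr :: "distr \<Rightarrow> distr" where
  "inverse_fourier_distr T \<phi> = T (inverse_fourier \<phi>)"

definition mult_distr :: "(real \<Rightarrow> complex) \<Rightarrow> distr \<Rightarrow> distr" where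
  "mult_distr a T \<phi> = T (\<lambda>x. a x * \<phi> x)"

definition bessel :: "real \<Rightarrow> distr \<Rightarrow> distr" where
  "bessel \<alpha> T = inverse_fourier_distr
     (mult_distr (\<lambda>\<xi>. of_real ((1 + \<bar>\<xi>\<bar>\<^sup>2) powr (\<alpha> / 2))) (fourier_distr T))"


section \<open>Weighted Bessel potential spaces\<close>

definition is_bessel_density ::
    "real poly \<Rightarrow> real \<Rightarrow> real \<Rightarrow> real \<Rightarrow> (real \<Rightarrow> complex) \<Rightarrow> (real \<Rightarrow> complex) \<Rightarrow> bool" where
  "is_bessel_density q \<kappa> \<alpha> p f g \<longleftrightarrow>
     g \<in> weighted_Lp q \<kappa> p \<and> (\<forall>\<phi>\<in>schwartz. regular_distr g \<phi> = bessel \<alpha> (regular_distr f) \<phi>)"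

text \<open>Finiteness of the norm of a distribution means that it is given by a function in
  \<^const>\<open>weighted_Lp\<close>; this function is unique up to null sets, so its norm does not depend
  on the choice.\<close>

definition weighted_sobolev ::
    "real poly \<Rightarrow> real \<Rightarrow> real \<Rightarrow> real \<Rightarrow> (real \<Rightarrow> complex) set" where
  "weighted_sobolev q \<kappa> \<alpha> p = {f \<in> weighted_Lp q \<kappa> p. \<exists>g. is_bessel_density q \<kappa> \<alpha> p f g}"

definition weighted_sobolev_norm ::
    "real poly \<Rightarrow> real \<Rightarrow> real \<Rightarrow> real \<Rightarrow> (real \<Rightarrow> complex) \<Rightarrow> real" where
  "weighted_sobolev_norm q \<kappa> \<alpha> p f =
     weighted_Lp_norm q \<kappa> p (SOME g. is_bessel_density q \<kappa> \<alpha> p f g)"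

definition continuous_rep :: "(real \<Rightarrow> complex) \<Rightarrow> real \<Rightarrow> complex" where
  "continuous_rep f = (THE g. continuous_on UNIV g \<and> (AE x in lebesgue. g x = f x))"


section \<open>The integral and the transformed trapezoidal rule\<close>

definition moebius :: "real \<Rightarrow> real \<Rightarrow> real" where
  "moebius \<gamma> \<theta> = - \<gamma> * cot (\<theta> / 2)"

definition moebius' :: "real \<Rightarrow> real \<Rightarrow> real" where
  "moebius' \<gamma> \<theta> = \<gamma> / (2 * (sin (\<theta> / 2))\<^sup>2)"

lemma moebius_has_derivative:
  assumes "0 < \<theta>" "\<theta> < 2 * pi"
  shows "(moebius \<gamma> has_real_derivative moebius' \<gamma> \<theta>) (at \<theta>)"
proof -
  have "sin (\<theta> / 2) \<noteq> 0"
    using assms sin_gt_zero[of "\<theta> / 2"] by simp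
  then show ?thesis
    unfolding moebius_def[abs_def] moebius'_def
    by (auto intro!: derivative_eq_intros DERIV_chain2[OF DERIV_cot] simp: field_simps)
qed

definition weighted_integral :: "real poly \<Rightarrow> real \<Rightarrow> (real \<Rightarrow> complex) \<Rightarrow> complex" where
  "weighted_integral q \<upsilon> f = (LINT x|lebesgue. f x * of_real (weight q \<upsilon> x))"

definition node :: "nat \<Rightarrow> nat \<Rightarrow> real" where
  "node n j = 2 * pi * real j / real n - pi / real n"

text \<open>This evaluates its argument pointwise; for an element of a Sobolev space it is to be
  applied to the continuous representative.\<close>

definition moebius_trapezoidal ::
    "real poly \<Rightarrow> real \<Rightarrow> real \<Rightarrow> nat \<Rightarrow> (real \<Rightarrow> complex) \<Rightarrow> complex" where
  "moebius_trapezoidal q \<gamma> \<upsilon> n f = of_real (2 * pi / real n) *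
     (\<Sum>j=1..n. f (moebius \<gamma> (node n j)) *
        of_real (weight q \<upsilon> (moebius \<gamma> (node n j)) * moebius' \<gamma> (node n j)))"

end

theory Submission
  imports Defs "HOL-Probability.Probability"
begin

text \<open>
  By subordination, the Bessel kernel is a superposition over \<open>t > 0\<close> of the damped heat kernels
  \<open>heat t\<close>, with weight \<open>t powr (\<alpha> / 2 - 1)\<close>. Testing the definition of the Bessel density \<open>g\<close>
  of \<open>f\<close> against Bessel potentials of Gaussians identifies \<open>f\<close> with the Bessel potential of
  \<open>g\<close>, so that the quadrature error of \<open>f\<close> is the integral of \<open>g y\<close> against the errors
  \<open>e (t, y)\<close> of the translates \<open>\<lambda>x. heat t (x - y)\<close>. By Hoelder's inequality it remains to bound
  \<open>e (t, \<cdot>)\<close> in the dual weighted space, integrably in \<open>t\<close>.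

  Near \<open>y\<close> the mesh width in \<open>x\<close> is about \<open>W\<^sup>2 / n\<close> with \<open>W = sqrt (1 + y\<^sup>2)\<close>, while the kernel has
  width \<open>sqrt t\<close>. The transformed integrand is smooth and periodic, which gives an error of
  order \<open>(W\<^sup>2 / (n * sqrt t)) ^ M\<close> for every \<open>M\<close>; this is used where the mesh is fine. Where it is
  coarse, the integral and the quadrature sum are estimated separately. Everything then depends
  on \<open>n * sqrt t\<close> only, and scaling in \<open>t\<close> produces the factor \<open>n powr (- \<alpha>)\<close>.
\<close>

section \<open>Polynomial weights and Gaussians\<close>

text \<open>Neither kind of bound on the error suffices alone: the mass bound does not decay in
  \<open>n\<close>, and the first-order pointwise bound behaves like \<open>1 / sqrt t\<close>, too
  singular when \<alpha> \<le> 1. In the dual exponent \<open>r = p / (p - 1)\<close> they are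
  interpolated by writing \<open>e powr r\<close> as \<open>e powr (r - 1) * e\<close>, the first
  factor being bounded pointwise and the second by its mass. The mass is taken with the weight
  \<open>jbr y powr (\<upsilon> - 3/2)\<close>. The number 3/2 lies above 1, which makes
  \<open>jbr y powr (- 3/2)\<close> integrable and the total mass at the nodes bounded, and below 2,
  which leaves a spare factor \<open>R powr (- 1/4)\<close>, where \<open>R = n * sqrt t\<close>,
  for convergence at large \<open>t\<close>. At small \<open>t\<close> the integrand becomes
  \<open>t powr (\<alpha> / 2 - 1 - 1 / (2 * p))\<close>, integrable because \<alpha> > 1 / p. The
  index \<open>k\<close> of the Sobolev weight is the one for which the powers of
  \<open>jbr y\<close> match: with \<open>s = (\<alpha> - 1 / p) * r\<close> the dual weight has
  exponent \<open>r * (k / p) = r * (\<upsilon> - 2) - 2 * s\<close>.\<close>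

definition jbr :: "real \<Rightarrow> real" where
  "jbr x = sqrt (1 + x\<^sup>2)"

lemma jbr_ge_1: "1 \<le> jbr x"
  by (simp add: jbr_def)

lemma jbr_pos [simp]: "0 < jbr x"
  using jbr_ge_1[of x] by linarith

lemma jbr_nonneg [simp]: "0 \<le> jbr x"
  using jbr_pos[of x] by linarith

lemma jbr_nonzero [simp]: "jbr x \<noteq> 0"
  using jbr_pos[of x] by linarith

lemma jbr_power2: "(jbr x)\<^sup>2 = 1 + x\<^sup>2"
  by (simp add: jbr_def add_nonneg_nonneg)

lemma abs_le_jbr: "\<bar>x\<bar> \<le> jbr x"
  by (simp add: jbr_def real_le_rsqrt)

lemma continuous_on_jbr [continuous_intros]:
  "continuous_on A f \<Longrightarrow> continuous_on A (\<lambda>x. jbr (f x))"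
  unfolding jbr_def by (intro continuous_intros)

lemma borel_measurable_jbr [measurable]: "jbr \<in> borel_measurable borel"
  unfolding jbr_def[abs_def] by measurable

text \<open>The bracket is the Euclidean norm of the vector \<open>(1, x)\<close>, so this is the
  triangle inequality, made multiplicative by \<open>1 \<le> jbr y\<close>. The multiplicative form
  is the one that can be raised to real powers.\<close>

lemma jbr_le_mult: "jbr x \<le> jbr y * (1 + \<bar>x - y\<bar>)"
proof -
  have "jbr x = norm (1::real, x)" "jbr y = norm (1::real, y)"
    by (simp_all add: jbr_def norm_Pair)
  moreover have "norm (1::real, x) \<le> norm (1::real, y) + norm (0::real, x - y)"
    using norm_triangle_ineq[of "(1::real, y)" "(0::real, x - y)"] by simp
  ultimately have "jbr x \<le> jbr y + \<bar>x - y\<bar>"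
    by (simp add: norm_Pair)
  also have "\<dots> \<le> jbr y + jbr y * \<bar>x - y\<bar>"
    using mult_right_mono[OF jbr_ge_1[of y], of "\<bar>x - y\<bar>"] by simp
  finally show ?thesis
    by (simp add: algebra_simps)
qed

text \<open>Peetre's inequality. For a negative exponent the roles of \<open>x\<close> and
  \<open>y\<close> are exchanged, which is why the distance carries the absolute value of the
  exponent.\<close>

lemma jbr_powr_peetre: "jbr x powr a \<le> (1 + \<bar>x - y\<bar>) powr \<bar>a\<bar> * jbr y powr a"
proof (cases "a \<ge> 0")
  case True
  have "jbr x powr a \<le> (jbr y * (1 + \<bar>x - y\<bar>)) powr a"
    using True by (intro powr_mono2 jbr_le_mult) auto
  then show ?thesis
    using True by (simp add: powr_mult mult.commute)
next
  case False
  have "jbr y powr (-a) \<le> (jbr x * (1 + \<bar>y - x\<bar>)) powr (-a)"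
    using False by (intro powr_mono2 jbr_le_mult) auto
  then have "jbr y powr (-a) \<le> jbr x powr (-a) * (1 + \<bar>x - y\<bar>) powr (-a)"
    by (simp add: powr_mult abs_minus_commute)
  then have "inverse (jbr y powr a) \<le> inverse (jbr x powr a) * (1 + \<bar>x - y\<bar>) powr \<bar>a\<bar>"
    using False by (simp add: powr_minus)
  then show ?thesis
    by (simp add: field_simps)
qed

lemma integrable_jbr_powr: "integrable lborel (\<lambda>x. jbr x powr (-3/2))"
proof -
  define f where "f = (\<lambda>x::real. indicator {1..} x * x powr (-3/2))"
  have "((\<lambda>x. x powr (-3/2)) has_integral - (1 powr ((-3/2) + 1)) / ((-3/2) + 1)) {1::real..}"
    by (rule has_integral_powr_to_inf) auto
  then have "(\<lambda>x::real. x powr (-3/2)) absolutely_integrable_on {1..}"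
    by (intro nonnegative_absolutely_integrable_1) (auto simp: integrable_on_def)
  then have f: "integrable lborel f"
    unfolding set_integrable_def f_def
    by (simp add: integrable_completion)
  then have f': "integrable lborel (\<lambda>x. f (-x))"
    using lborel_integrable_real_affine[of f "-1" 0] by simp
  have i: "integrable lborel (indicator {-1..1} :: real \<Rightarrow> real)"
    by simp
  have "integrable lborel (\<lambda>x. f x + f (-x) + indicator {-1..1} x)"
    using f f' i by (intro Bochner_Integration.integrable_add)
  then show ?thesis
  proof (rule Bochner_Integration.integrable_bound)
    have *: "jbr x powr (-3/2) \<le> \<bar>x\<bar> powr (-3/2)" if "\<bar>x\<bar> \<ge> 1" for x
      using that abs_le_jbr[of x] by (intro powr_mono2') auto
    have "jbr x powr (-3/2) \<le> 1" for x
      using powr_mono2'[of "-3/2" 1 "jbr x"] jbr_ge_1[of x] by simp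
    then have "jbr x powr (-3/2) \<le> f x + f (-x) + indicator {-1..1} x" for x
      using *[of x] unfolding f_def by (cases "x = 1 \<or> x = -1")
      (auto simp: indicator_def abs_if split: if_splits intro: order.trans[of _ 1])
    then show "AE x in lborel. norm (jbr x powr (-3/2)) \<le> norm (f x + f (-x) + indicator {-1..1} x)"
      by (intro AE_I2) (smt (verit) real_norm_def powr_ge_zero)
  qed measurable
qed

lemma poly_le_jbr_power:
  assumes "degree A \<le> d"
  obtains C where "C > 0" "\<And>x. \<bar>poly A x\<bar> \<le> C * jbr x ^ d"
proof
  let ?C = "1 + (\<Sum>i\<le>degree A. \<bar>coeff A i\<bar>)"
  show "?C > 0"
    by (smt (verit) sum_nonneg abs_ge_zero)
  fix x
  have "\<bar>poly A x\<bar> \<le> (\<Sum>i\<le>degree A. \<bar>coeff A i\<bar> * \<bar>x\<bar> ^ i)"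
    unfolding poly_altdef by (rule order.trans[OF sum_abs]) (simp add: abs_mult power_abs)
  also have "\<dots> \<le> (\<Sum>i\<le>degree A. \<bar>coeff A i\<bar> * jbr x ^ d)"
  proof (intro sum_mono mult_left_mono)
    fix i assume "i \<in> {..degree A}"
    then have "\<bar>x\<bar> ^ i \<le> jbr x ^ i" "jbr x ^ i \<le> jbr x ^ d"
      using assms abs_le_jbr[of x] jbr_ge_1[of x] by (auto intro!: power_mono power_increasing)
    then show "\<bar>x\<bar> ^ i \<le> jbr x ^ d" by linarith
  qed auto
  also have "\<dots> \<le> ?C * jbr x ^ d"
    by (simp add: sum_distrib_right[symmetric] algebra_simps)
  finally show "\<bar>poly A x\<bar> \<le> ?C * jbr x ^ d" .
qed

text \<open>On \<open>{-1..1}\<close> this is compactness. Outside, \<open>poly q x\<close> is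
  \<open>x ^ (2 * m)\<close> times the reflected polynomial at \<open>1 / x\<close>, and compactness
  applies again, because the reflected polynomial is positive on \<open>{-1..1}\<close> too: its
  value at 0 is the leading coefficient of \<open>q\<close>, which is a limit of positive values and
  not zero.\<close>

lemma positive_poly_ge_jbr_power:
  fixes q :: "real poly"
  assumes deg: "degree q = 2 * m" and pos: "\<And>x. poly q x > 0"
  obtains c where "c > 0" "\<And>x. c * jbr x ^ (2 * m) \<le> poly q x"
proof -
  define Q where "Q = reflect_poly q"
  have q0: "q \<noteq> 0" using pos by auto
  have Qe: "poly q x = x ^ (2 * m) * poly Q (1 / x)" if "x \<noteq> 0" for x
    using poly_reflect_poly_nz[of "inverse x" q] that deg
    by (simp add: Q_def field_simps power_inverse)
  have Qpos: "poly Q y > 0" for y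
  proof -
    have nz: "poly Q y > 0" if "y \<noteq> 0" for y
      using Qe[of "1 / y"] pos[of "1 / y"] that by (auto simp: zero_less_mult_iff)
    have "poly Q 0 \<ge> 0"
    proof (rule tendsto_lowerbound)
      show "(poly Q \<longlongrightarrow> poly Q 0) (at 0)" by (intro tendsto_intros isContD poly_isCont) 
      show "\<forall>\<^sub>F x in at 0. 0 \<le> poly Q x"
        by (auto simp: eventually_at_filter intro!: always_eventually less_imp_le nz)
    qed simp
    moreover have "poly Q 0 \<noteq> 0"
      using q0 by (simp add: Q_def poly_0_coeff_0)
    ultimately show ?thesis using nz[of y] by (cases "y = 0") auto
  qed
  have ex: "\<exists>c>0. \<forall>x\<in>{-1..1}. c \<le> poly P x" if "\<And>x. poly P x > 0" for P :: "real poly"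
  proof -
    have "compact {-1..1::real}" "{-1..1::real} \<noteq> {}" "continuous_on {-1..1} (poly P)"
      by (auto intro!: continuous_intros)
    from continuous_attains_inf[OF this]
    obtain x0 where "x0 \<in> {-1..1}" "\<forall>x\<in>{-1..1}. poly P x0 \<le> poly P x"
      by blast
    then show ?thesis using that by blast
  qed
  obtain c1 where c1: "c1 > 0" "\<And>x. \<bar>x\<bar> \<le> 1 \<Longrightarrow> c1 \<le> poly q x"
    using ex[OF pos] by (auto simp: abs_le_iff)
  obtain c2 where c2: "c2 > 0" "\<And>x. \<bar>x\<bar> \<le> 1 \<Longrightarrow> c2 \<le> poly Q x"
    using ex[OF Qpos] by (auto simp: abs_le_iff)
  define c where "c = min c1 c2 / 2 ^ m"
  have jb2: "jbr x ^ (2 * m) = (1 + x\<^sup>2) ^ m" for x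
    by (simp add: power_mult jbr_power2)
  show ?thesis
  proof
    show "c > 0" using c1 c2 by (simp add: c_def)
    fix x
    show "c * jbr x ^ (2 * m) \<le> poly q x"
    proof (cases "\<bar>x\<bar> \<le> 1")
      case True
      then have "x\<^sup>2 \<le> 1" by (simp add: abs_square_le_1)
      then have "(1 + x\<^sup>2) ^ m \<le> 2 ^ m" by (intro power_mono) auto
      then have "c * jbr x ^ (2 * m) \<le> min c1 c2"
        unfolding jb2 c_def using c1 c2
        by (simp add: divide_le_eq mult_mono)
      also have "\<dots> \<le> poly q x" using c1(2)[OF True] by simp
      finally show ?thesis .
    next
      case False
      then have x2: "1 \<le> x\<^sup>2" using abs_le_square_iff[of 1 x] by simp
      have "(1 + x\<^sup>2) ^ m \<le> (2 * x\<^sup>2) ^ m" using x2 by (intro power_mono) auto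
      then have "c * jbr x ^ (2 * m) \<le> min c1 c2 * (x\<^sup>2) ^ m"
        unfolding jb2 c_def using c1 c2 by (simp add: field_simps power_mult_distrib)
      also have "\<dots> \<le> c2 * (x\<^sup>2) ^ m" by (intro mult_right_mono) auto
      also have "\<dots> \<le> poly Q (1 / x) * (x\<^sup>2) ^ m"
        using False by (intro mult_right_mono c2) (auto simp: field_simps)
      also have "\<dots> = poly q x"
        using False Qe[of x] by (simp add: power_mult)
      finally show ?thesis .
    qed
  qed
qed

text \<open>The quotient of \<open>q\<close> by \<open>jbr x ^ (2 * m)\<close> stays in a compact
  interval of positive numbers. Hence each of its real powers is at most the sum of the
  corresponding powers of the two end points, whatever the sign of the exponent.\<close>

lemma poly_powr_le_jbr_powr:
  fixes q :: "real poly" and e :: real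
  assumes deg: "degree q = 2 * m" and pos: "\<And>x. poly q x > 0"
  obtains C where "C > 0" "\<And>x. poly q x powr e \<le> C * jbr x powr (2 * real m * e)"
    "\<And>x. jbr x powr (2 * real m * e) \<le> C * poly q x powr e"
proof -
  obtain c where c: "c > 0" "\<And>x. c * jbr x ^ (2 * m) \<le> poly q x"
    using positive_poly_ge_jbr_power[OF assms] by blast
  obtain D where D: "D > 0" "\<And>x. \<bar>poly q x\<bar> \<le> D * jbr x ^ (2 * m)"
    using poly_le_jbr_power[of q "2 * m"] deg by auto
  define v where "v x = poly q x / jbr x ^ (2 * m)" for x
  have v: "c \<le> v x" "v x \<le> D" for x
    using c(2)[of x] D(2)[of x] pos[of x] by (simp_all add: v_def field_simps)
  have v0: "v x > 0" for x using v(1)[of x] c(1) by linarith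
  have bnd: "v x powr a \<le> c powr a + D powr a" for x a
  proof (cases "a \<ge> 0")
    case True
    then have "v x powr a \<le> D powr a" using v[of x] v0[of x] by (intro powr_mono2) auto
    then show ?thesis by (smt (verit) powr_ge_zero)
  next
    case False
    then have "v x powr a \<le> c powr a" using v[of x] c(1) by (intro powr_mono2') auto
    then show ?thesis by (smt (verit) powr_ge_zero)
  qed
  have jbp: "jbr x powr (2 * real m * a) = (jbr x ^ (2 * m)) powr a" for x and a :: real
    using powr_realpow[of "jbr x" "2 * m"] powr_powr[of "jbr x" "real (2 * m)" a] by simp
  have qe: "poly q x = v x * jbr x ^ (2 * m)" for x
    by (simp add: v_def)
  let ?C = "c powr e + D powr e + (c powr (-e) + D powr (-e))"
  show ?thesis
  proof (rule that[of ?C])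
    show "?C > 0" using c(1) by (smt (verit) powr_ge_zero powr_gt_zero)
    fix x :: real
    have "poly q x powr e = v x powr e * jbr x powr (2 * real m * e)"
      unfolding qe[of x] using v0[of x] jbp[of x e] by (simp add: powr_mult)
    moreover have "v x powr e \<le> ?C" using bnd[of x e] by (smt (verit) powr_ge_zero)
    ultimately show "poly q x powr e \<le> ?C * jbr x powr (2 * real m * e)"
      by (simp add: mult_right_mono)
    have "jbr x powr (2 * real m * e) = v x powr (-e) * poly q x powr e"
      unfolding qe[of x] using v0[of x] jbp[of x e] by (simp add: powr_mult powr_minus)
    moreover have "v x powr (-e) \<le> ?C" using bnd[of x "-e"] by (smt (verit) powr_ge_zero)
    ultimately show "jbr x powr (2 * real m * e) \<le> ?C * poly q x powr e"
      by (simp add: mult_right_mono)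
  qed
qed

lemma weight_comparable:
  fixes q :: "real poly"
  assumes m: "m \<ge> 1" and deg: "degree q = 2 * m" and pos: "\<And>x. poly q x > 0"
  obtains C where "C > 0" "\<And>x. weight q k x \<le> C * jbr x powr (-k)"
    "\<And>x. jbr x powr (-k) \<le> C * weight q k x"
proof -
  have "2 * m * (- k / (2 * m)) = - k" using m by simp
  then show ?thesis
    using poly_powr_le_jbr_powr[OF deg pos, of "- k / (2 * m)"] that
    unfolding weight_def deg by (metis of_nat_mult of_nat_numeral)
qed

section \<open>Polynomial growth against exponential and Gaussian decay\<close>

lemma power_le_fact_mult_exp:
  fixes x :: real
  assumes "0 \<le> x" shows "x ^ d \<le> fact d * exp x"
proof -
  have "(\<Sum>i\<in>{d}. x ^ i / fact i) \<le> (\<Sum>i. x ^ i / fact i)"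
    using assms summable_exp_generic[of x]
    by (intro sum_le_suminf) (auto simp: divide_inverse mult.commute)
  then show ?thesis
    by (simp add: exp_def field_simps)
qed

lemma powr_le_exp:
  fixes c a :: real
  assumes c: "0 < c"
  obtains C where "C > 0" "\<And>x. 0 \<le> x \<Longrightarrow> (1 + x) powr a \<le> C * exp (c * x)"
proof -
  define d where "d = nat \<lceil>a\<rceil>"
  let ?C = "fact d * exp c / c ^ d"
  show ?thesis
  proof
    show "?C > 0" using c by simp
    fix x :: real assume x: "0 \<le> x"
    have "(1 + x) powr a \<le> (1 + x) powr d"
      using x by (intro powr_mono) (auto simp: d_def, linarith)
    also have "\<dots> = (1 + x) ^ d" using x by (simp add: powr_realpow)
    also have "\<dots> = (c * (1 + x)) ^ d / c ^ d" using c by (simp add: power_mult_distrib)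
    also have "\<dots> \<le> fact d * exp (c * (1 + x)) / c ^ d"
      using c x by (intro divide_right_mono power_le_fact_mult_exp) auto
    also have "\<dots> = ?C * exp (c * x)" by (simp add: exp_add algebra_simps)
    finally show "(1 + x) powr a \<le> ?C * exp (c * x)" .
  qed
qed

lemma poly_gauss_bound:
  obtains C where "C > 0" "\<And>u::real. \<bar>poly B u\<bar> * exp (- (u\<^sup>2 / 4)) \<le> C * exp (- (u\<^sup>2 / 8))"
proof -
  obtain C where C: "C > 0" "\<And>u. \<bar>poly B u\<bar> \<le> C * jbr u ^ (degree B)"
    using poly_le_jbr_power[of B "degree B"] by auto
  obtain D where D: "D > 0" "\<And>x. 0 \<le> x \<Longrightarrow> (1 + x) powr (degree B / 2) \<le> D * exp (1/8 * x)"
    using powr_le_exp[of "1/8" "degree B / 2"] by auto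
  show ?thesis
  proof
    show "C * D > 0" using C D by simp
    fix u :: real
    have "jbr u powr degree B = ((1 + u\<^sup>2) powr (1 / 2)) powr degree B"
      by (simp add: jbr_def powr_half_sqrt)
    then have "jbr u ^ degree B = (1 + u\<^sup>2) powr (degree B / 2)"
      by (simp add: powr_powr powr_realpow)
    also have "\<dots> \<le> D * exp (u\<^sup>2 / 8)" using D(2)[of "u\<^sup>2"] by simp
    finally have "C * jbr u ^ degree B \<le> C * (D * exp (u\<^sup>2 / 8))"
      using C(1) by (intro mult_left_mono) auto
    with C(2)[of u] have "\<bar>poly B u\<bar> \<le> C * D * exp (u\<^sup>2 / 8)" by simp
    then have "\<bar>poly B u\<bar> * exp (- (u\<^sup>2 / 4)) \<le> C * D * exp (u\<^sup>2 / 8) * exp (- (u\<^sup>2 / 4))"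
      by (intro mult_right_mono) auto
    also have "\<dots> = C * D * exp (- (u\<^sup>2 / 8))" by (simp add: mult_exp_exp)
    finally show "\<bar>poly B u\<bar> * exp (- (u\<^sup>2 / 4)) \<le> C * D * exp (- (u\<^sup>2 / 8))" .
  qed
qed

text \<open>Moving the weight from \<open>x\<close> to \<open>y\<close> costs a power of
  \<open>1 + \<bar>x - y\<bar>\<close>, and this has to be absorbed uniformly in all
  \<open>t > 0\<close>. The Gaussian alone does it only for bounded \<open>t\<close>; for large
  \<open>t\<close> the damping \<open>exp (- t)\<close> is needed. Half of each is spent.\<close>

lemma gauss_jbr_bound:
  obtains C where "C > 0"
    "\<And>t x y. t > 0 \<Longrightarrow> exp (-t) * exp (- ((x - y)\<^sup>2 / (8 * t))) * jbr x powr a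
      \<le> C * jbr y powr a * exp (-t/2) * exp (- ((x - y)\<^sup>2 / (16 * t)))"
proof -
  obtain C where C: "C > 0" "\<And>x. 0 \<le> x \<Longrightarrow> (1 + x) powr \<bar>a\<bar> \<le> C * exp (1/4 * x)"
    using powr_le_exp[of "1/4" "\<bar>a\<bar>"] by auto
  show ?thesis
  proof
    show "C > 0" by fact
    fix t x y :: real assume t: "t > 0"
    define z where "z = \<bar>x - y\<bar>"
    \<comment> \<open>The square is arranged so that dividing by \<open>16 * t\<close> gives
      \<open>z / 4 \<le> t / 2 + z^2 / (16 * t)\<close>: a linear exponent is paid for by the
      damping and the Gaussian together.\<close>
    have "0 \<le> 2 * (2 * t - z / 2)\<^sup>2 + z\<^sup>2 / 2" by simp
    then have "4 * z * t \<le> 8 * t\<^sup>2 + z\<^sup>2" by (simp add: power2_eq_square algebra_simps)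
    then have "z / 4 \<le> t / 2 + z\<^sup>2 / (16 * t)"
      using t by (simp add: field_simps power2_eq_square)
    then have ez: "exp (z / 4) \<le> exp (t / 2 + z\<^sup>2 / (16 * t))" by simp
    have "jbr x powr a \<le> (1 + z) powr \<bar>a\<bar> * jbr y powr a"
      unfolding z_def by (rule jbr_powr_peetre)
    also have "\<dots> \<le> C * exp (z / 4) * jbr y powr a"
      using C(2)[of z] by (intro mult_right_mono) (auto simp: z_def)
    also have "\<dots> \<le> C * exp (t / 2 + z\<^sup>2 / (16 * t)) * jbr y powr a"
      using C(1) ez by (intro mult_right_mono mult_left_mono) auto
    finally have "exp (-t) * exp (- (z\<^sup>2 / (8 * t))) * jbr x powr a \<le>
      exp (-t) * exp (- (z\<^sup>2 / (8 * t))) * (C * exp (t / 2 + z\<^sup>2 / (16 * t)) * jbr y powr a)"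
      by (intro mult_left_mono) auto
    also have "\<dots> = C * jbr y powr a * (exp (-t) * exp (- (z\<^sup>2 / (8 * t))) * exp (t / 2 + z\<^sup>2 / (16 * t)))"
      by simp
    also have "exp (-t) * exp (- (z\<^sup>2 / (8 * t))) * exp (t / 2 + z\<^sup>2 / (16 * t)) = exp (-t/2) * exp (- (z\<^sup>2 / (16 * t)))"
      using t by (simp add: mult_exp_exp field_simps)
    finally show "exp (-t) * exp (- ((x - y)\<^sup>2 / (8 * t))) * jbr x powr a
      \<le> C * jbr y powr a * exp (-t/2) * exp (- ((x - y)\<^sup>2 / (16 * t)))"
      by (simp add: z_def mult.assoc)
  qed
qed

section \<open>The rectangle rule for periodic functions\<close>

text \<open>Averaging the sampling sum over all shifts within one step recovers the full integral.
  Below it serves both to show that the error has mean zero in the shift and to bring back the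
  \<open>L^1\<close> norm of the last derivative.\<close>

lemma integral_sum_translates:
  fixes f :: "real \<Rightarrow> real"
  assumes f: "continuous_on UNIV f" and h: "h \<ge> 0"
  shows "integral {0..h} (\<lambda>s. \<Sum>j<n. f (s + real j * h)) = integral {0..real n * h} f"
proof (induction n)
  case (Suc n)
  have cf: "continuous_on A f" for A using f continuous_on_subset by blast
  have "integral {0..h} (\<lambda>s. \<Sum>j<Suc n. f (s + real j * h)) =
     integral {0..h} (\<lambda>s. \<Sum>j<n. f (s + real j * h)) + integral {0..h} (\<lambda>s. f (s + real n * h))"
    unfolding sum.lessThan_Suc
    by (intro integral_add integrable_continuous_real continuous_on_sum
          continuous_on_compose2[OF f] continuous_intros) auto
  also have "integral {0..h} (\<lambda>s. f (s + real n * h)) = integral {real n * h..real n * h + h} f"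
  proof (rule integral_unique)
    have "(f has_integral integral {real n * h..real n * h + h} f) (cbox (real n * h) (real n * h + h))"
      using integrable_integral[OF integrable_continuous_real[OF cf, of "real n * h" "real n * h + h"]]
      by simp
    from has_integral_affinity[OF this, of 1 "real n * h"]
    show "((\<lambda>s. f (s + real n * h)) has_integral integral {real n * h..real n * h + h} f) {0..h}"
      by (simp add: image_minus_const_atLeastAtMost')
  qed
  also have "integral {0..h} (\<lambda>s. \<Sum>j<n. f (s + real j * h)) + \<dots> = integral {0..real n * h + h} f"
    unfolding Suc.IH using h
    by (intro Henstock_Kurzweil_Integration.integral_combine integrable_continuous_real cf) auto
  finally show ?case by (simp add: algebra_simps)
qed simp

text \<open>The error of the rectangle rule, as a function of the shift \<open>s\<close>, has mean zero over a
  step; hence it has a zero there and is bounded by the integral of its derivative, which is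
  the error for the derivative of the integrand.\<close>

lemma periodic_rectangle_rule_error:
  fixes F :: "nat \<Rightarrow> real \<Rightarrow> real" and n :: nat
  assumes der: "\<And>k x. (F k has_real_derivative F (Suc k) x) (at x)"
    and per: "\<And>k. F k L = F k 0"
    and L: "L > 0" and n: "n \<ge> 1" and h: "h = L / n"
    and s: "0 \<le> s" "s \<le> h"
  shows "\<bar>integral {0..L} (F 0) - h * (\<Sum>j<n. F 0 (s + real j * h))\<bar>
    \<le> h ^ Suc M * integral {0..L} (\<lambda>x. \<bar>F (Suc M) x\<bar>)"
proof -
  have h0: "h > 0" using L n h by simp
  have nh: "real n * h = L" using n h by simp
  define E where "E k s = integral {0..L} (F k) - h * (\<Sum>j<n. F k (s + real j * h))" for k s
  have cF: "continuous_on A (F k)" for A k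
    by (rule DERIV_continuous_on, rule has_field_derivative_at_within, rule der)
  have cE: "continuous_on A (E k)" for A k
    unfolding E_def by (intro continuous_intros continuous_on_compose2[OF cF[of UNIV]]) auto
  have int0: "integral {0..L} (F (Suc k)) = 0" for k
    using fundamental_theorem_of_calculus[of 0 L "F k" "F (Suc k)"] der L per[of k]
    by (intro integral_unique) (auto simp: has_real_derivative_iff_has_vector_derivative[symmetric]
        intro: has_field_derivative_at_within)
  have derE: "(E k has_real_derivative E (Suc k) s) (at s)" for k s
    unfolding E_def
    by (auto intro!: derivative_eq_intros DERIV_chain2[OF der] simp: int0 sum_distrib_left mult.commute)
  have mean0: "integral {0..h} (E k) = 0" for k
  proof -
    have "integral {0..h} (E k) = integral {0..h} (\<lambda>s. integral {0..L} (F k))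
        - integral {0..h} (\<lambda>s. h * (\<Sum>j<n. F k (s + real j * h)))"
      unfolding E_def
      by (intro integral_diff integrable_continuous_real continuous_intros
            continuous_on_compose2[OF cF[of UNIV]]) auto
    then show ?thesis
      using h0 integral_sum_translates[OF cF, of h k n] by (simp add: nh)
  qed
  \<comment> \<open>A continuous function of mean zero has a zero: Rolle's theorem for its
    primitive, which takes the same value at both ends.\<close>
  have zero: "\<exists>z\<in>{0..h}. E k z = 0" for k
  proof -
    define u where "u x = integral {0..x} (E k)" for x
    have du: "(u has_real_derivative E k x) (at x within {0..h})" if "x \<in> {0..h}" for x
      unfolding u_def by (rule integral_has_real_derivative[OF cE that])
    have "\<exists>z. 0 < z \<and> z < h \<and> (\<lambda>v. E k z * v) = (\<lambda>v. 0)"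
    proof (rule Rolle_deriv[OF h0])
      show "u 0 = u h" by (simp add: u_def mean0)
      show "continuous_on {0..h} u" using du by (rule DERIV_continuous_on)
      fix x assume "0 < x" "x < h"
      then show "(u has_derivative (\<lambda>v. E k x * v)) (at x)"
        using du[of x] at_within_interior[of x "{0..h}"]
        by (simp add: has_field_derivative_def)
    qed
    then show ?thesis
      by (metis atLeastAtMost_iff less_imp_le mult.right_neutral)
  qed
  \<comment> \<open>The mean of \<open>\<bar>E k\<bar>\<close> over a step is at most
    \<open>J (Suc k)\<close>, so every further derivative gains one factor \<open>h\<close>.\<close>
  define J where "J k = integral {0..h} (\<lambda>s. \<bar>E k s\<bar>)" for k
  have iE: "(\<lambda>s. \<bar>E k s\<bar>) integrable_on {a..b}" for k a b
    by (intro integrable_continuous_real continuous_intros cE)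
  have step: "\<bar>E k s\<bar> \<le> J (Suc k)" if "s \<in> {0..h}" for k s
  proof -
    have ord: "\<bar>E k b - E k a\<bar> \<le> J (Suc k)" if "0 \<le> a" "a \<le> b" "b \<le> h" for a b
    proof -
      have hi: "(E (Suc k) has_integral (E k b - E k a)) {a..b}"
        using that derE
        by (intro fundamental_theorem_of_calculus)
           (auto simp: has_real_derivative_iff_has_vector_derivative[symmetric]
              intro: has_field_derivative_at_within)
      have "\<bar>E k b - E k a\<bar> \<le> integral {a..b} (\<lambda>s. \<bar>E (Suc k) s\<bar>)"
        using integral_norm_bound_integral[of "E (Suc k)" "{a..b}" "\<lambda>s. \<bar>E (Suc k) s\<bar>"] hi iE
        by (auto simp: integral_unique has_integral_integrable)
      also have "\<dots> \<le> J (Suc k)"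
        unfolding J_def using that by (intro integral_subset_le iE) auto
      finally show ?thesis .
    qed
    obtain z where "z \<in> {0..h}" "E k z = 0" using zero by blast
    then show ?thesis
      using ord[of z s] ord[of s z] that by (cases "z \<le> s") auto
  qed
  have Jstep: "J k \<le> h * J (Suc k)" for k
  proof -
    have "J k \<le> integral {0..h} (\<lambda>s. J (Suc k))"
      unfolding J_def[of k] by (intro integral_le iE step) auto
    then show ?thesis using h0 by simp
  qed
  have Jpow: "J (Suc 0) \<le> h ^ M * J (Suc M)" for M
  proof (induction M)
    case (Suc M)
    have "h ^ M * J (Suc M) \<le> h ^ M * (h * J (Suc (Suc M)))"
      using h0 Jstep by (intro mult_left_mono) auto
    with Suc show ?case by (simp add: mult_ac)
  qed simp
  \<comment> \<open>For a derivative the integral over the period vanishes, so the error is just the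
    sampling sum, and no cancellation is lost by taking absolute values inside it.\<close>
  have "J (Suc M) \<le> integral {0..h} (\<lambda>s. h * (\<Sum>j<n. \<bar>F (Suc M) (s + real j * h)\<bar>))"
    unfolding J_def
  proof (intro integral_le iE)
    show "(\<lambda>s. h * (\<Sum>j<n. \<bar>F (Suc M) (s + real j * h)\<bar>)) integrable_on {0..h}"
      by (intro integrable_continuous_real continuous_intros continuous_on_compose2[OF cF[of UNIV]]) auto
    fix s
    show "\<bar>E (Suc M) s\<bar> \<le> h * (\<Sum>j<n. \<bar>F (Suc M) (s + real j * h)\<bar>)"
      using h0 by (auto simp: E_def int0 abs_mult intro!: sum_abs)
  qed
  also have "\<dots> = h * integral {0..L} (\<lambda>x. \<bar>F (Suc M) x\<bar>)"
    using integral_sum_translates[of "\<lambda>x. \<bar>F (Suc M) x\<bar>" h n] h0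
    by (simp add: nh cF continuous_on_rabs)
  finally have "h ^ M * J (Suc M) \<le> h ^ M * (h * integral {0..L} (\<lambda>x. \<bar>F (Suc M) x\<bar>))"
    using h0 by (intro mult_left_mono) auto
  moreover have "\<bar>E 0 s\<bar> \<le> J (Suc 0)" using step s by simp
  ultimately show ?thesis
    using Jpow[of M] by (simp add: E_def mult_ac)
qed

section \<open>The Moebius map and periodic lifts of functions on the line\<close>

lemma moebius_eq_tan:
  "moebius \<gamma> \<theta> = - \<gamma> * tan (pi / 2 - \<theta> / 2)"
  by (simp add: moebius_def cot_def tan_def sin_diff cos_diff)

lemma inj_on_moebius:
  assumes "\<gamma> > 0" shows "inj_on (moebius \<gamma>) {0<..<2 * pi}"
proof (rule inj_on_inverseI)
  fix \<theta> assume "\<theta> \<in> {0<..<2 * pi}"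
  then show "pi - 2 * arctan (- moebius \<gamma> \<theta> / \<gamma>) = \<theta>"
    using assms by (simp add: moebius_eq_tan arctan_tan)
qed

lemma moebius_image:
  assumes "\<gamma> > 0" shows "moebius \<gamma> ` {0<..<2 * pi} = UNIV"
proof (intro equalityI subsetI)
  fix x :: real
  have "x = moebius \<gamma> (pi - 2 * arctan (- x / \<gamma>))"
    using assms by (simp add: moebius_eq_tan diff_divide_distrib tan_arctan)
  moreover have "pi - 2 * arctan (- x / \<gamma>) \<in> {0<..<2 * pi}"
    using arctan_lbound[of "- x / \<gamma>"] arctan_ubound[of "- x / \<gamma>"] by auto
  ultimately show "x \<in> moebius \<gamma> ` {0<..<2 * pi}" by blast
qed simp

lemma moebius_sin2:
  assumes "sin (\<theta> / 2) \<noteq> 0"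
  shows "\<gamma>\<^sup>2 + (moebius \<gamma> \<theta>)\<^sup>2 = \<gamma>\<^sup>2 / (sin (\<theta> / 2))\<^sup>2"
proof -
  have "(cos (\<theta> / 2))\<^sup>2 = 1 - (sin (\<theta> / 2))\<^sup>2" by (simp add: cos_squared_eq)
  then show ?thesis
    using assms by (simp add: moebius_def cot_def power_mult_distrib power_divide field_simps)
      (simp add: distrib_left[symmetric])
qed

lemma moebius_jacobian:
  assumes "sin (\<theta> / 2) \<noteq> 0" "\<gamma> > 0"
  shows "moebius' \<gamma> \<theta> * (2 * \<gamma> / (\<gamma>\<^sup>2 + (moebius \<gamma> \<theta>)\<^sup>2)) = 1"
  unfolding moebius_sin2[OF assms(1)] moebius'_def
  using assms by (simp add: field_simps power2_eq_square)

text \<open>The derivative of the angle with respect to \<open>x\<close>. If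
  \<open>G' x * moebius_jac \<gamma> x\<close> is the derivative of \<open>G\<close> at
  \<open>x\<close>, then \<open>G'\<close> is the derivative of \<open>G\<close> in the angle, again
  expressed as a function on the line; all angular derivatives below are handled in this
  form.\<close>

abbreviation moebius_jac :: "real \<Rightarrow> real \<Rightarrow> real" where
  "moebius_jac \<gamma> x \<equiv> 2 * \<gamma> / (\<gamma>\<^sup>2 + x\<^sup>2)"

text \<open>The points where the sine vanishes correspond to infinity on the line. The value 0 there
  is the continuous extension for a decaying \<open>G\<close>; at those points
  \<open>moebius\<close> itself only has the default value coming from division by zero.\<close>

definition moebius_lift :: "real \<Rightarrow> (real \<Rightarrow> real) \<Rightarrow> real \<Rightarrow> real" where
  "moebius_lift \<gamma> G \<theta> = (if sin (\<theta> / 2) = 0 then 0 else G (moebius \<gamma> \<theta>))"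

text \<open>At a point over infinity, \<open>1 / (\<gamma>^2 + x^2)\<close> becomes
  \<open>(sin (\<theta> / 2))^2 / \<gamma>^2\<close>, so the decay of \<open>G\<close> makes the
  lift vanish to second order. Its derivative there is therefore 0, the value assigned to the lift
  of \<open>G'\<close>. In this way decay at infinity of every angular derivative yields a smooth
  periodic lift.\<close>

lemma moebius_lift_has_derivative:
  assumes g: "\<gamma> > 0"
    and der: "\<And>x. (G has_real_derivative G' x * moebius_jac \<gamma> x) (at x)"
    and bnd: "\<And>x. \<bar>G x\<bar> \<le> C / (\<gamma>\<^sup>2 + x\<^sup>2)"
  shows "(moebius_lift \<gamma> G has_real_derivative moebius_lift \<gamma> G' \<theta>) (at \<theta>)"
proof (cases "sin (\<theta> / 2) = 0")
  case False
  have op: "open {\<theta>::real. sin (\<theta> / 2) \<noteq> 0}"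
    by (intro open_Collect_neq continuous_intros) auto
  have "(moebius \<gamma> has_real_derivative moebius' \<gamma> \<theta>) (at \<theta>)"
    using False unfolding moebius_def[abs_def] moebius'_def
    by (auto intro!: derivative_eq_intros DERIV_chain2[OF DERIV_cot] simp: field_simps)
  then have "((\<lambda>\<theta>. G (moebius \<gamma> \<theta>)) has_real_derivative
      G' (moebius \<gamma> \<theta>) * (2 * \<gamma> / (\<gamma>\<^sup>2 + (moebius \<gamma> \<theta>)\<^sup>2)) * moebius' \<gamma> \<theta>) (at \<theta>)"
    by (rule DERIV_chain2[OF der])
  also have "G' (moebius \<gamma> \<theta>) * (2 * \<gamma> / (\<gamma>\<^sup>2 + (moebius \<gamma> \<theta>)\<^sup>2)) * moebius' \<gamma> \<theta>
      = G' (moebius \<gamma> \<theta>) * (moebius' \<gamma> \<theta> * (2 * \<gamma> / (\<gamma>\<^sup>2 + (moebius \<gamma> \<theta>)\<^sup>2)))"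
    by (simp only: mult_ac)
  also have "\<dots> = moebius_lift \<gamma> G' \<theta>"
    unfolding moebius_jacobian[OF False g] using False by (simp add: moebius_lift_def)
  finally show ?thesis
    by (rule has_field_derivative_transform_within_open[OF _ op]) (use False in \<open>auto simp: moebius_lift_def\<close>)
next
  case True
  have C0: "C \<ge> 0"
  proof -
    have "0 \<le> C / (\<gamma>\<^sup>2 + 0\<^sup>2)" using bnd[of 0] by (rule order.trans[OF abs_ge_zero])
    then show ?thesis using g by (simp add: zero_le_divide_iff)
  qed
  have b: "\<bar>moebius_lift \<gamma> G t\<bar> \<le> C / \<gamma>\<^sup>2 * (t - \<theta>)\<^sup>2" for t
  proof (cases "sin (t / 2) = 0")
    case False
    have "sin (t / 2) = sin ((t - \<theta>) / 2 + \<theta> / 2)" by (simp add: field_simps)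
    also have "\<dots> = sin ((t - \<theta>) / 2) * cos (\<theta> / 2)" by (simp only: sin_add True mult_zero_right add_0_right)
    finally have "\<bar>sin (t / 2)\<bar> \<le> \<bar>sin ((t - \<theta>) / 2)\<bar> * 1"
      by (simp only: abs_mult) (intro mult_left_mono, auto)
    also have "\<dots> \<le> \<bar>t - \<theta>\<bar>" using abs_sin_x_le_abs_x[of "(t - \<theta>) / 2"] by simp
    finally have "(sin (t / 2))\<^sup>2 \<le> (t - \<theta>)\<^sup>2" by (simp add: abs_le_square_iff)
    then have "C * (sin (t / 2))\<^sup>2 / \<gamma>\<^sup>2 \<le> C * (t - \<theta>)\<^sup>2 / \<gamma>\<^sup>2"
      using C0 by (intro divide_right_mono mult_left_mono) auto
    moreover have "\<bar>moebius_lift \<gamma> G t\<bar> \<le> C * (sin (t / 2))\<^sup>2 / \<gamma>\<^sup>2"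
      using bnd[of "moebius \<gamma> t"] False by (simp add: moebius_lift_def moebius_sin2)
    ultimately show ?thesis by simp
  qed (use C0 in \<open>simp add: moebius_lift_def\<close>)
  have c0: "moebius_lift \<gamma> G \<theta> = 0" "moebius_lift \<gamma> G' \<theta> = 0" using True by (simp_all add: moebius_lift_def)
  have "((\<lambda>t. (moebius_lift \<gamma> G t - moebius_lift \<gamma> G \<theta>) / (t - \<theta>)) \<longlongrightarrow> 0) (at \<theta>)"
  proof (rule Lim_null_comparison)
    show "\<forall>\<^sub>F t in at \<theta>. norm ((moebius_lift \<gamma> G t - moebius_lift \<gamma> G \<theta>) / (t - \<theta>)) \<le> C / \<gamma>\<^sup>2 * \<bar>t - \<theta>\<bar>"
    proof (rule eventually_mono[OF eventually_neq_at_within])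
      fix t assume "t \<noteq> \<theta>"
      then show "norm ((moebius_lift \<gamma> G t - moebius_lift \<gamma> G \<theta>) / (t - \<theta>)) \<le> C / \<gamma>\<^sup>2 * \<bar>t - \<theta>\<bar>"
        using b[of t] by (simp add: c0 divide_le_eq power2_eq_square abs_mult[symmetric])
           (simp add: abs_mult mult.assoc)
    qed
    show "((\<lambda>t. C / \<gamma>\<^sup>2 * \<bar>t - \<theta>\<bar>) \<longlongrightarrow> 0) (at \<theta>)"
      using tendsto_mult_right_zero[of "\<lambda>t. \<bar>t - \<theta>\<bar>" "at \<theta>" "C / \<gamma>\<^sup>2"]
      by (simp add: LIM_zero tendsto_rabs_zero)
  qed
  then show ?thesis by (simp add: has_field_derivative_iff c0)
qed

lemma moebius_lift_periodic: "moebius_lift \<gamma> G (2 * pi) = moebius_lift \<gamma> G 0"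
  by (simp add: moebius_lift_def)

text \<open>The change of variables is applied to \<open>G x * moebius_jac \<gamma> x\<close> on the
  open interval. Integrability on the line is part of its outcome, since the lift is continuous on
  the compact interval.\<close>

lemma integral_moebius_lift:
  fixes G :: "real \<Rightarrow> real"
  assumes g: "\<gamma> > 0" and c: "continuous_on UNIV (moebius_lift \<gamma> G)"
    and m: "G \<in> borel_measurable borel"
  shows "integral {0..2 * pi} (moebius_lift \<gamma> G) = (LINT x|lborel. G x * moebius_jac \<gamma> x)"
    and "integrable lborel (\<lambda>x. G x * moebius_jac \<gamma> x)"
proof -
  define S where "S = {0<..<2 * pi}"
  define f where "f x = G x * moebius_jac \<gamma> x" for x
  have sin0: "sin (\<theta> / 2) > 0" if "\<theta> \<in> S" for \<theta>
    using that by (intro sin_gt_zero) (auto simp: S_def)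
  have eq: "\<bar>moebius' \<gamma> \<theta>\<bar> * f (moebius \<gamma> \<theta>) = moebius_lift \<gamma> G \<theta>" if "\<theta> \<in> S" for \<theta>
  proof -
    have "\<bar>moebius' \<gamma> \<theta>\<bar> = moebius' \<gamma> \<theta>" using g by (simp add: moebius'_def)
    then have "\<bar>moebius' \<gamma> \<theta>\<bar> * f (moebius \<gamma> \<theta>)
      = G (moebius \<gamma> \<theta>) * (moebius' \<gamma> \<theta> * (2 * \<gamma> / (\<gamma>\<^sup>2 + (moebius \<gamma> \<theta>)\<^sup>2)))"
      unfolding f_def by (simp only: mult_ac)
    also have "\<dots> = moebius_lift \<gamma> G \<theta>"
      using sin0[OF that] g by (subst moebius_jacobian) (auto simp: moebius_lift_def)
    finally show ?thesis .
  qed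
  have cs: "moebius_lift \<gamma> G absolutely_integrable_on {0..2 * pi}"
    using c by (intro absolutely_integrable_continuous_real) (auto intro: continuous_on_subset)
  have cS: "moebius_lift \<gamma> G absolutely_integrable_on S"
    by (rule set_integrable_subset[OF cs]) (auto simp: S_def)
  then have "(\<lambda>\<theta>. \<bar>moebius' \<gamma> \<theta>\<bar> * f (moebius \<gamma> \<theta>)) absolutely_integrable_on S"
    by (rule set_integrable_cong[THEN iffD2, rotated -1]) (auto simp: eq)
  moreover have "integral S (\<lambda>\<theta>. \<bar>moebius' \<gamma> \<theta>\<bar> * f (moebius \<gamma> \<theta>)) = integral S (moebius_lift \<gamma> G)"
    by (rule Henstock_Kurzweil_Integration.integral_cong) (rule eq)
  moreover have "(moebius \<gamma> has_field_derivative moebius' \<gamma> \<theta>) (at \<theta> within S)" if "\<theta> \<in> S" for \<theta>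
    using that moebius_has_derivative[of \<theta> \<gamma>] by (auto simp: S_def intro: has_field_derivative_at_within)
  ultimately have *: "f absolutely_integrable_on UNIV \<and> integral UNIV f = integral S (moebius_lift \<gamma> G)"
    using has_absolute_integral_change_of_variables_1'[of S "moebius \<gamma>" "moebius' \<gamma>" f "integral S (moebius_lift \<gamma> G)"]
      inj_on_moebius[OF g] moebius_image[OF g] by (auto simp: S_def)
  have fm: "f \<in> borel_measurable borel"
    unfolding f_def[abs_def] using m by measurable
  then show i: "integrable lborel (\<lambda>x. G x * moebius_jac \<gamma> x)"
    using * by (simp add: set_integrable_def integrable_completion f_def[abs_def])
  have "integral {0..2 * pi} (moebius_lift \<gamma> G) = integral S (moebius_lift \<gamma> G)"
    unfolding S_def by (simp add: integral_open_interval_real)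
  also have "\<dots> = integral UNIV f" using * by simp
  also have "\<dots> = (LINT x|lborel. f x)"
    using i by (intro integral_lborel) (simp add: f_def[abs_def])
  finally show "integral {0..2 * pi} (moebius_lift \<gamma> G) = (LINT x|lborel. G x * moebius_jac \<gamma> x)"
    by (simp add: f_def)
qed

lemma node_bounds:
  assumes "n \<ge> 1" "j \<in> {1..n}"
  shows "0 < node n j" "node n j < 2 * pi"
proof -
  have e: "node n j = pi * (2 * real j - 1) / real n"
    by (simp add: node_def diff_divide_distrib algebra_simps)
  have "1 \<le> real j" "real j \<le> real n" "real n > 0" using assms by auto
  then show "0 < node n j" "node n j < 2 * pi"
    unfolding e by (auto simp: divide_less_eq intro!: divide_pos_pos mult_pos_pos)
qed

lemma moebius_trapezoid_error:
  fixes G :: "nat \<Rightarrow> real \<Rightarrow> real"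
  assumes g: "\<gamma> > 0" and n: "n \<ge> 1" and M: "M \<ge> 1"
    and der: "\<And>k x. (G k has_real_derivative G (Suc k) x * moebius_jac \<gamma> x) (at x)"
    and bnd: "\<And>k. \<exists>C. \<forall>x. \<bar>G k x\<bar> \<le> C / (\<gamma>\<^sup>2 + x\<^sup>2)"
  shows "\<bar>(LINT x|lborel. G 0 x * moebius_jac \<gamma> x)
      - 2 * pi / n * (\<Sum>j=1..n. G 0 (moebius \<gamma> (node n j)))\<bar>
    \<le> (2 * pi / n) ^ M * (LINT x|lborel. \<bar>G M x\<bar> * moebius_jac \<gamma> x)"
proof -
  define F where "F k = moebius_lift \<gamma> (G k)" for k
  have derF: "(F k has_real_derivative F (Suc k) x) (at x)" for k x
    using bnd[of k] moebius_lift_has_derivative[OF g der] unfolding F_def by blast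
  have cF: "continuous_on UNIV (F k)" for k
    by (rule DERIV_continuous_on, rule has_field_derivative_at_within, rule derF)
  have cG: "continuous_on UNIV (G k)" for k
    by (rule DERIV_continuous_on, rule has_field_derivative_at_within, rule der)
  then have mG: "G k \<in> borel_measurable borel" for k
    by (rule borel_measurable_continuous_onI)
  have absF: "moebius_lift \<gamma> (\<lambda>x. \<bar>G k x\<bar>) = (\<lambda>x. \<bar>F k x\<bar>)" for k
    by (auto simp: F_def moebius_lift_def)
  obtain N where N: "M = Suc N" using M by (cases M) auto
  \<comment> \<open>The nodes are those of the rectangle rule with step \<open>2 * pi / n\<close>
    shifted by half a step, which keeps them away from the points over infinity.\<close>
  have "\<bar>integral {0..2 * pi} (F 0) - 2 * pi / n * (\<Sum>j<n. F 0 (pi / n + real j * (2 * pi / n)))\<bar>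
    \<le> (2 * pi / n) ^ Suc N * integral {0..2 * pi} (\<lambda>x. \<bar>F (Suc N) x\<bar>)"
    using n by (intro periodic_rectangle_rule_error[where F = F and L = "2 * pi" and n = n])
       (auto intro: derF[unfolded F_def] simp: F_def moebius_lift_periodic divide_right_mono)
  moreover have "(\<Sum>j<n. F 0 (pi / n + real j * (2 * pi / n))) = (\<Sum>j=1..n. F 0 (node n j))"
  proof -
    have "(\<Sum>j=1..n. F 0 (node n j)) = (\<Sum>j<n. F 0 (node n (Suc j)))"
      by (rule sum.reindex_bij_witness[of _ Suc "\<lambda>j. j - 1"]) auto
    moreover have "node n (Suc j) = pi / n + real j * (2 * pi / n)" for j
      using n by (simp add: node_def distrib_left add_divide_distrib)
    ultimately show ?thesis by simp
  qed
  moreover have "(\<Sum>j=1..n. F 0 (node n j)) = (\<Sum>j=1..n. G 0 (moebius \<gamma> (node n j)))"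
  proof (rule sum.cong[OF refl])
    fix j assume j: "j \<in> {1..n}"
    have "sin (node n j / 2) > 0"
      using node_bounds[OF n j] by (intro sin_gt_zero) auto
    then show "F 0 (node n j) = G 0 (moebius \<gamma> (node n j))"
      by (simp add: F_def moebius_lift_def)
  qed
  moreover have "integral {0..2 * pi} (F 0) = (LINT x|lborel. G 0 x * moebius_jac \<gamma> x)"
    unfolding F_def by (rule integral_moebius_lift[OF g cF[unfolded F_def] mG])
  moreover have "integral {0..2 * pi} (\<lambda>x. \<bar>F M x\<bar>) = (LINT x|lborel. \<bar>G M x\<bar> * moebius_jac \<gamma> x)"
    unfolding absF[symmetric]
    by (rule integral_moebius_lift[OF g]) (use mG in \<open>auto simp: absF intro!: continuous_intros cF\<close>)
  ultimately show ?thesis by (simp add: N)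
qed

section \<open>Smooth error estimate for the heat kernel\<close>

text \<open>The heat kernel at time \<open>t\<close>, damped by \<open>exp (- t)\<close>, without
  its factor \<open>1 / sqrt (4 * pi)\<close>; that factor is moved to \<open>bessel_const\<close>.
  The damping turns the symbol \<open>exp (- t * \<xi>^2)\<close> into
  \<open>exp (- t * (1 + \<xi>^2))\<close>, as subordination for the Bessel multiplier
  requires.\<close>

definition heat :: "real \<Rightarrow> real \<Rightarrow> real" where
  "heat t z = exp (- t) * t powr (- 1 / 2) * exp (- (z\<^sup>2 / (4 * t)))"

definition quad_err :: "real poly \<Rightarrow> real \<Rightarrow> real \<Rightarrow> nat \<Rightarrow> real \<Rightarrow> real \<Rightarrow> real" where
  "quad_err q \<gamma> \<upsilon> n t y =
     (LINT x|lborel. heat t (x - y) * weight q \<upsilon> x) -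
     2 * pi / real n * (\<Sum>j=1..n. heat t (moebius \<gamma> (node n j) - y) *
        (weight q \<upsilon> (moebius \<gamma> (node n j)) * moebius' \<gamma> (node n j)))"

lemma heat_nonneg: "0 \<le> heat t z"
  by (simp add: heat_def)

text \<open>Functions of \<open>x\<close> with parameters \<open>t\<close> and \<open>y\<close>: iterated derivatives, with respect to
  the angle, of the transformed integrand \<open>heat t (x - y) * weight q \<upsilon> x * moebius' \<gamma> \<theta>\<close>.
  Each derivative costs growth \<open>2\<close> in \<open>x\<close> and a factor \<open>1 / sqrt t\<close>.\<close>

inductive heat_term :: "real poly \<Rightarrow> nat \<Rightarrow> real \<Rightarrow> nat \<Rightarrow> (real \<Rightarrow> real \<Rightarrow> real \<Rightarrow> real) \<Rightarrow> bool"
  for q :: "real poly" and m :: nat and a :: real where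
  base: "real (degree A) + 2 * real m * s \<le> a + 2 * real N \<Longrightarrow> l \<le> N \<Longrightarrow>
    heat_term q m a N (\<lambda>t y x. poly A x * poly q x powr s * poly B ((x - y) / sqrt t) *
      (1 / sqrt t) ^ l * exp (- ((x - y)\<^sup>2 / (4 * t))))"
| add: "heat_term q m a N F \<Longrightarrow> heat_term q m a N F' \<Longrightarrow> heat_term q m a N (\<lambda>t y x. F t y x + F' t y x)"

text \<open>The reciprocal Jacobian is a quadratic polynomial. Passing to the angular derivative
  thus multiplies by a polynomial, which stays within \<open>heat_term\<close> and explains the
  growth 2 per derivative.\<close>

lemma poly_moebius_jacobian:
  fixes \<gamma> x :: real
  assumes "\<gamma> > 0"
  shows "poly [:\<gamma> / 2, 0, 1 / (2 * \<gamma>):] x * moebius_jac \<gamma> x = 1"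
proof -
  have "\<gamma>\<^sup>2 + x\<^sup>2 > 0" using assms zero_le_power2[of x] zero_less_power[of \<gamma> 2] by linarith
  moreover have "poly [:\<gamma> / 2, 0, 1 / (2 * \<gamma>):] x = (\<gamma>\<^sup>2 + x\<^sup>2) / (2 * \<gamma>)"
    using assms by (simp add: field_simps power2_eq_square)
  ultimately show ?thesis using assms by simp
qed

text \<open>A derivative falling on \<open>poly A x * poly q x powr s\<close> produces no factor
  \<open>1 / sqrt t\<close>, one falling on the functions of \<open>(x - y) / sqrt t\<close>
  produces exactly one. For this reason \<open>heat_term\<close> asks for \<open>l \<le> N\<close>
  and not for equality.\<close>

lemma heat_term_derivative:
  assumes g: "\<gamma> > 0" and deg: "degree q = 2 * m" and pos: "\<And>x. poly q x > 0"
    and F: "heat_term q m a N F"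
  shows "\<exists>F'. heat_term q m a (Suc N) F' \<and>
    (\<forall>t>0. \<forall>y x. (F t y has_real_derivative F' t y x * moebius_jac \<gamma> x) (at x))"
  using F
proof induction
  case (base A s N l B)
  define P where "P = [:\<gamma> / 2, 0, 1 / (2 * \<gamma>):]"
  have P: "poly P x * moebius_jac \<gamma> x = 1" for x
    unfolding P_def by (rule poly_moebius_jacobian[OF g])
  have dP: "degree P \<le> 2" by (simp add: P_def)
  \<comment> \<open>\<open>A1\<close> is what remains of the derivative of the polynomial part after
    \<open>poly q x powr (s - 1)\<close> is factored out: the drop of \<open>s\<close> by 1 balances
    the \<open>2 * m\<close> gained in degree. \<open>B2\<close> comes from differentiating
    \<open>poly B u * exp (- (u^2 / 4))\<close> with respect to \<open>u\<close>.\<close>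
  define A1 where "A1 = P * (pderiv A * q + smult s (A * pderiv q))"
  define B2 where "B2 = pderiv B - smult (1/2) (pCons 0 B)"
  define F1 where "F1 t y x = poly A1 x * poly q x powr (s - 1) * poly B ((x - y) / sqrt t) *
      (1 / sqrt t) ^ l * exp (- ((x - y)\<^sup>2 / (4 * t)))" for t y x :: real
  define F2 where "F2 t y x = poly (P * A) x * poly q x powr s * poly B2 ((x - y) / sqrt t) *
      (1 / sqrt t) ^ Suc l * exp (- ((x - y)\<^sup>2 / (4 * t)))" for t y x :: real
  have "degree (pderiv A * q + smult s (A * pderiv q)) \<le> degree A + 2 * m"
  proof (rule degree_add_le)
    show "degree (pderiv A * q) \<le> degree A + 2 * m"
      by (rule order.trans[OF degree_mult_le]) (simp add: deg degree_pderiv)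
    show "degree (smult s (A * pderiv q)) \<le> degree A + 2 * m"
      by (rule order.trans[OF degree_smult_le], rule order.trans[OF degree_mult_le])
         (simp add: deg degree_pderiv)
  qed
  then have "degree A1 \<le> 2 + (degree A + 2 * m)"
    unfolding A1_def using dP by (intro order.trans[OF degree_mult_le] add_mono)
  then have dA1: "real (degree A1) \<le> 2 + degree A + 2 * real m" by linarith
  have "degree (P * A) \<le> 2 + degree A"
    using dP by (intro order.trans[OF degree_mult_le] add_mono) auto
  then have dA2: "real (degree (P * A)) \<le> 2 + real (degree A)" by linarith
  have "heat_term q m a (Suc N) F1"
    unfolding F1_def using base dA1 by (intro heat_term.base) (auto simp: algebra_simps)
  moreover have "heat_term q m a (Suc N) F2"
    unfolding F2_def using base dA2 by (intro heat_term.base) (auto simp: algebra_simps)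
  ultimately have "heat_term q m a (Suc N) (\<lambda>t y x. F1 t y x + F2 t y x)"
    by (rule heat_term.add)
  moreover have "((\<lambda>x. poly A x * poly q x powr s * poly B ((x - y) / sqrt t) *
      (1 / sqrt t) ^ l * exp (- ((x - y)\<^sup>2 / (4 * t)))) has_real_derivative
      (F1 t y x + F2 t y x) * moebius_jac \<gamma> x) (at x)" if t: "t > 0" for t y x
  proof -
    define u e where "u = (x - y) / sqrt t" and "e = exp (- ((x - y)\<^sup>2 / (4 * t)))"
    have d1: "((\<lambda>x. poly A x * poly q x powr s) has_real_derivative
        (poly (pderiv A) x * poly q x powr s + poly A x * (s * poly q x powr (s - 1) * poly (pderiv q) x))) (at x)"
      using pos[of x] by (auto intro!: derivative_eq_intros simp: algebra_simps)
    have qs: "poly q x powr s = poly q x * poly q x powr (s - 1)"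
      using pos[of x] by (simp add: powr_diff)
    have d2: "((\<lambda>x. poly B ((x - y) / sqrt t)) has_real_derivative (poly (pderiv B) u * (1 / sqrt t))) (at x)"
      unfolding u_def by (rule DERIV_chain2[OF poly_DERIV DERIV_cdivide]) (auto intro!: derivative_eq_intros)
    have d3: "((\<lambda>x. exp (- ((x - y)\<^sup>2 / (4 * t)))) has_real_derivative (e * (- (u / 2) * (1 / sqrt t)))) (at x)"
    proof -
      have "u * (1 / sqrt t) = (x - y) / t" using t by (simp add: u_def)
      then have "- (u / 2) * (1 / sqrt t) = - (1 / 2) * ((x - y) / t)" by simp
      also have "\<dots> = - (2 * (x - y) / (4 * t))" using t by (simp add: field_simps)
      finally have "- (u / 2) * (1 / sqrt t) = - (2 * (x - y) / (4 * t))" .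
      moreover have "((\<lambda>x. - ((x - y)\<^sup>2 / (4 * t))) has_real_derivative - (2 * (x - y) / (4 * t))) (at x)"
        by (intro DERIV_minus DERIV_cdivide) (auto intro!: derivative_eq_intros)
      ultimately show ?thesis
        unfolding e_def by (metis DERIV_fun_exp)
    qed
    have "((\<lambda>x. poly A x * poly q x powr s * poly B ((x - y) / sqrt t) *
      (1 / sqrt t) ^ l * exp (- ((x - y)\<^sup>2 / (4 * t)))) has_real_derivative
        ((poly (pderiv A) x * poly q x powr s + poly A x * (s * poly q x powr (s - 1) * poly (pderiv q) x)) * poly B u * (1 / sqrt t) ^ l * e
        + poly A x * poly q x powr s * (poly (pderiv B) u * (1 / sqrt t)) * (1 / sqrt t) ^ l * e
        + poly A x * poly q x powr s * poly B u * (1 / sqrt t) ^ l * (e * (- (u / 2) * (1 / sqrt t))))) (at x)"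
      by (rule derivative_eq_intros d1 d2 d3 refl | simp add: u_def[symmetric] e_def[symmetric])+
         (simp add: algebra_simps)
    also have "(poly (pderiv A) x * poly q x powr s + poly A x * (s * poly q x powr (s - 1) * poly (pderiv q) x)) * poly B u * (1 / sqrt t) ^ l * e
        + poly A x * poly q x powr s * (poly (pderiv B) u * (1 / sqrt t)) * (1 / sqrt t) ^ l * e
        + poly A x * poly q x powr s * poly B u * (1 / sqrt t) ^ l * (e * (- (u / 2) * (1 / sqrt t)))
      = (poly (pderiv A * q + smult s (A * pderiv q)) x * poly q x powr (s - 1) * poly B u * (1 / sqrt t) ^ l * e
         + poly A x * poly q x powr s * poly B2 u * (1 / sqrt t) ^ Suc l * e)"
      unfolding qs B2_def by (simp add: algebra_simps)
    also have "\<dots> = \<dots> * (poly P x * moebius_jac \<gamma> x)"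
      unfolding P by simp
    also have "\<dots> = (F1 t y x + F2 t y x) * moebius_jac \<gamma> x"
      unfolding F1_def F2_def A1_def u_def[symmetric] e_def[symmetric] poly_mult[of P] by (simp only: algebra_simps)
    finally show ?thesis .
  qed
  ultimately show ?case by blast
next
  case (add N F F')
  from add.IH obtain D D' where D: "heat_term q m a (Suc N) D" "heat_term q m a (Suc N) D'"
     "\<And>t y x. t > 0 \<Longrightarrow> (F t y has_real_derivative D t y x * moebius_jac \<gamma> x) (at x)"
     "\<And>t y x. t > 0 \<Longrightarrow> (F' t y has_real_derivative D' t y x * moebius_jac \<gamma> x) (at x)"
    by blast
  have "((\<lambda>x. F t y x + F' t y x) has_real_derivative (D t y x + D' t y x) * moebius_jac \<gamma> x) (at x)"
    if "t > 0" for t y x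
    unfolding distrib_right by (intro DERIV_add D that)
  then show ?case
    using heat_term.add[OF D(1,2)] by (intro exI[of _ "\<lambda>t y x. D t y x + D' t y x"]) simp
qed

text \<open>The Gaussian \<open>exp (- (u^2 / 4))\<close> is spent in two stages: half of it on the
  polynomial \<open>B\<close>, then half of the rest, together with half of the damping, on moving
  the weight from \<open>x\<close> to \<open>y\<close>. The other half of the damping makes up for a
  power \<open>l\<close> smaller than \<open>N\<close> when \<open>t\<close> is large.\<close>

lemma heat_term_bound:
  assumes deg: "degree q = 2 * m" and pos: "\<And>x. poly q x > 0" and F: "heat_term q m a N F"
  shows "\<exists>C>0. \<forall>t>0. \<forall>y x. exp (- t) * \<bar>F t y x\<bar> * jbr x powr d
    \<le> C * jbr y powr (a + 2 * real N + d) * (1 / sqrt t) ^ N * exp (- ((x - y)\<^sup>2 / (16 * t)))"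
  using F
proof induction
  case (base A s N l B)
  define b where "b = a + 2 * real N"
  obtain C1 where C1: "C1 > 0" "\<And>x. \<bar>poly A x\<bar> \<le> C1 * jbr x ^ degree A"
    using poly_le_jbr_power[of A "degree A"] by auto
  obtain C2 where C2: "C2 > 0" "\<And>x. poly q x powr s \<le> C2 * jbr x powr (2 * real m * s)"
    using poly_powr_le_jbr_powr[OF deg pos, of s] by metis
  obtain C3 where C3: "C3 > 0" "\<And>u::real. \<bar>poly B u\<bar> * exp (- (u\<^sup>2 / 4)) \<le> C3 * exp (- (u\<^sup>2 / 8))"
    using poly_gauss_bound[of B] by auto
  obtain C4 where C4: "C4 > 0" "\<And>t x y. t > 0 \<Longrightarrow> exp (-t) * exp (- ((x - y)\<^sup>2 / (8 * t))) * jbr x powr (b + d)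
      \<le> C4 * jbr y powr (b + d) * exp (-t/2) * exp (- ((x - y)\<^sup>2 / (16 * t)))"
    using gauss_jbr_bound[of "b + d"] by blast
  obtain C5 where C5: "C5 > 0" "\<And>x. 0 \<le> x \<Longrightarrow> (1 + x) powr ((N - l) / 2) \<le> C5 * exp (1/2 * x)"
    using powr_le_exp[of "1/2" "(N - l) / 2"] by auto
  let ?C = "C1 * C2 * C3 * C4 * C5"
  show ?case
  proof (intro exI[of _ ?C] conjI allI impI)
    show "?C > 0" using C1 C2 C3 C4 C5 by simp
    fix t y x :: real assume t: "t > 0"
    define u where "u = (x - y) / sqrt t"
    have u2: "u\<^sup>2 = (x - y)\<^sup>2 / t" using t by (simp add: u_def power_divide)
    have "\<bar>poly A x\<bar> * poly q x powr s \<le> (C1 * jbr x ^ degree A) * (C2 * jbr x powr (2 * real m * s))"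
      using C1 C2 by (intro mult_mono) auto
    also have "\<dots> = C1 * C2 * jbr x powr (degree A + 2 * real m * s)"
      by (simp add: powr_add powr_realpow)
    also have "\<dots> \<le> C1 * C2 * jbr x powr b"
      using C1 C2 base jbr_ge_1[of x] by (intro mult_left_mono powr_mono) (auto simp: b_def)
    finally have e1: "\<bar>poly A x\<bar> * poly q x powr s \<le> C1 * C2 * jbr x powr b" .
    have e2: "\<bar>poly B u\<bar> * exp (- ((x - y)\<^sup>2 / (4 * t))) \<le> C3 * exp (- ((x - y)\<^sup>2 / (8 * t)))"
      using C3(2)[of u] by (simp add: u2 mult.commute)
    \<comment> \<open>Replacing \<open>(1 / sqrt t) ^ l\<close> by \<open>(1 / sqrt t) ^ N\<close>
      loses the factor \<open>sqrt t ^ (N - l)\<close>, unbounded only for large \<open>t\<close>,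
      where \<open>exp (- t / 2)\<close> controls it.\<close>
    have "sqrt t ^ (N - l) = t powr ((N - l) / 2)"
      using t by (simp add: powr_half_sqrt[symmetric] powr_realpow[symmetric] powr_powr)
    also have "\<dots> \<le> (1 + t) powr ((N - l) / 2)" using t by (intro powr_mono2) auto
    also have "\<dots> \<le> C5 * exp (t / 2)" using C5(2)[of t] t by simp
    finally have "exp (-t/2) * sqrt t ^ (N - l) \<le> exp (-t/2) * (C5 * exp (t / 2))"
      by (intro mult_left_mono) auto
    also have "\<dots> = C5" by (simp add: mult.left_commute mult_exp_exp)
    finally have "exp (-t/2) * sqrt t ^ (N - l) \<le> C5" .
    then have "exp (-t/2) * sqrt t ^ (N - l) * (1 / sqrt t) ^ N \<le> C5 * (1 / sqrt t) ^ N"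
      using t by (intro mult_right_mono) auto
    moreover have "(1 / sqrt t) ^ N = (1 / sqrt t) ^ (N - l) * (1 / sqrt t) ^ l"
      using base(2) by (simp add: power_add[symmetric])
    moreover have "sqrt t ^ (N - l) * (1 / sqrt t) ^ (N - l) = 1"
      using t by (simp add: power_mult_distrib[symmetric])
    ultimately have e3: "exp (-t/2) * (1 / sqrt t) ^ l \<le> C5 * (1 / sqrt t) ^ N"
      by (metis (no_types, lifting) mult.assoc mult.left_neutral)
    have "exp (- t) * \<bar>poly A x * poly q x powr s * poly B ((x - y) / sqrt t) * (1 / sqrt t) ^ l *
        exp (- ((x - y)\<^sup>2 / (4 * t)))\<bar> * jbr x powr d
      = exp (- t) * (\<bar>poly A x\<bar> * poly q x powr s) * (\<bar>poly B u\<bar> * exp (- ((x - y)\<^sup>2 / (4 * t)))) * (1 / sqrt t) ^ l * jbr x powr d"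
      using t by (simp add: abs_mult u_def power_abs)
    also have "\<dots> \<le> exp (- t) * (C1 * C2 * jbr x powr b) * (C3 * exp (- ((x - y)\<^sup>2 / (8 * t)))) * (1 / sqrt t) ^ l * jbr x powr d"
      using C1 C2 C3 t by (intro mult_right_mono mult_left_mono mult_mono e1 e2) auto
    also have "\<dots> = C1 * C2 * C3 * (1 / sqrt t) ^ l * (exp (-t) * exp (- ((x - y)\<^sup>2 / (8 * t))) * jbr x powr (b + d))"
      by (simp add: powr_add)
    also have "\<dots> \<le> C1 * C2 * C3 * (1 / sqrt t) ^ l * (C4 * jbr y powr (b + d) * exp (-t/2) * exp (- ((x - y)\<^sup>2 / (16 * t))))"
      using C1 C2 C3 t by (intro mult_left_mono C4) auto
    also have "\<dots> = C1 * C2 * C3 * C4 * jbr y powr (b + d) * exp (- ((x - y)\<^sup>2 / (16 * t))) * (exp (-t/2) * (1 / sqrt t) ^ l)"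
      by (simp only: mult_ac)
    also have "\<dots> \<le> C1 * C2 * C3 * C4 * jbr y powr (b + d) * exp (- ((x - y)\<^sup>2 / (16 * t))) * (C5 * (1 / sqrt t) ^ N)"
      using C1 C2 C3 C4 by (intro mult_left_mono e3) auto
    finally show "exp (- t) * \<bar>poly A x * poly q x powr s * poly B ((x - y) / sqrt t) * (1 / sqrt t) ^ l *
        exp (- ((x - y)\<^sup>2 / (4 * t)))\<bar> * jbr x powr d
      \<le> ?C * jbr y powr (a + 2 * real N + d) * (1 / sqrt t) ^ N * exp (- ((x - y)\<^sup>2 / (16 * t)))"
      by (simp only: mult_ac b_def)
  qed
next
  case (add N F F')
  from add.IH(1) obtain C where C: "C > 0"
    "\<forall>t>0. \<forall>y x. exp (- t) * \<bar>F t y x\<bar> * jbr x powr d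
      \<le> C * jbr y powr (a + 2 * real N + d) * (1 / sqrt t) ^ N * exp (- ((x - y)\<^sup>2 / (16 * t)))"
    by (elim exE conjE)
  from add.IH(2) obtain C' where C': "C' > 0"
    "\<forall>t>0. \<forall>y x. exp (- t) * \<bar>F' t y x\<bar> * jbr x powr d
      \<le> C' * jbr y powr (a + 2 * real N + d) * (1 / sqrt t) ^ N * exp (- ((x - y)\<^sup>2 / (16 * t)))"
    by (elim exE conjE)
  show ?case
  proof (intro exI[of _ "C + C'"] conjI allI impI)
    show "C + C' > 0" using C(1) C'(1) by simp
    fix t y x :: real assume t: "t > 0"
    have "exp (- t) * \<bar>F t y x + F' t y x\<bar> * jbr x powr d
      \<le> exp (- t) * (\<bar>F t y x\<bar> + \<bar>F' t y x\<bar>) * jbr x powr d"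
      by (intro mult_right_mono mult_left_mono) auto
    moreover have "exp (- t) * \<bar>F t y x\<bar> * jbr x powr d
      \<le> C * jbr y powr (a + 2 * real N + d) * (1 / sqrt t) ^ N * exp (- ((x - y)\<^sup>2 / (16 * t)))"
      "exp (- t) * \<bar>F' t y x\<bar> * jbr x powr d
      \<le> C' * jbr y powr (a + 2 * real N + d) * (1 / sqrt t) ^ N * exp (- ((x - y)\<^sup>2 / (16 * t)))"
      using C(2) C'(2) t by auto
    ultimately show "exp (- t) * \<bar>F t y x + F' t y x\<bar> * jbr x powr d
      \<le> (C + C') * jbr y powr (a + 2 * real N + d) * (1 / sqrt t) ^ N * exp (- ((x - y)\<^sup>2 / (16 * t)))"
      by (simp add: algebra_simps)
  qed
qed

lemma gauss_exp_integral:
  fixes s y :: real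
  assumes "s > 0"
  shows "integrable lborel (\<lambda>x. exp (- ((x - y)\<^sup>2 / (2 * s))))"
    and "(LINT x|lborel. exp (- ((x - y)\<^sup>2 / (2 * s)))) = sqrt (2 * pi * s)"
proof -
  have e: "exp (- ((x - y)\<^sup>2 / (2 * s))) = sqrt (2 * pi * s) * normal_density y (sqrt s) x" for x
    using assms by (simp add: normal_density_def)
  show "integrable lborel (\<lambda>x. exp (- ((x - y)\<^sup>2 / (2 * s))))"
    unfolding e using assms by (intro integrable_mult_right integrable_normal_density) auto
  show "(LINT x|lborel. exp (- ((x - y)\<^sup>2 / (2 * s)))) = sqrt (2 * pi * s)"
    unfolding e using assms by (simp add: integral_normal_density)
qed

text \<open>The transformed integrand has growth \<open>2 - \<upsilon>\<close>: the weight gives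
  \<open>- \<upsilon>\<close> and the reciprocal Jacobian 2, which the Jacobian in the final
  integral takes back. Each of the \<open>M\<close> angular derivatives contributes
  \<open>(jbr y)^2 / sqrt t\<close>, and the mass of the Gaussian, a multiple of
  \<open>sqrt t\<close>, cancels the factor \<open>t powr (- 1 / 2)\<close> of
  \<open>heat\<close>.\<close>

lemma quad_err_smooth_bound:
  assumes g: "\<gamma> > 0" and m: "m \<ge> 1" and deg: "degree q = 2 * m" and pos: "\<And>x. poly q x > 0"
    and M: "M \<ge> 1"
  shows "\<exists>C>0. \<forall>n\<ge>1. \<forall>t>0. \<forall>y. \<bar>quad_err q \<gamma> \<upsilon> n t y\<bar>
    \<le> C * jbr y powr (- \<upsilon>) * ((jbr y)\<^sup>2 / (real n * sqrt t)) ^ M"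
proof -
  define P where "P = [:\<gamma> / 2, 0, 1 / (2 * \<gamma>):]"
  have g2: "\<gamma>\<^sup>2 + x\<^sup>2 > 0" for x using g zero_le_power2[of x] zero_less_power[of \<gamma> 2] by linarith
  have P: "poly P x * moebius_jac \<gamma> x = 1" for x
    unfolding P_def by (rule poly_moebius_jacobian[OF g])
  define s where "s = - \<upsilon> / real (degree q)"
  define F0 where "F0 t y x = poly P x * poly q x powr s * poly 1 ((x - y) / sqrt t) *
      (1 / sqrt t) ^ 0 * exp (- ((x - y)\<^sup>2 / (4 * t)))" for t y x :: real
  have "real (degree P) + 2 * real m * s \<le> (2 - \<upsilon>) + 2 * real 0"
    using g m by (simp add: P_def s_def deg)
  then have F0: "heat_term q m (2 - \<upsilon>) 0 F0" unfolding F0_def by (rule heat_term.base) simp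
  \<comment> \<open>The whole sequence of derivatives is chosen before \<open>n\<close>,
    \<open>t\<close> and \<open>y\<close> are fixed, so that the constant for the
    \<open>M\<close>-th one is uniform. The implication for \<open>k = 0\<close> pins the sequence
    to the given integrand.\<close>
  have "\<exists>F. \<forall>k. heat_term q m (2 - \<upsilon>) k (F k) \<and> (k = 0 \<longrightarrow> F k = F0) \<and>
    (\<forall>t>0. \<forall>y x. (F k t y has_real_derivative F (Suc k) t y x * moebius_jac \<gamma> x) (at x))"
  proof (rule dependent_nat_choice[where
      P = "\<lambda>k F. heat_term q m (2 - \<upsilon>) k F \<and> (k = 0 \<longrightarrow> F = F0)" and
      Q = "\<lambda>k F F'. \<forall>t>0. \<forall>y x. (F t y has_real_derivative F' t y x * moebius_jac \<gamma> x) (at x)",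
      simplified conj_assoc])
    show "\<exists>F. heat_term q m (2 - \<upsilon>) 0 F \<and> (0 = (0::nat) \<longrightarrow> F = F0)" using F0 by blast
    fix F k assume "heat_term q m (2 - \<upsilon>) k F \<and> (k = 0 \<longrightarrow> F = F0)"
    then show "\<exists>F'. heat_term q m (2 - \<upsilon>) (Suc k) F' \<and> (Suc k = 0 \<longrightarrow> F' = F0) \<and>
       (\<forall>t>0. \<forall>y x. (F t y has_real_derivative F' t y x * moebius_jac \<gamma> x) (at x))"
      using heat_term_derivative[OF g deg pos, of "2 - \<upsilon>" k F] by auto
  qed
  then obtain F where F: "\<And>k. heat_term q m (2 - \<upsilon>) k (F k)" "F 0 = F0"
    "\<And>k t y x. t > 0 \<Longrightarrow> (F k t y has_real_derivative F (Suc k) t y x * moebius_jac \<gamma> x) (at x)"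
    by blast
  obtain C where C: "C > 0" "\<And>t y x. t > 0 \<Longrightarrow> exp (- t) * \<bar>F M t y x\<bar> * jbr x powr (-2)
    \<le> C * jbr y powr (2 * real M - \<upsilon>) * (1 / sqrt t) ^ M * exp (- ((x - y)\<^sup>2 / (16 * t)))"
    using heat_term_bound[OF deg pos F(1)[of M], of "-2"] by (auto simp: algebra_simps)
  define c where "c = 2 * \<gamma> * (1 + 1 / \<gamma>\<^sup>2)"
  have c: "c > 0" using g by (simp add: c_def add_pos_nonneg)
  have dx: "moebius_jac \<gamma> x \<le> c * jbr x powr (-2)" for x
  proof -
    have "1 + x\<^sup>2 \<le> (1 + 1 / \<gamma>\<^sup>2) * (\<gamma>\<^sup>2 + x\<^sup>2)"
      using g by (simp add: algebra_simps)
    then have "2 * \<gamma> * (1 + x\<^sup>2) \<le> c * (\<gamma>\<^sup>2 + x\<^sup>2)"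
      using g unfolding c_def by (simp add: mult.assoc)
    moreover have "jbr x powr (-2) = 1 / (1 + x\<^sup>2)"
      by (simp add: powr_minus_divide jbr_power2)
    ultimately show ?thesis
      using g2[of x] by (simp add: field_simps add_pos_nonneg)
  qed
  let ?D = "C * c * sqrt (16 * pi) * (2 * pi) ^ M"
  show ?thesis
  proof (intro exI[of _ ?D] conjI allI impI)
    show "?D > 0" using C c by simp
    fix n :: nat and t y :: real assume n: "n \<ge> 1" and t: "t > 0"
    define G where "G k = F k t y" for k
    define J where "J = exp (- t) * t powr (- 1 / 2)"
    have J0: "J \<ge> 0" by (simp add: J_def)
    have h1: "heat t (x - y) * weight q \<upsilon> x = J * (G 0 x * moebius_jac \<gamma> x)" for x
    proof -
      have "G 0 x * moebius_jac \<gamma> x = poly q x powr s * exp (- ((x - y)\<^sup>2 / (4 * t))) *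
          (poly P x * moebius_jac \<gamma> x)"
        unfolding G_def F(2) F0_def by simp
      then show ?thesis unfolding P by (simp add: J_def heat_def weight_def s_def)
    qed
    have h2: "heat t (moebius \<gamma> (node n j) - y) * (weight q \<upsilon> (moebius \<gamma> (node n j)) * moebius' \<gamma> (node n j))
        = J * G 0 (moebius \<gamma> (node n j))" if "j \<in> {1..n}" for j
    proof -
      have "sin (node n j / 2) > 0"
        using node_bounds[OF n that] by (intro sin_gt_zero) auto
      then have "moebius' \<gamma> (node n j) * (2 * \<gamma> / (\<gamma>\<^sup>2 + (moebius \<gamma> (node n j))\<^sup>2)) = 1"
        using g by (intro moebius_jacobian) auto
      moreover have "heat t (moebius \<gamma> (node n j) - y) * (weight q \<upsilon> (moebius \<gamma> (node n j)) * moebius' \<gamma> (node n j))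
          = J * G 0 (moebius \<gamma> (node n j)) *
            (moebius' \<gamma> (node n j) * (2 * \<gamma> / (\<gamma>\<^sup>2 + (moebius \<gamma> (node n j))\<^sup>2)))"
        unfolding mult.assoc[symmetric, of "heat _ _"] h1 by (simp only: mult_ac)
      ultimately show ?thesis by (simp only: mult_1_right)
    qed
    have ex: "\<bar>quad_err q \<gamma> \<upsilon> n t y\<bar> = J * \<bar>(LINT x|lborel. G 0 x * moebius_jac \<gamma> x)
      - 2 * pi / n * (\<Sum>j=1..n. G 0 (moebius \<gamma> (node n j)))\<bar>"
    proof -
      have "quad_err q \<gamma> \<upsilon> n t y = (LINT x|lborel. J * (G 0 x * moebius_jac \<gamma> x))
        - 2 * pi / n * (\<Sum>j=1..n. J * G 0 (moebius \<gamma> (node n j)))"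
        unfolding quad_err_def h1 by (subst sum.cong[OF refl h2]) auto
      also have "\<dots> = J * ((LINT x|lborel. G 0 x * moebius_jac \<gamma> x)
        - 2 * pi / n * (\<Sum>j=1..n. G 0 (moebius \<gamma> (node n j))))"
        unfolding integral_mult_right_zero sum_distrib_left[symmetric] right_diff_distrib
        by (simp only: mult.left_commute)
      finally show ?thesis using J0 by (simp add: abs_mult)
    qed
    \<comment> \<open>Here the constant may depend on \<open>k\<close>, \<open>t\<close> and
      \<open>y\<close>: the decay only serves to make the lifts differentiable over
      infinity.\<close>
    have bnd: "\<exists>C. \<forall>x. \<bar>G k x\<bar> \<le> C / (\<gamma>\<^sup>2 + x\<^sup>2)" for k
    proof -
      obtain B where B: "B > 0" "\<And>x. exp (- t) * \<bar>F k t y x\<bar> * jbr x powr 2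
        \<le> B * jbr y powr ((2 - \<upsilon>) + 2 * real k + 2) * (1 / sqrt t) ^ k * exp (- ((x - y)\<^sup>2 / (16 * t)))"
        using heat_term_bound[OF deg pos F(1)[of k], of 2] t by blast
      define B' where "B' = exp t * (B * jbr y powr ((2 - \<upsilon>) + 2 * real k + 2) * (1 / sqrt t) ^ k) * (1 + \<gamma>\<^sup>2)"
      have "\<bar>G k x\<bar> * (\<gamma>\<^sup>2 + x\<^sup>2) \<le> B'" for x
      proof -
        have "exp (- t) * \<bar>F k t y x\<bar> * jbr x powr 2
          \<le> B * jbr y powr ((2 - \<upsilon>) + 2 * real k + 2) * (1 / sqrt t) ^ k"
          using B(1) t by (intro order.trans[OF B(2)] mult_left_le) auto
        then have f1: "exp t * (exp (- t) * \<bar>F k t y x\<bar> * jbr x powr 2)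
          \<le> exp t * (B * jbr y powr ((2 - \<upsilon>) + 2 * real k + 2) * (1 / sqrt t) ^ k)"
          by (intro mult_left_mono) auto
        have f2: "exp t * (exp (- t) * \<bar>F k t y x\<bar> * jbr x powr 2) = \<bar>G k x\<bar> * (1 + x\<^sup>2)"
          by (simp add: mult_exp_exp G_def jbr_power2 mult.assoc[symmetric])
        have "\<bar>G k x\<bar> * (1 + x\<^sup>2) * (1 + \<gamma>\<^sup>2) \<le> B'"
          unfolding B'_def by (rule mult_right_mono[OF f1[unfolded f2]]) simp
        moreover have "\<gamma>\<^sup>2 + x\<^sup>2 \<le> (1 + x\<^sup>2) * (1 + \<gamma>\<^sup>2)" by (simp add: algebra_simps)
        then have "\<bar>G k x\<bar> * (\<gamma>\<^sup>2 + x\<^sup>2) \<le> \<bar>G k x\<bar> * ((1 + x\<^sup>2) * (1 + \<gamma>\<^sup>2))"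
          by (intro mult_left_mono) auto
        ultimately show ?thesis by (simp add: mult.assoc)
      qed
      then have "\<forall>x. \<bar>G k x\<bar> \<le> B' / (\<gamma>\<^sup>2 + x\<^sup>2)"
        using g2 by (simp add: le_divide_eq)
      then show ?thesis by blast
    qed
    have derG: "(G k has_real_derivative G (Suc k) x * moebius_jac \<gamma> x) (at x)" for k x
      unfolding G_def by (rule F(3)[OF t])
    have cG: "continuous_on UNIV (G k)" for k
      by (rule DERIV_continuous_on, rule has_field_derivative_at_within, rule derG)
    then have mG [measurable]: "G k \<in> borel_measurable borel" for k
      by (rule borel_measurable_continuous_onI)
    have "exp (- t) * (LINT x|lborel. \<bar>G M x\<bar> * moebius_jac \<gamma> x)
      = (LINT x|lborel. exp (- t) * (\<bar>G M x\<bar> * moebius_jac \<gamma> x))"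
      by (simp only: integral_mult_right_zero)
    also have "\<dots> \<le> (LINT x|lborel. C * c * jbr y powr (2 * real M - \<upsilon>) * (1 / sqrt t) ^ M * exp (- ((x - y)\<^sup>2 / (2 * (8 * t)))))"
    proof (rule integral_mono')
      show "integrable lborel (\<lambda>x. C * c * jbr y powr (2 * real M - \<upsilon>) * (1 / sqrt t) ^ M * exp (- ((x - y)\<^sup>2 / (2 * (8 * t)))))"
        using t by (intro integrable_mult_right gauss_exp_integral) auto
      fix x
      have "exp (- t) * (\<bar>G M x\<bar> * moebius_jac \<gamma> x) \<le> exp (- t) * (\<bar>G M x\<bar> * (c * jbr x powr (-2)))"
        by (intro mult_left_mono dx) auto
      also have "\<dots> = c * (exp (- t) * \<bar>F M t y x\<bar> * jbr x powr (-2))" by (simp add: G_def)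
      also have "\<dots> \<le> c * (C * jbr y powr (2 * real M - \<upsilon>) * (1 / sqrt t) ^ M * exp (- ((x - y)\<^sup>2 / (16 * t))))"
        using c by (intro mult_left_mono C t) auto
      finally show "exp (- t) * (\<bar>G M x\<bar> * moebius_jac \<gamma> x)
        \<le> C * c * jbr y powr (2 * real M - \<upsilon>) * (1 / sqrt t) ^ M * exp (- ((x - y)\<^sup>2 / (2 * (8 * t))))"
        by (simp add: mult_ac)
      show "0 \<le> C * c * jbr y powr (2 * real M - \<upsilon>) * (1 / sqrt t) ^ M * exp (- ((x - y)\<^sup>2 / (2 * (8 * t))))"
        using C c t by simp
    qed
    also have "\<dots> = C * c * jbr y powr (2 * real M - \<upsilon>) * (1 / sqrt t) ^ M * (sqrt (16 * pi) * sqrt t)"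
      using t gauss_exp_integral(2)[of "8 * t" y] by (simp add: real_sqrt_mult)
    finally have I: "exp (- t) * (LINT x|lborel. \<bar>G M x\<bar> * moebius_jac \<gamma> x)
      \<le> C * c * jbr y powr (2 * real M - \<upsilon>) * (1 / sqrt t) ^ M * (sqrt (16 * pi) * sqrt t)" .
    have tp: "t powr (- 1 / 2) * sqrt t = 1"
      using t by (simp add: powr_minus_divide powr_half_sqrt minus_divide_left[symmetric])
    have "\<bar>quad_err q \<gamma> \<upsilon> n t y\<bar>
      \<le> J * ((2 * pi / n) ^ M * (LINT x|lborel. \<bar>G M x\<bar> * moebius_jac \<gamma> x))"
      unfolding ex by (intro mult_left_mono moebius_trapezoid_error g n M derG bnd J0)
    also have "\<dots> = t powr (- 1 / 2) * (2 * pi / n) ^ M * (exp (- t) * (LINT x|lborel. \<bar>G M x\<bar> * moebius_jac \<gamma> x))"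
      by (simp only: J_def mult_ac)
    also have "\<dots> \<le> t powr (- 1 / 2) * (2 * pi / n) ^ M *
       (C * c * jbr y powr (2 * real M - \<upsilon>) * (1 / sqrt t) ^ M * (sqrt (16 * pi) * sqrt t))"
      by (intro mult_left_mono I) auto
    also have "\<dots> = (t powr (- 1 / 2) * sqrt t) * (?D * (jbr y powr (2 * real M - \<upsilon>) * (1 / sqrt t) ^ M * (1 / n) ^ M))"
      by (simp add: power_divide mult_ac)
    also have "\<dots> = ?D * (jbr y powr (- \<upsilon>) * ((jbr y)\<^sup>2 / (real n * sqrt t)) ^ M)"
    proof -
      have "jbr y powr (2 * real M - \<upsilon>) = jbr y powr (2 * real M) * jbr y powr (- \<upsilon>)"
        by (simp add: powr_add[symmetric])
      also have "jbr y powr (2 * real M) = ((jbr y)\<^sup>2) ^ M"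
        using powr_realpow[of "jbr y" "2 * M"] by (simp add: power_mult)
      finally show ?thesis
        unfolding tp by (simp add: power_divide power_mult_distrib mult_ac)
    qed
    finally show "\<bar>quad_err q \<gamma> \<upsilon> n t y\<bar> \<le> ?D * jbr y powr (- \<upsilon>) * ((jbr y)\<^sup>2 / (real n * sqrt t)) ^ M"
      by (simp only: mult.assoc)
  qed
qed

section \<open>Mass of the nodes\<close>

text \<open>From \<open>sin x \<ge> x - x ^ 3 / 6\<close>: on this interval
  \<open>x^2 \<le> 3\<close>, so the cubic term takes away at most half of \<open>x\<close>.\<close>

lemma sin_ge_half:
  fixes x :: real
  assumes "0 \<le> x" "x \<le> pi / 2" shows "x / 2 \<le> sin x"
proof -
  have "\<bar>sin x - (\<Sum>m<3. sin_coeff m * x ^ m)\<bar> \<le> inverse (fact 3) * \<bar>x\<bar> ^ 3"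
    by (rule Maclaurin_sin_bound)
  moreover have "(\<Sum>m<3. sin_coeff m * x ^ m) = x"
    by (simp add: numeral_3_eq_3 sin_coeff_def)
  ultimately have "\<bar>sin x - x\<bar> \<le> x ^ 3 / 6"
    using assms by (simp add: fact_numeral)
  then have "x - x ^ 3 / 6 \<le> sin x" by linarith
  moreover have "x ^ 3 / 6 \<le> x / 2"
  proof -
    have "x \<le> 1.6" using assms pi_less_4 pi_approx by simp
    then have "x * x \<le> 1.6 * 1.6" using assms by (intro mult_mono) auto
    then have "x * x * x \<le> 3 * x" using assms by (intro mult_right_mono) auto
    then show ?thesis by (simp add: power3_eq_cube)
  qed
  ultimately show ?thesis by linarith
qed

lemma sum_inverse_sqrt_le:
  "(\<Sum>j=1..n. 1 / sqrt (real j)) \<le> 2 * sqrt (real n)"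
proof (induction n)
  case (Suc n)
  let ?a = "sqrt (real n)" and ?b = "sqrt (real (Suc n))"
  have b0: "?b > 0" by simp
  have ab: "0 \<le> (?b - ?a)\<^sup>2" by simp
  have a2: "?a\<^sup>2 = real n" "?b\<^sup>2 = real n + 1" by simp_all
  have "2 * ?a * ?b + 1 \<le> 2 * ?b\<^sup>2"
    using ab unfolding power2_diff a2 by (simp add: algebra_simps)
  then have "2 * ?a + 1 / ?b \<le> 2 * ?b"
    using b0 by (simp add: field_simps power2_eq_square)
  with Suc show ?case by simp
qed simp

lemma jbr_moebius_le:
  assumes s: "sin (\<theta> / 2) > 0"
  shows "jbr (moebius \<gamma> \<theta>) \<le> sqrt (1 + \<gamma>\<^sup>2) / sin (\<theta> / 2)"
proof -
  have "(sin (\<theta> / 2))\<^sup>2 \<le> 1" by (simp add: abs_square_le_1)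
  then have s2: "1 \<le> 1 / (sin (\<theta> / 2))\<^sup>2" using s by simp
  have "\<gamma>\<^sup>2 + (moebius \<gamma> \<theta>)\<^sup>2 = \<gamma>\<^sup>2 / (sin (\<theta> / 2))\<^sup>2"
    using s by (intro moebius_sin2) auto
  then have "1 + (moebius \<gamma> \<theta>)\<^sup>2 \<le> 1 / (sin (\<theta> / 2))\<^sup>2 + \<gamma>\<^sup>2 / (sin (\<theta> / 2))\<^sup>2"
    using s2 zero_le_power2[of \<gamma>] by linarith
  also have "\<dots> = (1 + \<gamma>\<^sup>2) / (sin (\<theta> / 2))\<^sup>2" by (simp add: add_divide_distrib)
  finally have "jbr (moebius \<gamma> \<theta>) \<le> sqrt ((1 + \<gamma>\<^sup>2) / (sin (\<theta> / 2))\<^sup>2)"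
    unfolding jbr_def by (rule real_sqrt_le_mono)
  also have "\<dots> = sqrt (1 + \<gamma>\<^sup>2) / sin (\<theta> / 2)"
    using s by (simp add: real_sqrt_divide)
  finally show ?thesis .
qed

lemma moebius'_le_jbr:
  assumes g: "\<gamma> > 0" and s: "sin (\<theta> / 2) > 0"
  shows "moebius' \<gamma> \<theta> \<le> (\<gamma>\<^sup>2 + 1) / (2 * \<gamma>) * (jbr (moebius \<gamma> \<theta>)) powr 2"
proof -
  let ?x = "moebius \<gamma> \<theta>"
  have "moebius' \<gamma> \<theta> * (2 * \<gamma> / (\<gamma>\<^sup>2 + ?x\<^sup>2)) = 1"
    using s g by (intro moebius_jacobian) auto
  moreover have "\<gamma>\<^sup>2 + ?x\<^sup>2 > 0" using g zero_le_power2[of ?x] zero_less_power[of \<gamma> 2] by linarith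
  ultimately have "moebius' \<gamma> \<theta> = (\<gamma>\<^sup>2 + ?x\<^sup>2) / (2 * \<gamma>)"
    using g by (simp add: field_simps)
  also have "\<dots> \<le> ((\<gamma>\<^sup>2 + 1) * (1 + ?x\<^sup>2)) / (2 * \<gamma>)"
    using g by (intro divide_right_mono) (auto simp: algebra_simps)
  finally show ?thesis by (simp add: jbr_power2)
qed

text \<open>A discrete version of the convergence of the integral of
  \<open>1 / sqrt (sin (\<theta> / 2))\<close> over the circle. The power 1/2 is what the factor
  \<open>moebius'\<close>, of growth 2, and the weight exponent \<open>- 3/2\<close> leave
  together.\<close>

lemma node_sum_bound:
  assumes g: "\<gamma> > 0"
  obtains C where "C > 0" "\<And>n. n \<ge> 1 \<Longrightarrow> 2 * pi / real n * (\<Sum>j=1..n. jbr (moebius \<gamma> (node n j)) powr (1/2)) \<le> C"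
proof -
  define c where "c = sqrt (2 * sqrt (1 + \<gamma>\<^sup>2))"
  have c0: "c > 0" by (simp add: c_def add_pos_nonneg)
  \<comment> \<open>Both ends of the angular interval lie over infinity. The first term handles
    nodes near 0; in the second, \<open>n + 1 - j\<close> is the index counted from the other
    end.\<close>
  have pt: "jbr (moebius \<gamma> (node n j)) powr (1/2) \<le> c * (sqrt n / sqrt j + sqrt n / sqrt (real (n + 1 - j)))"
    if n: "n \<ge> 1" and j: "j \<in> {1..n}" for n j
  proof -
    define \<phi> where "\<phi> = node n j / 2"
    have ph: "\<phi> = pi * (2 * real j - 1) / (2 * n)"
      by (simp add: \<phi>_def node_def field_simps diff_divide_distrib)
    have jn: "1 \<le> real j" "real j \<le> n" "0 < real n" using j n by auto
    have r: "real (n + 1 - j) = n + 1 - real j" using j by auto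
    have b: "0 < \<phi>" "\<phi> < pi" using node_bounds[OF n j] by (auto simp: \<phi>_def)
    have p3: "pi / 2 \<ge> 1" using pi_gt3 by simp
    have l1: "real j / (2 * real n) \<le> \<phi> / 2"
    proof -
      have "1 * real j \<le> pi / 2 * (2 * real j - 1)"
        using p3 jn by (intro mult_mono) auto
      then show ?thesis using jn unfolding ph by (simp add: field_simps)
    qed
    have l2: "real (n + 1 - j) / (2 * real n) \<le> (pi - \<phi>) / 2"
    proof -
      have "1 * (n + 1 - real j) \<le> pi / 2 * (2 * (n - real j) + 1)"
        using p3 jn by (intro mult_mono) auto
      moreover have "(pi - \<phi>) / 2 = pi / 2 * (2 * (n - real j) + 1) / (2 * real n)"
        using jn unfolding ph by (simp add: field_simps)
      ultimately show ?thesis unfolding r by (simp only: mult_1_left) (intro divide_right_mono, auto)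
    qed
    have s0: "sin \<phi> > 0" using b by (intro sin_gt_zero) auto
    have key: "1 / sqrt (sin \<phi>) \<le> sqrt 2 * (sqrt n / sqrt k)" if k: "k > 0" "k / (2 * real n) \<le> sin \<phi>" for k :: real
    proof -
      have "sqrt (k / (2 * real n)) \<le> sqrt (sin \<phi>)" using k by simp
      then have "1 / sqrt (sin \<phi>) \<le> 1 / sqrt (k / (2 * real n))"
        using k jn s0 by (intro divide_left_mono mult_pos_pos real_sqrt_gt_zero) auto
      also have "\<dots> = sqrt 2 * (sqrt n / sqrt k)"
        by (simp add: real_sqrt_divide real_sqrt_mult)
      finally show ?thesis .
    qed
    have inv: "1 / sqrt (sin \<phi>) \<le> sqrt 2 * (sqrt n / sqrt j + sqrt n / sqrt (real (n + 1 - j)))"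
    proof (cases "\<phi> \<le> pi / 2")
      case True
      have "1 / sqrt (sin \<phi>) \<le> sqrt 2 * (sqrt n / sqrt j)"
        using sin_ge_half[of \<phi>] True b l1 jn by (intro key) auto
      also have "\<dots> \<le> sqrt 2 * (sqrt n / sqrt j + sqrt n / sqrt (real (n + 1 - j)))"
        by (intro mult_left_mono) auto
      finally show ?thesis .
    next
      case False
      have "1 / sqrt (sin \<phi>) \<le> sqrt 2 * (sqrt n / sqrt (real (n + 1 - j)))"
      proof (rule key)
        show "0 < real (n + 1 - j)" using jn r by linarith
        have "(pi - \<phi>) / 2 \<le> sin \<phi>" using sin_ge_half[of "pi - \<phi>"] False b by simp
        with l2 show "real (n + 1 - j) / (2 * real n) \<le> sin \<phi>" by linarith
      qed
      also have "\<dots> \<le> sqrt 2 * (sqrt n / sqrt j + sqrt n / sqrt (real (n + 1 - j)))"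
        by (intro mult_left_mono) auto
      finally show ?thesis .
    qed
    have "jbr (moebius \<gamma> (node n j)) powr (1/2) = sqrt (jbr (moebius \<gamma> (node n j)))"
      by (simp add: powr_half_sqrt)
    also have "\<dots> \<le> sqrt (sqrt (1 + \<gamma>\<^sup>2) / sin \<phi>)"
      using jbr_moebius_le[of "node n j" \<gamma>] s0 by (simp add: \<phi>_def)
    also have "\<dots> = sqrt (sqrt (1 + \<gamma>\<^sup>2)) * (1 / sqrt (sin \<phi>))"
      by (simp add: real_sqrt_divide)
    also have "\<dots> \<le> sqrt (sqrt (1 + \<gamma>\<^sup>2)) * (sqrt 2 * (sqrt n / sqrt j + sqrt n / sqrt (real (n + 1 - j))))"
      by (intro mult_left_mono inv) auto
    finally show ?thesis by (simp add: c_def real_sqrt_mult mult_ac)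
  qed
  show ?thesis
  proof
    show "8 * pi * c > 0" using c0 by simp
    fix n :: nat assume n: "n \<ge> 1"
    have "(\<Sum>j=1..n. jbr (moebius \<gamma> (node n j)) powr (1/2))
      \<le> (\<Sum>j=1..n. c * (sqrt n / sqrt j + sqrt n / sqrt (real (n + 1 - j))))"
      by (intro sum_mono pt n)
    also have "\<dots> = c * (sqrt n * (\<Sum>j=1..n. 1 / sqrt j) + sqrt n * (\<Sum>j=1..n. 1 / sqrt (real (n + 1 - j))))"
      by (simp only: sum_distrib_left[symmetric] sum.distrib times_divide_eq_right[symmetric] mult_1_right
          divide_inverse mult_1_left)
    also have "(\<Sum>j=1..n. 1 / sqrt (real (n + 1 - j))) = (\<Sum>j=1..n. 1 / sqrt j)"
      by (rule sum.reindex_bij_witness[of _ "\<lambda>j. n + 1 - j" "\<lambda>j. n + 1 - j"]) auto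
    also have "c * (sqrt n * (\<Sum>j=1..n. 1 / sqrt j) + sqrt n * (\<Sum>j=1..n. 1 / sqrt j))
      \<le> c * (sqrt n * (2 * sqrt n) + sqrt n * (2 * sqrt n))"
      using c0 sum_inverse_sqrt_le[of n] by (intro mult_left_mono add_mono) auto
    also have "\<dots> = 4 * c * n" by simp
    finally have "2 * pi / n * (\<Sum>j=1..n. jbr (moebius \<gamma> (node n j)) powr (1/2)) \<le> 2 * pi / n * (4 * c * n)"
      by (intro mult_left_mono) auto
    then show "2 * pi / n * (\<Sum>j=1..n. jbr (moebius \<gamma> (node n j)) powr (1/2)) \<le> 8 * pi * c"
      using n by simp
  qed
qed

section \<open>Mass of the heat kernel in power weights\<close>

lemma heat_measurable [measurable (raw)]:
  assumes [measurable]: "f \<in> borel_measurable M" "g \<in> borel_measurable M"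
  shows "(\<lambda>x. heat (f x) (g x)) \<in> borel_measurable M"
  unfolding heat_def by measurable

lemma poly_measurable [measurable]: "poly q \<in> borel_measurable (borel :: real measure)"
  by (intro borel_measurable_continuous_onI continuous_intros)

lemma weight_measurable [measurable]: "weight q k \<in> borel_measurable borel"
  unfolding weight_def[abs_def] by measurable

lemma heat_jbr_bound:
  obtains C where "C > 0" "\<And>t x y. t > 0 \<Longrightarrow> heat t (x - y) * jbr y powr d
    \<le> C * jbr x powr d * (exp (- t / 2) * t powr (- 1 / 2) * exp (- ((y - x)\<^sup>2 / (2 * (8 * t)))))"
proof -
  obtain C where C: "C > 0" "\<And>t x y. t > 0 \<Longrightarrow> exp (-t) * exp (- ((x - y)\<^sup>2 / (8 * t))) * jbr x powr d
      \<le> C * jbr y powr d * exp (-t/2) * exp (- ((x - y)\<^sup>2 / (16 * t)))"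
    using gauss_jbr_bound[of d] by blast
  show ?thesis
  proof
    show "C > 0" by fact
    fix t x y :: real assume t: "t > 0"
    have "(y - x)\<^sup>2 / (8 * t) \<le> (y - x)\<^sup>2 / (4 * t)"
      using t by (intro divide_left_mono) auto
    then have "heat t (x - y) * jbr y powr d \<le> t powr (-1/2) * (exp (-t) * exp (- ((y - x)\<^sup>2 / (8 * t))) * jbr y powr d)"
      unfolding heat_def by (simp add: power2_commute[of x] mult_ac mult_left_mono mult_right_mono)
    also have "\<dots> \<le> t powr (-1/2) * (C * jbr x powr d * exp (-t/2) * exp (- ((y - x)\<^sup>2 / (16 * t))))"
      by (intro mult_left_mono C t) auto
    finally show "heat t (x - y) * jbr y powr d
      \<le> C * jbr x powr d * (exp (- t / 2) * t powr (- 1 / 2) * exp (- ((y - x)\<^sup>2 / (2 * (8 * t)))))"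
      by (simp add: mult_ac)
  qed
qed

lemma gauss_scale:
  assumes t: "t > 0"
  shows "integrable lborel (\<lambda>y. A * (B * t powr (- 1 / 2) * exp (- ((y - x)\<^sup>2 / (2 * (8 * t))))))"
    and "(LINT y|lborel. A * (B * t powr (- 1 / 2) * exp (- ((y - x)\<^sup>2 / (2 * (8 * t)))))) = A * B * sqrt (16 * pi)"
proof -
  show "integrable lborel (\<lambda>y. A * (B * t powr (- 1 / 2) * exp (- ((y - x)\<^sup>2 / (2 * (8 * t))))))"
    using t by (intro integrable_mult_right gauss_exp_integral) auto
  have tp: "t powr (- 1 / 2) * sqrt t = 1"
    using t by (simp add: powr_minus_divide powr_half_sqrt minus_divide_left[symmetric])
  have "(LINT y|lborel. A * (B * t powr (- 1 / 2) * exp (- ((y - x)\<^sup>2 / (2 * (8 * t))))))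
    = A * (B * t powr (- 1 / 2) * (LINT y|lborel. exp (- ((y - x)\<^sup>2 / (2 * (8 * t))))))"
    by (simp only: integral_mult_right_zero)
  also have "\<dots> = A * (B * t powr (- 1 / 2) * (sqrt (16 * pi) * sqrt t))"
    using t gauss_exp_integral(2)[of "8 * t" x] by (simp add: real_sqrt_mult)
  also have "\<dots> = A * B * sqrt (16 * pi) * (t powr (- 1 / 2) * sqrt t)" by (simp only: mult_ac)
  finally show "(LINT y|lborel. A * (B * t powr (- 1 / 2) * exp (- ((y - x)\<^sup>2 / (2 * (8 * t)))))) = A * B * sqrt (16 * pi)"
    unfolding tp by simp
qed

text \<open>Peetre's inequality makes the weight nearly constant over the width of the kernel, and
  the damping covers widths \<open>sqrt t\<close> above 1. The factor \<open>exp (- t / 2)\<close>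
  that remains is what later makes the potentials converge at large \<open>t\<close>.\<close>

lemma heat_moment:
  obtains C where "C > 0"
    "\<And>t x. t > 0 \<Longrightarrow> integrable lborel (\<lambda>y. heat t (x - y) * jbr y powr d)"
    "\<And>t x. t > 0 \<Longrightarrow> (LINT y|lborel. heat t (x - y) * jbr y powr d) \<le> C * exp (- t / 2) * jbr x powr d"
proof -
  obtain C where C: "C > 0" "\<And>t x y. t > 0 \<Longrightarrow> heat t (x - y) * jbr y powr d
    \<le> C * jbr x powr d * (exp (- t / 2) * t powr (- 1 / 2) * exp (- ((y - x)\<^sup>2 / (2 * (8 * t)))))"
    using heat_jbr_bound[of d] by blast
  show ?thesis
  proof
    show "C * sqrt (16 * pi) > 0" using C by simp
    fix t x :: real assume t: "t > 0"
    show i: "integrable lborel (\<lambda>y. heat t (x - y) * jbr y powr d)"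
    proof (rule Bochner_Integration.integrable_bound[OF gauss_scale(1)[OF t]])
      show "AE y in lborel. norm (heat t (x - y) * jbr y powr d)
        \<le> norm (C * jbr x powr d * (exp (- t / 2) * t powr (- 1 / 2) * exp (- ((y - x)\<^sup>2 / (2 * (8 * t))))))"
        using C t by (intro AE_I2) (simp add: heat_nonneg abs_mult)
    qed measurable
    have "(LINT y|lborel. heat t (x - y) * jbr y powr d)
      \<le> (LINT y|lborel. C * jbr x powr d * (exp (- t / 2) * t powr (- 1 / 2) * exp (- ((y - x)\<^sup>2 / (2 * (8 * t))))))"
      by (intro integral_mono i gauss_scale(1) t C)
    also have "\<dots> = C * jbr x powr d * exp (- t / 2) * sqrt (16 * pi)"
      by (rule gauss_scale(2)[OF t])
    finally show "(LINT y|lborel. heat t (x - y) * jbr y powr d) \<le> C * sqrt (16 * pi) * exp (- t / 2) * jbr x powr d"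
      by (simp add: mult_ac)
  qed
qed

text \<open>The error with its minus sign turned into a plus: a nonnegative majorant for the region
  where the mesh is too coarse for any cancellation.\<close>

definition quad_abs :: "real poly \<Rightarrow> real \<Rightarrow> real \<Rightarrow> nat \<Rightarrow> real \<Rightarrow> real \<Rightarrow> real" where
  "quad_abs q \<gamma> \<upsilon> n t y =
     (LINT x|lborel. heat t (x - y) * weight q \<upsilon> x) +
     2 * pi / real n * (\<Sum>j=1..n. heat t (moebius \<gamma> (node n j) - y) *
        (weight q \<upsilon> (moebius \<gamma> (node n j)) * moebius' \<gamma> (node n j)))"

lemma weight_nonneg: "0 \<le> weight q k x"
  by (simp add: weight_def)

lemma moebius'_nonneg: "\<gamma> > 0 \<Longrightarrow> 0 \<le> moebius' \<gamma> \<theta>"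
  by (simp add: moebius'_def)

lemma quad_err_measurable [measurable]:
  "(\<lambda>x. quad_err q \<gamma> \<upsilon> n (fst x) (snd x)) \<in> borel_measurable (borel \<Otimes>\<^sub>M borel)"
  unfolding quad_err_def by measurable

lemma quad_err_le_abs:
  assumes "\<gamma> > 0" shows "\<bar>quad_err q \<gamma> \<upsilon> n t y\<bar> \<le> quad_abs q \<gamma> \<upsilon> n t y"
proof -
  have "0 \<le> (LINT x|lborel. heat t (x - y) * weight q \<upsilon> x)"
    by (intro integral_nonneg_AE) (simp add: heat_nonneg weight_nonneg)
  moreover have "0 \<le> 2 * pi / real n * (\<Sum>j=1..n. heat t (moebius \<gamma> (node n j) - y) *
        (weight q \<upsilon> (moebius \<gamma> (node n j)) * moebius' \<gamma> (node n j)))"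
    using assms by (intro mult_nonneg_nonneg sum_nonneg heat_nonneg weight_nonneg moebius'_nonneg) auto
  ultimately show ?thesis
    unfolding quad_err_def quad_abs_def by linarith
qed

lemma heat_minus_commute: "heat t (x - y) = heat t (y - x)"
  by (simp add: heat_def power2_commute)

text \<open>In the integral part the weights combine to \<open>jbr y powr (- 3/2)\<close>, which is
  integrable. In the sum the integration over \<open>y\<close> is done first, node by node; with
  \<open>moebius'\<close> bounded by a multiple of \<open>jbr (X j) powr 2\<close>, the exponents
  \<open>- \<upsilon>\<close>, 2 and \<open>\<upsilon> - 3/2\<close> add up to 1/2. The bound is
  uniform in both \<open>n\<close> and \<open>t\<close>.\<close>

lemma quad_abs_integral_bound:
  assumes g: "\<gamma> > 0" and m: "m \<ge> 1" and deg: "degree q = 2 * m" and pos: "\<And>x. poly q x > 0"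
  obtains C where "C > 0" "\<And>n t. n \<ge> 1 \<Longrightarrow> t > 0 \<Longrightarrow>
    (\<integral>\<^sup>+y. ennreal (quad_abs q \<gamma> \<upsilon> n t y * jbr y powr (\<upsilon> - 3/2)) \<partial>lborel) \<le> ennreal C"
proof -
  obtain W where W: "W > 0" "\<And>x. weight q \<upsilon> x \<le> W * jbr x powr (- \<upsilon>)"
    using weight_comparable[OF m deg pos, of \<upsilon>] by metis
  obtain H1 where H1: "H1 > 0" "\<And>t x. t > 0 \<Longrightarrow> integrable lborel (\<lambda>y. heat t (x - y) * jbr y powr (- \<upsilon>))"
    "\<And>t x. t > 0 \<Longrightarrow> (LINT y|lborel. heat t (x - y) * jbr y powr (- \<upsilon>)) \<le> H1 * exp (- t / 2) * jbr x powr (- \<upsilon>)"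
    using heat_moment[of "- \<upsilon>"] by blast
  obtain H2 where H2: "H2 > 0" "\<And>t x. t > 0 \<Longrightarrow> integrable lborel (\<lambda>y. heat t (x - y) * jbr y powr (\<upsilon> - 3/2))"
    "\<And>t x. t > 0 \<Longrightarrow> (LINT y|lborel. heat t (x - y) * jbr y powr (\<upsilon> - 3/2)) \<le> H2 * exp (- t / 2) * jbr x powr (\<upsilon> - 3/2)"
    using heat_moment[of "\<upsilon> - 3/2"] by blast
  obtain S where S: "S > 0" "\<And>n. n \<ge> 1 \<Longrightarrow> 2 * pi / real n * (\<Sum>j=1..n. jbr (moebius \<gamma> (node n j)) powr (1/2)) \<le> S"
    using node_sum_bound[OF g] by blast
  define J where "J = (LINT y|lborel. jbr y powr (-3/2))"
  have J0: "J \<ge> 0" unfolding J_def by (intro integral_nonneg_AE) auto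
  define c where "c = (\<gamma>\<^sup>2 + 1) / (2 * \<gamma>)"
  have c0: "c > 0" using g by (simp add: c_def add_nonneg_pos)
  let ?C = "W * H1 * J + c * W * H2 * S"
  show ?thesis
  proof
    show "?C > 0" using W H1 J0 c0 H2 S by (simp add: add_nonneg_pos)
    fix n :: nat and t :: real assume n: "n \<ge> 1" and t: "t > 0"
    have et: "exp (- t / 2) \<le> 1" using t by simp
    define X where "X j = moebius \<gamma> (node n j)" for j
    define a where "a j = weight q \<upsilon> (X j) * moebius' \<gamma> (node n j)" for j
    have a0: "a j \<ge> 0" for j using g by (simp add: a_def weight_nonneg moebius'_nonneg)
    have qI: "(LINT x|lborel. heat t (x - y) * weight q \<upsilon> x) \<le> W * H1 * jbr y powr (- \<upsilon>)" for y
    proof -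
      have "(LINT x|lborel. heat t (x - y) * weight q \<upsilon> x) \<le> (LINT x|lborel. W * (heat t (y - x) * jbr x powr (- \<upsilon>)))"
      proof (rule integral_mono')
        show "integrable lborel (\<lambda>x. W * (heat t (y - x) * jbr x powr (- \<upsilon>)))"
          by (intro integrable_mult_right H1 t)
        fix x
        show "heat t (x - y) * weight q \<upsilon> x \<le> W * (heat t (y - x) * jbr x powr (- \<upsilon>))"
          using mult_left_mono[OF W(2)[of x] heat_nonneg[of t "x - y"]]
          by (simp add: heat_minus_commute[of t y] mult_ac)
        show "0 \<le> W * (heat t (y - x) * jbr x powr (- \<upsilon>))" using W by (simp add: heat_nonneg)
      qed
      also have "\<dots> = W * (LINT x|lborel. heat t (y - x) * jbr x powr (- \<upsilon>))" by simp
      also have "\<dots> \<le> W * (H1 * 1 * jbr y powr (- \<upsilon>))"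
        using W H1 et
        by (intro mult_left_mono order.trans[OF H1(3)[OF t]] mult_right_mono) auto
      finally show ?thesis by simp
    qed
    have i1: "integrable lborel (\<lambda>y. W * H1 * jbr y powr (-3/2))"
      by (intro integrable_mult_right integrable_jbr_powr)
    have i2: "integrable lborel (\<lambda>y. 2 * pi / real n * (\<Sum>j=1..n. a j * (heat t (X j - y) * jbr y powr (\<upsilon> - 3/2))))"
      by (intro integrable_mult_right Bochner_Integration.integrable_sum H2 t)
    have "(\<integral>\<^sup>+y. ennreal (quad_abs q \<gamma> \<upsilon> n t y * jbr y powr (\<upsilon> - 3/2)) \<partial>lborel)
      \<le> (\<integral>\<^sup>+y. ennreal (W * H1 * jbr y powr (-3/2) + 2 * pi / real n * (\<Sum>j=1..n. a j * (heat t (X j - y) * jbr y powr (\<upsilon> - 3/2)))) \<partial>lborel)"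
    proof (intro nn_integral_mono ennreal_leI)
      fix y
      have "jbr y powr (-3/2) = jbr y powr (- \<upsilon>) * jbr y powr (\<upsilon> - 3/2)"
        by (simp add: powr_add[symmetric])
      then show "quad_abs q \<gamma> \<upsilon> n t y * jbr y powr (\<upsilon> - 3/2)
        \<le> W * H1 * jbr y powr (-3/2) + 2 * pi / real n * (\<Sum>j=1..n. a j * (heat t (X j - y) * jbr y powr (\<upsilon> - 3/2)))"
        unfolding quad_abs_def X_def[symmetric] a_def[symmetric] distrib_right
        using mult_right_mono[OF qI[of y], of "jbr y powr (\<upsilon> - 3/2)"]
        by (intro add_mono) (simp_all add: sum_distrib_right sum_distrib_left mult_ac)
    qed
    also have "\<dots> = ennreal (LINT y|lborel. (W * H1 * jbr y powr (-3/2) + 2 * pi / real n * (\<Sum>j=1..n. a j * (heat t (X j - y) * jbr y powr (\<upsilon> - 3/2)))))"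
      using W H1 a0 by (intro nn_integral_eq_integral Bochner_Integration.integrable_add i1 i2 AE_I2
        add_nonneg_nonneg mult_nonneg_nonneg sum_nonneg heat_nonneg) auto
    also have "(LINT y|lborel. (W * H1 * jbr y powr (-3/2) + 2 * pi / real n * (\<Sum>j=1..n. a j * (heat t (X j - y) * jbr y powr (\<upsilon> - 3/2)))))
      = W * H1 * J + 2 * pi / real n * (\<Sum>j=1..n. a j * (LINT y|lborel. heat t (X j - y) * jbr y powr (\<upsilon> - 3/2)))"
      unfolding Bochner_Integration.integral_add[OF i1 i2] J_def
      using H2(2)[OF t] by (subst integral_mult_right_zero, subst integral_mult_right_zero, subst Bochner_Integration.integral_sum) auto
    also have "\<dots> \<le> W * H1 * J + 2 * pi / real n * (\<Sum>j=1..n. c * W * H2 * jbr (X j) powr (1/2))"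
    proof (intro add_left_mono mult_left_mono sum_mono)
      fix j assume j: "j \<in> {1..n}"
      have s: "sin (node n j / 2) > 0" using node_bounds[OF n j] by (intro sin_gt_zero) auto
      have "a j \<le> (W * jbr (X j) powr (- \<upsilon>)) * (c * jbr (X j) powr 2)"
        unfolding a_def X_def c_def using W g moebius'_le_jbr[OF g s]
        by (intro mult_mono W) (auto simp: moebius'_nonneg)
      moreover have "(LINT y|lborel. heat t (X j - y) * jbr y powr (\<upsilon> - 3/2)) \<le> H2 * 1 * jbr (X j) powr (\<upsilon> - 3/2)"
        using H2 et by (intro order.trans[OF H2(3)[OF t]] mult_right_mono mult_left_mono) auto
      ultimately have "a j * (LINT y|lborel. heat t (X j - y) * jbr y powr (\<upsilon> - 3/2))
        \<le> (W * jbr (X j) powr (- \<upsilon>)) * (c * jbr (X j) powr 2) * (H2 * 1 * jbr (X j) powr (\<upsilon> - 3/2))"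
        using W c0 a0
        by (intro mult_mono) (auto intro!: integral_nonneg_AE simp: heat_nonneg)
      also have "\<dots> = c * W * H2 * (jbr (X j) powr (- \<upsilon>) * jbr (X j) powr 2 * jbr (X j) powr (\<upsilon> - 3/2))"
        by (simp only: mult_ac mult_1_right mult_1_left)
      also have "jbr (X j) powr (- \<upsilon>) * jbr (X j) powr 2 * jbr (X j) powr (\<upsilon> - 3/2) = jbr (X j) powr (1/2)"
        unfolding powr_add[symmetric] by simp
      finally show "a j * (LINT y|lborel. heat t (X j - y) * jbr y powr (\<upsilon> - 3/2)) \<le> c * W * H2 * jbr (X j) powr (1/2)" .
    qed auto
    also have "\<dots> = W * H1 * J + c * W * H2 * (2 * pi / real n * (\<Sum>j=1..n. jbr (X j) powr (1/2)))"
      by (simp add: sum_distrib_left[symmetric] mult_ac)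
    also have "\<dots> \<le> W * H1 * J + c * W * H2 * S"
      using c0 W H2 S(2)[OF n] unfolding X_def by (intro add_left_mono mult_left_mono) auto
    finally show "(\<integral>\<^sup>+y. ennreal (quad_abs q \<gamma> \<upsilon> n t y * jbr y powr (\<upsilon> - 3/2)) \<partial>lborel) \<le> ennreal ?C"
      by (auto simp: ennreal_leI)
  qed
qed

section \<open>The dual estimate\<close>

definition Theta :: "real \<Rightarrow> real \<Rightarrow> real \<Rightarrow> real" where
  "Theta r s R = (if R < 1 then R powr (- (r - 1)) else R powr (- (r - 1) - s - 1/4))"

lemma Theta_nonneg: "0 \<le> Theta r s R"
  by (simp add: Theta_def)

text \<open>\<open>W\<close> is the bracket of \<open>y\<close> and \<open>R = n * sqrt t\<close>, so \<open>W\<^sup>2 / R\<close> is the ratio of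
  the local mesh width to the width of the kernel. Where the mesh is too coarse, the first-order
  estimate is used for the power \<open>r - 1\<close> only.\<close>

lemma interpolated_bound:
  assumes W: "W \<ge> 1" and R: "R > 0" and e: "0 \<le> e" "e \<le> B" and C: "C1 > 0" "CM > 0"
    and e1: "e \<le> C1 * W powr (-\<upsilon>) * (W\<^sup>2 / R)"
    and eM: "e \<le> CM * W powr (-\<upsilon>) * (W\<^sup>2 / R) ^ M"
    and r: "r > 1" and s: "s \<ge> 0" and M: "r + s - 3/4 \<le> real M * r"
  shows "e powr r * W powr (r * (\<upsilon> - 2) - 2 * s)
    \<le> (C1 powr (r - 1) + CM powr r) * Theta r s R * (W powr (-3/2) + B * W powr (\<upsilon> - 3/2))"
proof (cases "e = 0")
  case True
  then show ?thesis using e by (simp add: Theta_nonneg)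
next
  case False
  with e have e0: "e > 0" by simp
  have W0: "W > 0" using W by simp
  have W2: "W\<^sup>2 = W powr 2" using W0 by simp
  show ?thesis
  proof (cases "R \<le> W\<^sup>2")
    case True
    have "e powr (r - 1) \<le> (C1 * W powr (-\<upsilon>) * (W\<^sup>2 / R)) powr (r - 1)"
      using e0 e1 r by (intro powr_mono2) auto
    also have "C1 * W powr (-\<upsilon>) * (W\<^sup>2 / R) = C1 * (W powr (2 - \<upsilon>) * R powr (- 1))"
      unfolding W2 using R W0 by (simp add: powr_diff powr_minus_divide field_simps)
    also have "\<dots> powr (r - 1) = C1 powr (r - 1) * (W powr ((2 - \<upsilon>) * (r - 1)) * R powr (- (r - 1)))"
      using C R W0 by (simp add: powr_mult powr_powr del: powr_neg_one')
    finally have er: "e powr (r - 1) \<le> C1 powr (r - 1) * (W powr ((2 - \<upsilon>) * (r - 1)) * R powr (- (r - 1)))" .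
    \<comment> \<open>The surplus of negative powers of \<open>W\<close> is converted into decay in
      \<open>R\<close>; it is available only because the mass weight has exponent 3/2 instead of
      2.\<close>
    have th: "R powr (- (r - 1)) * W powr (- (1/2 + 2 * s)) \<le> Theta r s R"
    proof (cases "R < 1")
      case True
      have "W powr (- (1/2 + 2 * s)) \<le> 1"
        using powr_mono2'[of "- (1/2 + 2 * s)" 1 W] W s by simp
      then show ?thesis using True by (simp add: Theta_def mult_left_le)
    next
      case False
      have "W powr (- (1/2 + 2 * s)) = (W\<^sup>2) powr (- (s + 1/4))"
        unfolding W2 powr_powr by (simp add: algebra_simps)
      also have "\<dots> \<le> R powr (- (s + 1/4))"
        using \<open>R \<le> W\<^sup>2\<close> R s by (intro powr_mono2') auto
      finally have "R powr (- (r - 1)) * W powr (- (1/2 + 2 * s)) \<le> R powr (- (r - 1)) * R powr (- (s + 1/4))"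
        by (intro mult_left_mono) auto
      also have "\<dots> = Theta r s R" using False by (simp add: Theta_def powr_add[symmetric])
      finally show ?thesis .
    qed
    have "e powr r * W powr (r * (\<upsilon> - 2) - 2 * s) = e powr (r - 1) * e * W powr (r * (\<upsilon> - 2) - 2 * s)"
      using e0 by (simp add: powr_diff)
    also have "\<dots> \<le> (C1 powr (r - 1) * (W powr ((2 - \<upsilon>) * (r - 1)) * R powr (- (r - 1)))) * B * W powr (r * (\<upsilon> - 2) - 2 * s)"
      using e er by (intro mult_right_mono mult_mono) auto
    also have "\<dots> = C1 powr (r - 1) * B * R powr (- (r - 1)) * (W powr ((2 - \<upsilon>) * (r - 1)) * W powr (r * (\<upsilon> - 2) - 2 * s))"
      by (simp only: mult_ac)
    also have "W powr ((2 - \<upsilon>) * (r - 1)) * W powr (r * (\<upsilon> - 2) - 2 * s) = W powr (- (1/2 + 2 * s)) * W powr (\<upsilon> - 3/2)"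
      unfolding powr_add[symmetric] by (rule arg_cong[where f = "\<lambda>a. W powr a"]) (simp add: algebra_simps)
    also have "C1 powr (r - 1) * B * R powr (- (r - 1)) * (W powr (- (1/2 + 2 * s)) * W powr (\<upsilon> - 3/2))
      = (R powr (- (r - 1)) * W powr (- (1/2 + 2 * s))) * (C1 powr (r - 1) * (B * W powr (\<upsilon> - 3/2)))"
      by (simp only: mult_ac)
    also have "\<dots> \<le> Theta r s R * ((C1 powr (r - 1) + CM powr r) * (W powr (-3/2) + B * W powr (\<upsilon> - 3/2)))"
      using e by (intro mult_mono[OF th] mult_mono) (auto simp: Theta_nonneg)
    finally show ?thesis by (simp only: mult_ac)
  next
    case False
    have "1 \<le> W\<^sup>2" using W by (rule one_le_power)
    then have R1: "R > 1" "W\<^sup>2 / R < 1" using False R by (linarith, simp add: divide_less_eq)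
    have "e powr r \<le> (CM * W powr (-\<upsilon>) * (W\<^sup>2 / R) ^ M) powr r"
      using e0 eM r by (intro powr_mono2) auto
    also have "(W\<^sup>2 / R) ^ M = (W\<^sup>2 / R) powr real M"
      using W0 R by (intro powr_realpow[symmetric]) auto
    also have "(CM * W powr (-\<upsilon>) * (W\<^sup>2 / R) powr real M) powr r
      = CM powr r * W powr (-\<upsilon> * r) * (W\<^sup>2 / R) powr (real M * r)"
      using C by (simp only: powr_mult powr_powr)
    \<comment> \<open>Since \<open>W^2 / R < 1\<close>, the exponent may be lowered from
      \<open>M * r\<close> to \<open>r + s - 3/4\<close>, the value for which all powers of
      \<open>W\<close> combine to the integrable \<open>W powr (- 3/2)\<close>.\<close>
    also have "\<dots> \<le> CM powr r * W powr (-\<upsilon> * r) * (W\<^sup>2 / R) powr (r + s - 3/4)"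
      using R1 W0 R M by (intro mult_left_mono powr_mono') auto
    also have "(W\<^sup>2 / R) powr (r + s - 3/4) = W powr (2 * (r + s - 3/4)) * R powr (- (r - 1) - s - 1/4)"
    proof -
      have "(W\<^sup>2 / R) powr a = W powr (2 * a) * R powr (- a)" for a
        unfolding W2 using R W0 by (simp add: powr_divide powr_powr powr_minus_divide del: powr_numeral)
      moreover have "- (r + s - 3/4) = - (r - 1) - s - 1/4" by simp
      ultimately show ?thesis by metis
    qed
    finally have "e powr r * W powr (r * (\<upsilon> - 2) - 2 * s)
      \<le> CM powr r * W powr (-\<upsilon> * r) * (W powr (2 * (r + s - 3/4)) * R powr (- (r - 1) - s - 1/4)) * W powr (r * (\<upsilon> - 2) - 2 * s)"
      by (intro mult_right_mono) auto
    also have "\<dots> = CM powr r * R powr (- (r - 1) - s - 1/4) * (W powr (-\<upsilon> * r) * W powr (2 * (r + s - 3/4)) * W powr (r * (\<upsilon> - 2) - 2 * s))"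
      by (simp only: mult_ac)
    also have "W powr (-\<upsilon> * r) * W powr (2 * (r + s - 3/4)) * W powr (r * (\<upsilon> - 2) - 2 * s) = W powr (-3/2)"
      unfolding powr_add[symmetric] by (rule arg_cong[where f = "\<lambda>a. W powr a"]) (simp add: algebra_simps)
    also have "R powr (- (r - 1) - s - 1/4) = Theta r s R" using R1 by (simp add: Theta_def)
    also have "CM powr r * Theta r s R * W powr (-3/2)
      \<le> (C1 powr (r - 1) + CM powr r) * Theta r s R * (W powr (-3/2) + B * W powr (\<upsilon> - 3/2))"
      using e by (intro mult_mono) (auto simp: Theta_nonneg)
    finally show ?thesis .
  qed
qed

lemma quad_err_dual_bound:
  assumes g: "\<gamma> > 0" and m: "m \<ge> 1" and deg: "degree q = 2 * m" and pos: "\<And>x. poly q x > 0"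
    and r: "r > 1" and s: "s \<ge> 0"
  obtains C where "C > 0" "\<And>n t. n \<ge> 1 \<Longrightarrow> t > 0 \<Longrightarrow>
    (\<integral>\<^sup>+y. ennreal (\<bar>quad_err q \<gamma> \<upsilon> n t y\<bar> powr r * jbr y powr (r * (\<upsilon> - 2) - 2 * s)) \<partial>lborel)
      \<le> ennreal (C * Theta r s (real n * sqrt t))"
proof -
  \<comment> \<open>The order has to grow with \<open>s\<close>, hence with the smoothness \<alpha>,
    so that \<open>M * r \<ge> r + s\<close>.\<close>
  define M where "M = nat \<lceil>1 + s / r\<rceil>"
  have "1 + s / r \<le> real M" unfolding M_def by linarith
  then have "(1 + s / r) * r \<le> real M * r" using r by (intro mult_right_mono) auto
  then have Mr: "r + s - 3/4 \<le> real M * r" using r by (simp add: algebra_simps)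
  have M1: "M \<ge> 1"
  proof (rule ccontr)
    assume "\<not> M \<ge> 1"
    then have "real M = 0" by simp
    with Mr r s show False by simp
  qed
  obtain C1 where C1: "C1 > 0" "\<And>n t y. n \<ge> 1 \<Longrightarrow> t > 0 \<Longrightarrow> \<bar>quad_err q \<gamma> \<upsilon> n t y\<bar>
    \<le> C1 * jbr y powr (- \<upsilon>) * ((jbr y)\<^sup>2 / (real n * sqrt t))"
    using quad_err_smooth_bound[OF g m deg pos, of 1 \<upsilon>] by auto
  obtain CM where CM: "CM > 0" "\<And>n t y. n \<ge> 1 \<Longrightarrow> t > 0 \<Longrightarrow> \<bar>quad_err q \<gamma> \<upsilon> n t y\<bar>
    \<le> CM * jbr y powr (- \<upsilon>) * ((jbr y)\<^sup>2 / (real n * sqrt t)) ^ M"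
    using quad_err_smooth_bound[OF g m deg pos M1, of \<upsilon>] by blast
  obtain CB where CB: "CB > 0" "\<And>n t. n \<ge> 1 \<Longrightarrow> t > 0 \<Longrightarrow>
    (\<integral>\<^sup>+y. ennreal (quad_abs q \<gamma> \<upsilon> n t y * jbr y powr (\<upsilon> - 3/2)) \<partial>lborel) \<le> ennreal CB"
    using quad_abs_integral_bound[OF g m deg pos, of \<upsilon>] by blast
  define J where "J = (LINT y|lborel. jbr y powr (-3/2))"
  have J0: "J \<ge> 0" unfolding J_def by (intro integral_nonneg_AE) auto
  have Je: "(\<integral>\<^sup>+y. ennreal (jbr y powr (-3/2)) \<partial>lborel) = ennreal J"
    unfolding J_def by (intro nn_integral_eq_integral integrable_jbr_powr) auto
  define K where "K = C1 powr (r - 1) + CM powr r"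
  have K0: "K > 0" using C1 CM by (simp add: K_def add_pos_pos)
  show ?thesis
  proof
    show "K * (J + CB) > 0" using K0 J0 CB by (intro mult_pos_pos) auto
    fix n :: nat and t :: real assume n: "n \<ge> 1" and t: "t > 0"
    define R where "R = real n * sqrt t"
    have R0: "R > 0" using n t by (simp add: R_def)
    have [measurable]: "quad_abs q \<gamma> \<upsilon> n t \<in> borel_measurable borel"
      unfolding quad_abs_def[abs_def] by measurable
    have qa0: "0 \<le> quad_abs q \<gamma> \<upsilon> n t y" for y
      using quad_err_le_abs[OF g, of q \<upsilon> n t y] by linarith
    have "(\<integral>\<^sup>+y. ennreal (\<bar>quad_err q \<gamma> \<upsilon> n t y\<bar> powr r * jbr y powr (r * (\<upsilon> - 2) - 2 * s)) \<partial>lborel)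
      \<le> (\<integral>\<^sup>+y. ennreal (K * Theta r s R) * (ennreal (jbr y powr (-3/2)) + ennreal (quad_abs q \<gamma> \<upsilon> n t y * jbr y powr (\<upsilon> - 3/2))) \<partial>lborel)"
    proof (intro nn_integral_mono)
      fix y
      have "\<bar>quad_err q \<gamma> \<upsilon> n t y\<bar> powr r * jbr y powr (r * (\<upsilon> - 2) - 2 * s)
        \<le> K * Theta r s R * (jbr y powr (-3/2) + quad_abs q \<gamma> \<upsilon> n t y * jbr y powr (\<upsilon> - 3/2))"
        unfolding K_def R_def
        by (rule interpolated_bound[OF jbr_ge_1 R0[unfolded R_def] _ quad_err_le_abs[OF g] C1(1) CM(1) C1(2)[OF n t] CM(2)[OF n t] r s Mr]) simp
      then show "ennreal (\<bar>quad_err q \<gamma> \<upsilon> n t y\<bar> powr r * jbr y powr (r * (\<upsilon> - 2) - 2 * s))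
        \<le> ennreal (K * Theta r s R) * (ennreal (jbr y powr (-3/2)) + ennreal (quad_abs q \<gamma> \<upsilon> n t y * jbr y powr (\<upsilon> - 3/2)))"
        using K0 qa0 by (simp add: ennreal_plus[symmetric] ennreal_mult'[symmetric] Theta_nonneg ennreal_leI del: ennreal_plus)
    qed
    also have "\<dots> = ennreal (K * Theta r s R) * (ennreal J + (\<integral>\<^sup>+y. ennreal (quad_abs q \<gamma> \<upsilon> n t y * jbr y powr (\<upsilon> - 3/2)) \<partial>lborel))"
      unfolding Je[symmetric] by (simp add: nn_integral_cmult nn_integral_add)
    also have "\<dots> \<le> ennreal (K * Theta r s R) * (ennreal J + ennreal CB)"
      by (intro mult_left_mono add_left_mono CB n t) auto
    also have "\<dots> = ennreal (K * Theta r s R * (J + CB))"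
      using J0 CB K0 by (simp add: ennreal_plus[symmetric] ennreal_mult'[symmetric] Theta_nonneg del: ennreal_plus)
    finally show "(\<integral>\<^sup>+y. ennreal (\<bar>quad_err q \<gamma> \<upsilon> n t y\<bar> powr r * jbr y powr (r * (\<upsilon> - 2) - 2 * s)) \<partial>lborel)
      \<le> ennreal (K * (J + CB) * Theta r s (real n * sqrt t))"
      by (simp add: R_def mult_ac)
  qed
qed

section \<open>Hoelder's inequality and the scaling in the time variable\<close>

lemma holder_nn_integral_pos:
  fixes a b :: "'a \<Rightarrow> real"
  assumes [measurable]: "a \<in> borel_measurable M" "b \<in> borel_measurable M"
    and nn: "\<And>x. 0 \<le> a x" "\<And>x. 0 \<le> b x"
    and p: "p > 1" "r > 1" "1 / p + 1 / r = 1" and AB: "A > 0" "B > 0"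
    and A: "(\<integral>\<^sup>+x. ennreal (a x powr p) \<partial>M) \<le> ennreal A"
    and B: "(\<integral>\<^sup>+x. ennreal (b x powr r) \<partial>M) \<le> ennreal B"
  shows "(\<integral>\<^sup>+x. ennreal (a x * b x) \<partial>M) \<le> ennreal (A powr (1/p) * B powr (1/r))"
proof -
  \<comment> \<open>Young's inequality is applied to the factors normalized by
    \<open>A powr (1/p)\<close> and \<open>B powr (1/r)\<close>; the two terms then integrate to at
    most \<open>c / p\<close> and \<open>c / r\<close>.\<close>
  define c where "c = A powr (1/p) * B powr (1/r)"
  have c0: "c > 0" using AB by (simp add: c_def)
  have pt: "a x * b x \<le> c / (A * p) * a x powr p + c / (B * r) * b x powr r" for x
  proof -
    have "(a x / A powr (1/p)) * (b x / B powr (1/r))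
      \<le> (a x / A powr (1/p)) powr p / p + (b x / B powr (1/r)) powr r / r"
      using p nn AB by (intro Youngs_inequality) auto
    also have "\<dots> = a x powr p / (A * p) + b x powr r / (B * r)"
      using p nn AB by (simp add: powr_divide powr_powr)
    finally have "c * ((a x / A powr (1/p)) * (b x / B powr (1/r))) \<le> c * (a x powr p / (A * p) + b x powr r / (B * r))"
      using c0 by (intro mult_left_mono) auto
    moreover have "c * ((a x / A powr (1/p)) * (b x / B powr (1/r))) = a x * b x"
      using AB by (simp add: c_def)
    ultimately show ?thesis by (simp add: algebra_simps)
  qed
  have "(\<integral>\<^sup>+x. ennreal (a x * b x) \<partial>M)
    \<le> (\<integral>\<^sup>+x. ennreal (c / (A * p)) * ennreal (a x powr p) + ennreal (c / (B * r)) * ennreal (b x powr r) \<partial>M)"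
    using c0 AB p pt by (intro nn_integral_mono)
      (simp add: ennreal_mult'[symmetric] ennreal_plus[symmetric] ennreal_leI del: ennreal_plus)
  also have "\<dots> = ennreal (c / (A * p)) * (\<integral>\<^sup>+x. ennreal (a x powr p) \<partial>M)
      + ennreal (c / (B * r)) * (\<integral>\<^sup>+x. ennreal (b x powr r) \<partial>M)"
    by (simp add: nn_integral_cmult nn_integral_add)
  also have "\<dots> \<le> ennreal (c / (A * p)) * ennreal A + ennreal (c / (B * r)) * ennreal B"
    by (intro add_mono mult_left_mono A B) auto
  also have "\<dots> = ennreal (c / (A * p) * A + c / (B * r) * B)"
    using c0 AB p by (simp add: ennreal_mult'[symmetric] ennreal_plus[symmetric] del: ennreal_plus)
  also have "c / (A * p) * A + c / (B * r) * B = c * (1 / p + 1 / r)"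
    using AB p by (simp add: field_simps)
  finally show ?thesis using p by (simp add: c_def)
qed

text \<open>Normalization is impossible for a zero bound, so both bounds are increased by a positive
  amount that tends to 0.\<close>

lemma holder_nn_integral:
  fixes a b :: "'a \<Rightarrow> real"
  assumes M: "a \<in> borel_measurable M" "b \<in> borel_measurable M"
    and nn: "\<And>x. 0 \<le> a x" "\<And>x. 0 \<le> b x"
    and p: "p > 1" "r > 1" "1 / p + 1 / r = 1" and AB: "A \<ge> 0" "B \<ge> 0"
    and A: "(\<integral>\<^sup>+x. ennreal (a x powr p) \<partial>M) \<le> ennreal A"
    and B: "(\<integral>\<^sup>+x. ennreal (b x powr r) \<partial>M) \<le> ennreal B"
  shows "(\<integral>\<^sup>+x. ennreal (a x * b x) \<partial>M) \<le> ennreal (A powr (1/p) * B powr (1/r))"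
proof (rule tendsto_lowerbound)
  have "((\<lambda>\<epsilon>. (A + \<epsilon>) powr (1/p) * (B + \<epsilon>) powr (1/r)) \<longlongrightarrow> (A + 0) powr (1/p) * (B + 0) powr (1/r)) (at_right 0)"
    using p AB
    by (intro tendsto_mult tendsto_powr' tendsto_add tendsto_const tendsto_ident_at)
       (auto simp: eventually_at_filter intro!: always_eventually)
  then show "((\<lambda>\<epsilon>. ennreal ((A + \<epsilon>) powr (1/p) * (B + \<epsilon>) powr (1/r))) \<longlongrightarrow> ennreal (A powr (1/p) * B powr (1/r))) (at_right 0)"
    by (simp add: tendsto_ennrealI)
  show "\<forall>\<^sub>F \<epsilon> in at_right 0. (\<integral>\<^sup>+x. ennreal (a x * b x) \<partial>M) \<le> ennreal ((A + \<epsilon>) powr (1/p) * (B + \<epsilon>) powr (1/r))"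
  proof (rule eventually_mono[OF eventually_at_right_less[of 0]])
    fix \<epsilon> :: real assume "0 < \<epsilon>"
    then show "(\<integral>\<^sup>+x. ennreal (a x * b x) \<partial>M) \<le> ennreal ((A + \<epsilon>) powr (1/p) * (B + \<epsilon>) powr (1/r))"
      using AB by (intro holder_nn_integral_pos M nn p order.trans[OF A] order.trans[OF B] ennreal_leI) auto
  qed
qed simp

text \<open>\<open>Theta\<close> depends on \<open>n\<close> and \<open>t\<close> only through
  \<open>n^2 * t\<close>. The substitution turns \<open>t powr (\<alpha> / 2 - 1)\<close> and the
  measure into \<open>n powr (- \<alpha>)\<close> times an integral free of \<open>n\<close>, and
  this is the source of the convergence rate.\<close>

lemma Theta_integral:
  fixes \<alpha> p r :: real
  assumes p: "p > 1" and a: "\<alpha> > 1 / p" and r: "r = p / (p - 1)" and s: "s = (\<alpha> - 1 / p) * r"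
  obtains C where "C \<ge> 0" "\<And>n. n \<ge> 1 \<Longrightarrow>
    (\<integral>\<^sup>+t. ennreal (indicator {0<..} t * t powr (\<alpha> / 2 - 1) * Theta r s (real n * sqrt t) powr (1 / r)) \<partial>lborel)
      = ennreal (C * real n powr (- \<alpha>))"
proof -
  have r1: "r > 1" using p by (simp add: r field_simps)
  have ir: "1 / r = 1 - 1 / p" using p by (simp add: r field_simps)
  define h where "h t = indicator {0<..} t * t powr (\<alpha> / 2 - 1) * Theta r s (sqrt t) powr (1 / r)" for t :: real
  \<comment> \<open>The exponents of the integrand at small and large \<open>t\<close>. The first
    exceeds -1 because \<alpha> > 1 / p. In the second, \<open>s / r = \<alpha> - 1 / p\<close>
    cancels \<alpha>, and the spare 1/4 in \<open>Theta\<close> brings it below -1.\<close>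
  define e1 where "e1 = \<alpha> / 2 - 1 - 1 / (2 * p)"
  define e2 where "e2 = - 1 - 1 / (8 * r)"
  have h0: "0 \<le> h t" for t by (simp add: h_def)
  have hm [measurable]: "h \<in> borel_measurable borel"
    unfolding h_def[abs_def] Theta_def by measurable
  have x1: "- (r - 1) / r = - 1 / p" using r1 ir by (simp add: diff_divide_distrib)
  have x2: "(- (r - 1) - s - 1/4) / r = - \<alpha> - 1 / (4 * r)"
  proof -
    have "(- (r - 1) - s - 1/4) / r = - (r - 1) / r - s / r - 1 / (4 * r)"
      using r1 by (simp add: field_simps)
    then show ?thesis unfolding x1 using r1 by (simp add: s)
  qed
  have h1: "h t = t powr e1" if "0 < t" "t < 1" for t
  proof -
    have "Theta r s (sqrt t) = (t powr (1/2)) powr (- (r - 1))"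
      using that by (simp add: Theta_def powr_half_sqrt)
    then have "Theta r s (sqrt t) powr (1 / r) = t powr (1/2 * (- (r - 1) / r))"
      by (simp add: powr_powr)
    then show ?thesis
      unfolding x1 using that by (simp add: h_def e1_def powr_add[symmetric])
  qed
  have h2: "h t = t powr e2" if "1 \<le> t" for t
  proof -
    have "Theta r s (sqrt t) = (t powr (1/2)) powr (- (r - 1) - s - 1/4)"
      using that by (simp add: Theta_def powr_half_sqrt)
    then have "Theta r s (sqrt t) powr (1 / r) = t powr (1/2 * ((- (r - 1) - s - 1/4) / r))"
      by (simp add: powr_powr)
    then show ?thesis
      unfolding x2 using that by (simp add: h_def e2_def powr_add[symmetric] algebra_simps)
  qed
  have e1: "e1 > -1" using a by (simp add: e1_def field_simps)
  have e2: "e2 < -1" using r1 by (simp add: e2_def)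
  have i1: "integrable lborel (\<lambda>t. indicator {0..1} t * t powr e1)"
  proof -
    have "((\<lambda>t. t powr e1) has_integral 1 powr (e1 + 1) / (e1 + 1)) {0..1::real}"
      by (rule has_integral_powr_from_0) (use e1 in auto)
    then have "(\<lambda>t::real. t powr e1) absolutely_integrable_on {0..1}"
      by (intro nonnegative_absolutely_integrable_1) (auto simp: integrable_on_def)
    then show ?thesis unfolding set_integrable_def by (simp add: integrable_completion)
  qed
  have i2: "integrable lborel (\<lambda>t. indicator {1..} t * t powr e2)"
  proof -
    have "((\<lambda>t. t powr e2) has_integral - (1 powr (e2 + 1)) / (e2 + 1)) {1::real..}"
      by (rule has_integral_powr_to_inf) (use e2 in auto)
    then have "(\<lambda>t::real. t powr e2) absolutely_integrable_on {1..}"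
      by (intro nonnegative_absolutely_integrable_1) (auto simp: integrable_on_def)
    then show ?thesis unfolding set_integrable_def by (simp add: integrable_completion)
  qed
  have ih: "integrable lborel h"
  proof (rule Bochner_Integration.integrable_bound[OF Bochner_Integration.integrable_add[OF i1 i2]])
    show "AE t in lborel. norm (h t) \<le> norm (indicator {0..1} t * t powr e1 + indicator {1..} t * t powr e2)"
    proof (intro AE_I2)
      fix t :: real
      consider "t \<le> 0" | "0 < t" "t < 1" | "1 \<le> t" by linarith
      then show "norm (h t) \<le> norm (indicator {0..1} t * t powr e1 + indicator {1..} t * t powr e2)"
        by cases (auto simp: h1 h2 indicator_def, auto simp: h_def)
    qed
  qed measurable
  define C where "C = integral\<^sup>L lborel h"
  show ?thesis
  proof
    show C0: "C \<ge> 0" unfolding C_def using h0 by (intro integral_nonneg_AE) auto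
    have hC: "(\<integral>\<^sup>+t. ennreal (h t) \<partial>lborel) = ennreal C"
      unfolding C_def using h0 by (intro nn_integral_eq_integral ih) auto
    fix n :: nat assume n: "n \<ge> 1"
    define N where "N = real n"
    have N: "N > 0" using n by (simp add: N_def)
    have sc: "indicator {0<..} t * t powr (\<alpha> / 2 - 1) * Theta r s (N * sqrt t) powr (1 / r)
       = N powr (2 - \<alpha>) * h (0 + N\<^sup>2 * t)" for t
    proof (cases "t > 0")
      case True
      have "sqrt (N\<^sup>2 * t) = N * sqrt t" using N by (simp add: real_sqrt_mult)
      moreover have "(N\<^sup>2 * t) powr (\<alpha> / 2 - 1) = N powr (\<alpha> - 2) * t powr (\<alpha> / 2 - 1)"
        using N True by (simp add: powr_mult powr_powr powr_realpow[symmetric] algebra_simps del: powr_numeral)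
      moreover have "N powr (2 - \<alpha>) * N powr (\<alpha> - 2) = 1" using N by (simp add: powr_add[symmetric])
      ultimately show ?thesis using True N by (simp add: h_def)
    next
      case False
      then show ?thesis using N by (simp add: h_def mult_nonneg_nonpos zero_less_mult_iff)
    qed
    have aff: "(\<integral>\<^sup>+t. ennreal (h t) \<partial>lborel) = ennreal \<bar>N\<^sup>2\<bar> * (\<integral>\<^sup>+t. ennreal (h (0 + N\<^sup>2 * t)) \<partial>lborel)"
      using N by (intro nn_integral_real_affine) auto
    have "(\<integral>\<^sup>+t. ennreal (indicator {0<..} t * t powr (\<alpha> / 2 - 1) * Theta r s (N * sqrt t) powr (1 / r)) \<partial>lborel)
      = (\<integral>\<^sup>+t. ennreal (N powr (2 - \<alpha>)) * ennreal (h (0 + N\<^sup>2 * t)) \<partial>lborel)"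
      unfolding sc using h0 by (simp add: ennreal_mult')
    also have "\<dots> = ennreal (N powr (2 - \<alpha>)) * (\<integral>\<^sup>+t. ennreal (h (0 + N\<^sup>2 * t)) \<partial>lborel)"
      by (intro nn_integral_cmult) measurable
    also have "N powr (2 - \<alpha>) = N powr (- \<alpha>) * \<bar>N\<^sup>2\<bar>"
      using N powr_add[of N "- \<alpha>" 2] by simp
    also have "ennreal (N powr (- \<alpha>) * \<bar>N\<^sup>2\<bar>) * (\<integral>\<^sup>+t. ennreal (h (0 + N\<^sup>2 * t)) \<partial>lborel)
      = ennreal (N powr (- \<alpha>)) * (\<integral>\<^sup>+t. ennreal (h t) \<partial>lborel)"
      unfolding aff by (subst ennreal_mult') (auto simp: mult.assoc)
    also have "\<dots> = ennreal (C * N powr (- \<alpha>))"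
      unfolding hC using C0 by (simp add: ennreal_mult'[symmetric] mult.commute)
    finally show "(\<integral>\<^sup>+t. ennreal (indicator {0<..} t * t powr (\<alpha> / 2 - 1) * Theta r s (real n * sqrt t) powr (1 / r)) \<partial>lborel)
      = ennreal (C * real n powr (- \<alpha>))" by (simp add: N_def)
  qed
qed

section \<open>Bessel potentials of Gaussians\<close>

text \<open>The heat kernel without damping, indexed by time and not by variance: its Fourier
  transform is \<open>exp (- \<tau> * \<xi>^2)\<close>, and times add under convolution.\<close>

definition gauss :: "real \<Rightarrow> real \<Rightarrow> real" where
  "gauss \<tau> z = normal_density 0 (sqrt (2 * \<tau>)) z"

lemma gauss_nonneg [simp]: "0 \<le> gauss \<tau> z"
  by (simp add: gauss_def)

text \<open>Dominated convergence for difference quotients along sequences; the mean value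
  inequality carries the bound on \<open>f'\<close> over to them.\<close>

lemma has_real_derivative_lebesgue_integral:
  fixes f f' :: "real \<Rightarrow> 'a \<Rightarrow> real"
  assumes der: "\<And>x t. ((\<lambda>x. f x t) has_real_derivative f' x t) (at x)"
    and bnd: "\<And>x t. \<bar>f' x t\<bar> \<le> B t" and B: "integrable M B"
    and f: "\<And>x. integrable M (f x)" and f': "f' x \<in> borel_measurable M"
  shows "((\<lambda>x. LINT t|M. f x t) has_real_derivative (LINT t|M. f' x t)) (at x)"
  unfolding has_field_derivative_iff tendsto_at_iff_sequentially
proof (intro allI impI)
  fix X :: "nat \<Rightarrow> real"
  assume X: "\<forall>i. X i \<in> UNIV - {x}" "X \<longlonglongrightarrow> x"
  have eq: "((LINT t|M. f y t) - (LINT t|M. f x t)) / (y - x) = (LINT t|M. (f y t - f x t) / (y - x))" for y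
    using f by simp
  have lip: "\<bar>(f y t - f x t) / (y - x)\<bar> \<le> B t" if "y \<noteq> x" for y t
  proof -
    have "norm (f y t - f x t) \<le> B t * norm (y - x)"
      by (rule field_differentiable_bound[of UNIV "\<lambda>x. f x t" "\<lambda>x. f' x t"]) (use der bnd in auto)
    then show ?thesis using that by (simp add: divide_le_eq)
  qed
  have "(\<lambda>i. LINT t|M. (f (X i) t - f x t) / (X i - x)) \<longlonglongrightarrow> (LINT t|M. f' x t)"
  proof (rule integral_dominated_convergence[OF f' _ B])
    show "AE t in M. (\<lambda>i. (f (X i) t - f x t) / (X i - x)) \<longlonglongrightarrow> f' x t"
    proof (intro AE_I2)
      fix t
      have "((\<lambda>y. (f y t - f x t) / (y - x)) \<longlongrightarrow> f' x t) (at x)"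
        using der[of t x] by (simp add: has_field_derivative_iff)
      then show "(\<lambda>i. (f (X i) t - f x t) / (X i - x)) \<longlonglongrightarrow> f' x t"
        using X by (auto simp: tendsto_at_iff_sequentially comp_def)
    qed
    show "AE t in M. norm ((f (X i) t - f x t) / (X i - x)) \<le> B t" for i
      using X lip by (intro AE_I2) auto
  qed (use f in \<open>auto intro!: borel_measurable_integrable\<close>)
  then show "((\<lambda>y. ((LINT t|M. f y t) - (LINT t|M. f x t)) / (y - x)) \<circ> X) \<longlonglongrightarrow> (LINT t|M. f' x t)"
    by (simp add: comp_def eq)
qed

text \<open>Rescaled Hermite polynomials: the \<open>k\<close>-th derivative of
  \<open>exp (- (u^2 / 4))\<close> is
  \<open>poly (hermite_poly k) u * exp (- (u^2 / 4))\<close>.\<close>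

fun hermite_poly :: "nat \<Rightarrow> real poly" where
  "hermite_poly 0 = 1"
| "hermite_poly (Suc k) = pderiv (hermite_poly k) - smult (1/2) (pCons 0 (hermite_poly k))"

text \<open>A closed form of the \<open>k\<close>-th derivative of \<open>gauss\<close> in space.
  Joint measurability and bounds explicit in \<tau> can be read off from it.\<close>

definition gauss_deriv :: "nat \<Rightarrow> real \<Rightarrow> real \<Rightarrow> real" where
  "gauss_deriv k \<tau> z = poly (hermite_poly k) (z / sqrt \<tau>) * (1 / sqrt \<tau>) ^ Suc k * exp (- (z\<^sup>2 / (4 * \<tau>))) / sqrt (4 * pi)"

lemma gauss_eq: "\<tau> > 0 \<Longrightarrow> gauss \<tau> z = exp (- (z\<^sup>2 / (4 * \<tau>))) / sqrt (4 * pi * \<tau>)"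
  by (simp add: gauss_def normal_density_def)

lemma gauss_deriv_0: "\<tau> > 0 \<Longrightarrow> gauss_deriv 0 \<tau> z = gauss \<tau> z"
  unfolding gauss_eq by (simp add: gauss_deriv_def real_sqrt_mult)

lemma gauss_deriv_has_derivative:
  assumes t: "\<tau> > 0"
  shows "(gauss_deriv k \<tau> has_real_derivative gauss_deriv (Suc k) \<tau> z) (at z)"
proof -
  define u e where "u = z / sqrt \<tau>" and "e = exp (- (z\<^sup>2 / (4 * \<tau>)))"
  have d2: "((\<lambda>z. poly (hermite_poly k) (z / sqrt \<tau>)) has_real_derivative (poly (pderiv (hermite_poly k)) u * (1 / sqrt \<tau>))) (at z)"
    unfolding u_def by (rule DERIV_chain2[OF poly_DERIV DERIV_cdivide]) (auto intro!: derivative_eq_intros)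
  have d3: "((\<lambda>z. exp (- (z\<^sup>2 / (4 * \<tau>)))) has_real_derivative (e * (- (u / 2) * (1 / sqrt \<tau>)))) (at z)"
  proof -
    have "u * (1 / sqrt \<tau>) = z / \<tau>" using t by (simp add: u_def)
    then have "- (u / 2) * (1 / sqrt \<tau>) = - (1 / 2) * (z / \<tau>)" by simp
    also have "\<dots> = - (2 * z / (4 * \<tau>))" using t by (simp add: field_simps)
    finally have "- (u / 2) * (1 / sqrt \<tau>) = - (2 * z / (4 * \<tau>))" .
    moreover have "((\<lambda>z. - (z\<^sup>2 / (4 * \<tau>))) has_real_derivative - (2 * z / (4 * \<tau>))) (at z)"
      by (intro DERIV_minus DERIV_cdivide) (auto intro!: derivative_eq_intros)
    ultimately show ?thesis
      unfolding e_def by (metis DERIV_fun_exp)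
  qed
  have "((\<lambda>z. poly (hermite_poly k) (z / sqrt \<tau>) * exp (- (z\<^sup>2 / (4 * \<tau>))) * ((1 / sqrt \<tau>) ^ Suc k / sqrt (4 * pi)))
    has_real_derivative (poly (pderiv (hermite_poly k)) u * (1 / sqrt \<tau>) * e + e * (- (u / 2) * (1 / sqrt \<tau>)) * poly (hermite_poly k) u)
      * ((1 / sqrt \<tau>) ^ Suc k / sqrt (4 * pi))) (at z)"
    using DERIV_cmult_right[OF DERIV_mult[OF d2 d3]] unfolding u_def e_def .
  also have "(poly (pderiv (hermite_poly k)) u * (1 / sqrt \<tau>) * e + e * (- (u / 2) * (1 / sqrt \<tau>)) * poly (hermite_poly k) u)
      * ((1 / sqrt \<tau>) ^ Suc k / sqrt (4 * pi)) = gauss_deriv (Suc k) \<tau> z"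
  proof -
    define w S where "w = 1 / sqrt \<tau>" and "S = sqrt (4 * pi)"
    show ?thesis
      unfolding gauss_deriv_def u_def[symmetric] e_def[symmetric] w_def[symmetric] S_def[symmetric]
      by (simp add: algebra_simps add_divide_distrib diff_divide_distrib)
  qed
  finally show ?thesis
    unfolding gauss_deriv_def[abs_def] by (simp add: mult_ac)
qed

text \<open>Rapid decay with explicit dependence on time. The growth \<open>(1 + \<tau>) ^ j\<close>
  will be absorbed by the damping, and the singularity at 0 is never reached, since \<tau> will be
  \<open>t + s\<close> with a fixed \<open>s > 0\<close>.\<close>

lemma gauss_deriv_bound:
  obtains C where "C > 0" "\<And>\<tau> x. \<tau> > 0 \<Longrightarrow>
    (1 + x\<^sup>2) ^ j * \<bar>gauss_deriv k \<tau> (x - z)\<bar> \<le> C * (1 + \<tau>) ^ j * (1 / sqrt \<tau>) ^ Suc k"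
proof -
  obtain D where D: "D > 0" "\<And>u::real. \<bar>poly ([:1, 0, 1:] ^ j * hermite_poly k) u\<bar> * exp (- (u\<^sup>2 / 4)) \<le> D * exp (- (u\<^sup>2 / 8))"
    using poly_gauss_bound by blast
  show ?thesis
  proof
    show "(2 * (1 + z\<^sup>2)) ^ j * D > 0" using D by (intro mult_pos_pos zero_less_power) (auto intro: add_pos_nonneg)
    fix \<tau> x :: real assume t: "\<tau> > 0"
    define u where "u = (x - z) / sqrt \<tau>"
    have u2: "(x - z)\<^sup>2 / \<tau> = u\<^sup>2" using t by (simp add: u_def power_divide)
    have e1: "1 + x\<^sup>2 \<le> 2 * (1 + z\<^sup>2) * (1 + (x - z)\<^sup>2)"
    proof -
      have "x\<^sup>2 \<le> 2 * z\<^sup>2 + 2 * (x - z)\<^sup>2"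
        using zero_le_power2[of "x - 2 * z"] by (simp add: power2_eq_square algebra_simps)
      moreover have "0 \<le> z\<^sup>2 * (x - z)\<^sup>2" by simp
      moreover have "2 * (1 + z\<^sup>2) * (1 + (x - z)\<^sup>2) = 2 + 2 * z\<^sup>2 + 2 * (x - z)\<^sup>2 + 2 * (z\<^sup>2 * (x - z)\<^sup>2)"
        by (simp add: distrib_left distrib_right)
      ultimately show ?thesis by linarith
    qed
    have "(x - z)\<^sup>2 = \<tau> * u\<^sup>2" using t by (simp add: u2[symmetric])
    then have e2: "1 + (x - z)\<^sup>2 \<le> (1 + \<tau>) * (1 + u\<^sup>2)"
      using t by (simp add: algebra_simps)
    have "1 + x\<^sup>2 \<le> 2 * (1 + z\<^sup>2) * ((1 + \<tau>) * (1 + u\<^sup>2))"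
      using e2 by (intro order.trans[OF e1] mult_left_mono) auto
    then have "(1 + x\<^sup>2) ^ j \<le> (2 * (1 + z\<^sup>2) * ((1 + \<tau>) * (1 + u\<^sup>2))) ^ j"
      by (intro power_mono) auto
    also have "\<dots> = (2 * (1 + z\<^sup>2)) ^ j * (1 + \<tau>) ^ j * (1 + u\<^sup>2) ^ j"
      by (simp add: power_mult_distrib)
    finally have e3: "(1 + x\<^sup>2) ^ j \<le> (2 * (1 + z\<^sup>2)) ^ j * (1 + \<tau>) ^ j * (1 + u\<^sup>2) ^ j" .
    have "D * exp (- (u\<^sup>2 / 8)) \<le> D * 1" using D(1) by (intro mult_left_mono) auto
    then have e4: "(1 + u\<^sup>2) ^ j * \<bar>poly (hermite_poly k) u\<bar> * exp (- (u\<^sup>2 / 4)) \<le> D"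
      using D(2)[of u] by (simp add: abs_mult power2_eq_square power_abs)
    have s1: "1 / sqrt (4 * pi) \<le> 1" using pi_gt3 by (simp add: real_le_rsqrt)
    have "\<bar>gauss_deriv k \<tau> (x - z)\<bar> = \<bar>poly (hermite_poly k) u\<bar> * exp (- (u\<^sup>2 / 4)) * (1 / sqrt \<tau>) ^ Suc k * (1 / sqrt (4 * pi))"
      using t unfolding gauss_deriv_def u_def[symmetric] by (simp add: abs_mult u2[symmetric] power_abs mult.commute)
    also have "\<dots> \<le> \<bar>poly (hermite_poly k) u\<bar> * exp (- (u\<^sup>2 / 4)) * (1 / sqrt \<tau>) ^ Suc k * 1"
      using t s1 by (intro mult_left_mono) auto
    finally have "(1 + x\<^sup>2) ^ j * \<bar>gauss_deriv k \<tau> (x - z)\<bar>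
      \<le> ((2 * (1 + z\<^sup>2)) ^ j * (1 + \<tau>) ^ j * (1 + u\<^sup>2) ^ j) * (\<bar>poly (hermite_poly k) u\<bar> * exp (- (u\<^sup>2 / 4)) * (1 / sqrt \<tau>) ^ Suc k * 1)"
      using t by (intro mult_mono e3) auto
    also have "\<dots> = (2 * (1 + z\<^sup>2)) ^ j * (1 + \<tau>) ^ j * (1 / sqrt \<tau>) ^ Suc k * ((1 + u\<^sup>2) ^ j * \<bar>poly (hermite_poly k) u\<bar> * exp (- (u\<^sup>2 / 4)))"
      by (simp only: mult_ac mult_1_right)
    also have "\<dots> \<le> (2 * (1 + z\<^sup>2)) ^ j * (1 + \<tau>) ^ j * (1 / sqrt \<tau>) ^ Suc k * D"
      using t by (intro mult_left_mono e4) auto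
    finally show "(1 + x\<^sup>2) ^ j * \<bar>gauss_deriv k \<tau> (x - z)\<bar> \<le> (2 * (1 + z\<^sup>2)) ^ j * D * (1 + \<tau>) ^ j * (1 / sqrt \<tau>) ^ Suc k"
      by (simp only: mult_ac)
  qed
qed

text \<open>Euler's integral after rescaling. For \<open>a = \<alpha> / 2\<close> and
  \<open>b = 1 + \<xi>^2\<close> it is the subordination formula for the multiplier
  \<open>(1 + \<xi>^2) powr (- (\<alpha> / 2))\<close>.\<close>

lemma gamma_weight_integral:
  fixes a b :: real
  assumes a: "a > 0" and b: "b > 0"
  shows "integrable lborel (\<lambda>t. indicator {0<..} t * (t powr (a - 1) * exp (- (b * t))))"
    and "(LINT t|lborel. indicator {0<..} t * (t powr (a - 1) * exp (- (b * t)))) = Gamma a * b powr (- a)"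
proof -
  define f where "f t = indicator {0<..} t * (t powr (a - 1) * exp (- t))" for t :: real
  have fm [measurable]: "f \<in> borel_measurable borel" unfolding f_def[abs_def] by measurable
  have "((\<lambda>t. t powr (a - 1) / exp t) has_integral Gamma a) {0..}"
    by (rule Gamma_integral_real[OF a])
  then have 0: "((\<lambda>t. if t \<in> {0..} then t powr (a - 1) / exp t else 0) has_integral Gamma a) UNIV"
    by (simp only: has_integral_restrict_UNIV)
  have hi: "(f has_integral Gamma a) UNIV"
    by (rule has_integral_spike[OF _ _ 0, of "{0}"]) (auto simp: f_def exp_minus divide_inverse)
  have "f absolutely_integrable_on UNIV"
    using hi by (intro nonnegative_absolutely_integrable_1) (auto simp: integrable_on_def f_def)
  then have fi: "integrable lborel f"
    by (simp add: set_integrable_def integrable_completion)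
  have fI: "integral\<^sup>L lborel f = Gamma a"
    using integral_lborel[OF fi] hi by (simp add: integral_unique)
  have eq: "indicator {0<..} t * (t powr (a - 1) * exp (- (b * t))) = b powr (1 - a) * f (0 + b * t)" for t
  proof (cases "t > 0")
    case True
    have "b powr (1 - a) * b powr (a - 1) = 1" using b by (simp add: powr_add[symmetric])
    with True b show ?thesis by (simp add: f_def powr_mult)
  next
    case False
    with b show ?thesis by (simp add: f_def zero_less_mult_iff)
  qed
  show "integrable lborel (\<lambda>t. indicator {0<..} t * (t powr (a - 1) * exp (- (b * t))))"
    unfolding eq using b by (intro integrable_mult_right lborel_integrable_real_affine fi) auto
  have "Gamma a = b * (LINT t|lborel. f (0 + b * t))"
    using lborel_integral_real_affine[of b f 0] b fI by simp
  then have "(LINT t|lborel. f (0 + b * t)) = Gamma a / b" using b by simp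
  moreover have "b powr (1 - a) * (Gamma a / b) = Gamma a * b powr (- a)"
    using b by (simp add: powr_diff powr_minus_divide)
  ultimately show "(LINT t|lborel. indicator {0<..} t * (t powr (a - 1) * exp (- (b * t)))) = Gamma a * b powr (- a)"
    unfolding eq by simp
qed

abbreviation gamma_density :: "real \<Rightarrow> real \<Rightarrow> real" where
  "gamma_density \<alpha> t \<equiv> indicator {0<..} t * (t powr (\<alpha> / 2 - 1) * exp (- t))"

text \<open>The Bessel potential of order \<open>\<alpha>\<close> of the Gaussian \<open>gauss s (x - z)\<close>, and its derivatives.\<close>

definition bessel_gauss :: "nat \<Rightarrow> real \<Rightarrow> real \<Rightarrow> real \<Rightarrow> real \<Rightarrow> real" where
  "bessel_gauss k \<alpha> s z x = (LINT t|lborel. gamma_density \<alpha> t *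
     gauss_deriv k (t + s) (x - z)) / Gamma (\<alpha> / 2)"

lemma gauss_deriv_measurable [measurable (raw)]:
  assumes [measurable]: "f \<in> borel_measurable M" "g \<in> borel_measurable M"
  shows "(\<lambda>x. gauss_deriv k (f x) (g x)) \<in> borel_measurable M"
  unfolding gauss_deriv_def by measurable

text \<open>The offset \<open>s\<close> keeps all times away from 0, which smooths out the
  singularity of the Bessel kernel. The dominating function is independent of \<open>x\<close>, so
  it yields integrability, differentiation under the integral and decay alike.\<close>

lemma bessel_gauss_integrand:
  assumes a: "\<alpha> > 0" and s: "s > 0"
  obtains B where "integrable lborel B" "\<And>x t. (1 + x\<^sup>2) ^ j * \<bar>gamma_density \<alpha> t *
     gauss_deriv k (t + s) (x - z)\<bar> \<le> B t"
proof -
  obtain C where C: "C > 0" "\<And>\<tau> x. \<tau> > 0 \<Longrightarrow>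
    (1 + x\<^sup>2) ^ j * \<bar>gauss_deriv k \<tau> (x - z)\<bar> \<le> C * (1 + \<tau>) ^ j * (1 / sqrt \<tau>) ^ Suc k"
    using gauss_deriv_bound by blast
  obtain D where D: "D > 0" "\<And>x. 0 \<le> x \<Longrightarrow> (1 + x) powr real j \<le> D * exp (1/2 * x)"
    using powr_le_exp[of "1/2" "real j"] by auto
  define E where "E = C * (D * exp (s / 2)) * (1 / sqrt s) ^ Suc k"
  define B where "B t = E * (indicator {0<..} t * (t powr (\<alpha> / 2 - 1) * exp (- (1/2 * t))))" for t :: real
  show ?thesis
  proof
    show "integrable lborel B"
      unfolding B_def using a by (intro integrable_mult_right gamma_weight_integral) auto
    fix x t :: real
    show "(1 + x\<^sup>2) ^ j * \<bar>gamma_density \<alpha> t * gauss_deriv k (t + s) (x - z)\<bar> \<le> B t"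
    proof (cases "t > 0")
      case True
      have ts: "t + s > 0" using True s by simp
      have "(1 / sqrt (t + s)) ^ Suc k \<le> (1 / sqrt s) ^ Suc k"
        using True s by (intro power_mono divide_left_mono) auto
      moreover have "(1 + (t + s)) ^ j \<le> D * exp (s / 2) * exp (t / 2)"
        using D(2)[of "t + s"] True s by (simp add: powr_realpow exp_add[symmetric] add_divide_distrib mult.assoc mult_exp_exp)
           (simp add: add.commute)
      ultimately have "C * (1 + (t + s)) ^ j * (1 / sqrt (t + s)) ^ Suc k \<le> C * (D * exp (s / 2) * exp (t / 2)) * (1 / sqrt s) ^ Suc k"
        using C D ts by (intro mult_mono mult_left_mono) auto
      also have "\<dots> = E * exp (t / 2)" by (simp add: E_def)
      finally have b: "(1 + x\<^sup>2) ^ j * \<bar>gauss_deriv k (t + s) (x - z)\<bar> \<le> E * exp (t / 2)"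
        using C(2)[OF ts, of x] by linarith
      have "(1 + x\<^sup>2) ^ j * \<bar>gamma_density \<alpha> t * gauss_deriv k (t + s) (x - z)\<bar>
        = (t powr (\<alpha> / 2 - 1) * exp (- t)) * ((1 + x\<^sup>2) ^ j * \<bar>gauss_deriv k (t + s) (x - z)\<bar>)"
        using True by (simp add: abs_mult)
      also have "\<dots> \<le> (t powr (\<alpha> / 2 - 1) * exp (- t)) * (E * exp (t / 2))"
        by (intro mult_left_mono b) auto
      also have "\<dots> = E * (t powr (\<alpha> / 2 - 1) * (exp (- t) * exp (t / 2)))" by (simp only: mult_ac)
      also have "exp (- t) * exp (t / 2) = exp (- (1/2 * t))" by (simp add: mult_exp_exp)
      finally show ?thesis using True by (simp add: B_def)
    qed (simp add: B_def)
  qed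
qed

lemma bessel_gauss_integrable:
  assumes a: "\<alpha> > 0" and s: "s > 0"
  shows "integrable lborel (\<lambda>t. gamma_density \<alpha> t * gauss_deriv k (t + s) (x - z))"
proof -
  obtain B where B: "integrable lborel B" "\<And>x t. (1 + x\<^sup>2) ^ 0 * \<bar>gamma_density \<alpha> t *
     gauss_deriv k (t + s) (x - z)\<bar> \<le> B t"
    by (rule bessel_gauss_integrand[OF assms, where j = 0 and k = k and z = z]) (rule that)
  show ?thesis
  proof (rule Bochner_Integration.integrable_bound[OF B(1)])
    show "AE t in lborel. norm (gamma_density \<alpha> t * gauss_deriv k (t + s) (x - z)) \<le> norm (B t)"
    proof (intro AE_I2)
      fix t
      have "norm (gamma_density \<alpha> t * gauss_deriv k (t + s) (x - z)) \<le> B t"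
        using B(2)[of x t] by simp
      also have "B t \<le> norm (B t)" by simp
      finally show "norm (gamma_density \<alpha> t * gauss_deriv k (t + s) (x - z)) \<le> norm (B t)" .
    qed
  qed measurable
qed

lemma bessel_gauss_has_derivative:
  assumes a: "\<alpha> > 0" and s: "s > 0"
  shows "(bessel_gauss k \<alpha> s z has_real_derivative bessel_gauss (Suc k) \<alpha> s z x) (at x)"
proof -
  obtain B where B: "integrable lborel B" "\<And>x t. (1 + x\<^sup>2) ^ 0 * \<bar>gamma_density \<alpha> t *
     gauss_deriv (Suc k) (t + s) (x - z)\<bar> \<le> B t"
    by (rule bessel_gauss_integrand[OF assms, where j = 0 and k = "Suc k" and z = z]) (rule that)
  have "((\<lambda>x. LINT t|lborel. gamma_density \<alpha> t * gauss_deriv k (t + s) (x - z))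
    has_real_derivative (LINT t|lborel. gamma_density \<alpha> t * gauss_deriv (Suc k) (t + s) (x - z))) (at x)"
  proof (rule has_real_derivative_lebesgue_integral[OF _ _ B(1) bessel_gauss_integrable[OF assms]])
    fix x t :: real
    show "((\<lambda>x. gamma_density \<alpha> t * gauss_deriv k (t + s) (x - z)) has_real_derivative
      gamma_density \<alpha> t * gauss_deriv (Suc k) (t + s) (x - z)) (at x)"
    proof (cases "t > 0")
      case True
      have "((\<lambda>x. gauss_deriv k (t + s) (x - z)) has_real_derivative gauss_deriv (Suc k) (t + s) (x - z) * 1) (at x)"
        by (rule DERIV_chain2[OF gauss_deriv_has_derivative]) (use True s in \<open>auto intro!: derivative_eq_intros\<close>)
      then show ?thesis by (intro DERIV_cmult) simp
    qed simp
    show "\<bar>gamma_density \<alpha> t * gauss_deriv (Suc k) (t + s) (x - z)\<bar> \<le> B t"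
      using B(2)[of x t] by simp
  qed measurable
  then show ?thesis unfolding bessel_gauss_def[abs_def] by (rule DERIV_cdivide)
qed

lemma bessel_gauss_bound:
  assumes a: "\<alpha> > 0" and s: "s > 0"
  obtains C where "\<And>x. (1 + x\<^sup>2) ^ j * \<bar>bessel_gauss k \<alpha> s z x\<bar> \<le> C"
proof -
  obtain B where B: "integrable lborel B" "\<And>x t. (1 + x\<^sup>2) ^ j * \<bar>gamma_density \<alpha> t *
     gauss_deriv k (t + s) (x - z)\<bar> \<le> B t"
    by (rule bessel_gauss_integrand[OF assms, where j = j and k = k and z = z]) (rule that)
  have G: "Gamma (\<alpha> / 2) > 0" using a by (intro Gamma_real_pos) auto
  show ?thesis
  proof
    fix x :: real
    have p0: "(1 + x\<^sup>2) ^ j \<ge> 0" by simp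
    have "(1 + x\<^sup>2) ^ j * \<bar>LINT t|lborel. gamma_density \<alpha> t * gauss_deriv k (t + s) (x - z)\<bar>
      \<le> (1 + x\<^sup>2) ^ j * (LINT t|lborel. \<bar>gamma_density \<alpha> t * gauss_deriv k (t + s) (x - z)\<bar>)"
      by (intro mult_left_mono integral_abs_bound p0)
    also have "\<dots> = (LINT t|lborel. (1 + x\<^sup>2) ^ j * \<bar>gamma_density \<alpha> t * gauss_deriv k (t + s) (x - z)\<bar>)"
      by (simp only: integral_mult_right_zero)
    also have "\<dots> \<le> (LINT t|lborel. B t)"
      by (intro integral_mono B integrable_mult_right integrable_abs bessel_gauss_integrable a s)
    finally show "(1 + x\<^sup>2) ^ j * \<bar>bessel_gauss k \<alpha> s z x\<bar> \<le> (LINT t|lborel. B t) / Gamma (\<alpha> / 2)"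
      using G unfolding bessel_gauss_def by (simp add: divide_right_mono)
  qed
qed

lemma vderiv_of_real:
  assumes "\<And>x. (f has_real_derivative f' x) (at x)"
  shows "vderiv (\<lambda>x. of_real (f x)) = (\<lambda>x. of_real (f' x))"
  unfolding vderiv_def
  using assms by (intro ext vector_derivative_at has_vector_derivative_of_real)
     (simp add: has_real_derivative_iff_has_vector_derivative)

text \<open>Admits these functions as tests in the definition of
  \<open>is_bessel_density\<close>.\<close>

lemma bessel_gauss_schwartz:
  assumes a: "\<alpha> > 0" and s: "s > 0"
  shows "(\<lambda>x. complex_of_real (bessel_gauss 0 \<alpha> s z x)) \<in> schwartz"
proof -
  let ?\<phi> = "\<lambda>x. complex_of_real (bessel_gauss 0 \<alpha> s z x)"
  have it: "(vderiv ^^ k) ?\<phi> = (\<lambda>x. of_real (bessel_gauss k \<alpha> s z x))" for k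
  proof (induction k)
    case (Suc k)
    then show ?case
      using vderiv_of_real[OF bessel_gauss_has_derivative[OF a s, of k z]] by simp
  qed simp
  have "(vderiv ^^ k) ?\<phi> differentiable (at x)" for k x
  proof -
    have "((\<lambda>x. complex_of_real (bessel_gauss k \<alpha> s z x)) has_vector_derivative of_real (bessel_gauss (Suc k) \<alpha> s z x)) (at x)"
      using bessel_gauss_has_derivative[OF a s, of k z x]
      by (intro has_vector_derivative_of_real) (simp add: has_real_derivative_iff_has_vector_derivative)
    then show ?thesis unfolding it by (rule differentiableI_vector)
  qed
  moreover have "bounded (range (\<lambda>x. x ^ j *\<^sub>R (vderiv ^^ k) ?\<phi> x))" for j k
  proof -
    obtain C where C: "\<And>x. (1 + x\<^sup>2) ^ j * \<bar>bessel_gauss k \<alpha> s z x\<bar> \<le> C"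
      using bessel_gauss_bound[OF a s] by blast
    have "norm (x ^ j *\<^sub>R (vderiv ^^ k) ?\<phi> x) \<le> C" for x
    proof -
      have "\<bar>x\<bar> \<le> 1 + x\<^sup>2"
      proof -
        have "(\<bar>x\<bar> - 1)\<^sup>2 = x\<^sup>2 - 2 * \<bar>x\<bar> + 1" by (simp add: power2_diff)
        then show ?thesis using zero_le_power2[of "\<bar>x\<bar> - 1"] zero_le_power2[of x] by linarith
      qed
      then have "\<bar>x\<bar> ^ j \<le> (1 + x\<^sup>2) ^ j" by (intro power_mono) auto
      then have "\<bar>x\<bar> ^ j * \<bar>bessel_gauss k \<alpha> s z x\<bar> \<le> (1 + x\<^sup>2) ^ j * \<bar>bessel_gauss k \<alpha> s z x\<bar>"
        by (intro mult_right_mono) auto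
      also have "\<dots> \<le> C" by (rule C)
      finally show ?thesis by (simp add: it power_abs)
    qed
    then show ?thesis by (auto simp: bounded_iff)
  qed
  ultimately show ?thesis by (simp add: schwartz_def)
qed

lemma gauss_shift: "gauss \<tau> (x - z) = normal_density z (sqrt (2 * \<tau>)) x"
  by (simp add: gauss_def normal_density_def)

lemma gauss_integrable: "\<tau> > 0 \<Longrightarrow> integrable lborel (\<lambda>x. gauss \<tau> (x - z))"
  using integrable_normal_density[of "sqrt (2 * \<tau>)" z] unfolding gauss_shift[of _ _ z] by simp

lemma gauss_integral: "\<tau> > 0 \<Longrightarrow> (LINT x|lborel. gauss \<tau> (x - z)) = 1"
  using integral_normal_density[of "sqrt (2 * \<tau>)" z] unfolding gauss_shift[of _ _ z] by simp

lemma gauss_fourier: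
  assumes t: "\<tau> > 0"
  shows "(LINT x|lborel. exp (\<i> * of_real (\<xi> * x)) * of_real (gauss \<tau> (x - z)))
    = exp (\<i> * of_real (\<xi> * z)) * of_real (exp (- (\<tau> * \<xi>\<^sup>2)))"
proof -
  define \<sigma> where "\<sigma> = sqrt (2 * \<tau>)"
  have s: "\<sigma> > 0" using t by (simp add: \<sigma>_def)
  have s2: "\<sigma>\<^sup>2 = 2 * \<tau>" using t by (simp add: \<sigma>_def)
  have ch: "(LINT x|lborel. of_real (std_normal_density x) * exp (\<i> * of_real (u * x))) = of_real (exp (- u\<^sup>2 / 2))" for u
  proof -
    have "char std_normal_distribution u = of_real (exp (- u\<^sup>2 / 2))"
      by (simp add: char_std_normal_distribution)
    then show ?thesis
      unfolding char_def by (subst (asm) integral_density) (auto simp: scaleR_conv_of_real)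
  qed
  have "(LINT x|lborel. exp (\<i> * of_real (\<xi> * x)) * of_real (gauss \<tau> (x - z)))
    = \<bar>\<sigma>\<bar> *\<^sub>R (LINT x|lborel. exp (\<i> * of_real (\<xi> * (z + \<sigma> * x))) * of_real (gauss \<tau> (z + \<sigma> * x - z)))"
    using s by (intro lborel_integral_real_affine) auto
  also have "\<dots> = (LINT x|lborel. \<bar>\<sigma>\<bar> *\<^sub>R (exp (\<i> * of_real (\<xi> * (z + \<sigma> * x))) * of_real (gauss \<tau> (z + \<sigma> * x - z))))"
    by simp
  also have "\<dots> = (LINT x|lborel. exp (\<i> * of_real (\<xi> * z)) * (of_real (std_normal_density x) * exp (\<i> * of_real ((\<xi> * \<sigma>) * x))))"
  proof (rule Bochner_Integration.integral_cong[OF refl])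
    fix x
    have "\<sigma> * gauss \<tau> (\<sigma> * x) = std_normal_density x"
    proof -
      have "(\<sigma> * x)\<^sup>2 / (4 * \<tau>) = x\<^sup>2 / 2" using t by (simp add: power_mult_distrib s2)
      moreover have "sqrt (4 * pi * \<tau>) = sqrt (2 * pi) * \<sigma>"
        unfolding \<sigma>_def real_sqrt_mult[symmetric] by (simp add: mult_ac)
      ultimately show ?thesis
        using s unfolding gauss_eq[OF t] by (simp add: std_normal_density_def)
    qed
    then have n: "complex_of_real \<sigma> * of_real (gauss \<tau> (\<sigma> * x)) = of_real (std_normal_density x)"
      by (metis of_real_mult)
    have "exp (\<i> * of_real (\<xi> * (z + \<sigma> * x))) = exp (\<i> * of_real (\<xi> * z)) * exp (\<i> * of_real ((\<xi> * \<sigma>) * x))"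
      by (simp add: exp_add[symmetric] algebra_simps)
    then show "\<bar>\<sigma>\<bar> *\<^sub>R (exp (\<i> * of_real (\<xi> * (z + \<sigma> * x))) * of_real (gauss \<tau> (z + \<sigma> * x - z)))
      = exp (\<i> * of_real (\<xi> * z)) * (of_real (std_normal_density x) * exp (\<i> * of_real ((\<xi> * \<sigma>) * x)))"
      unfolding n[symmetric] using s by (simp add: scaleR_conv_of_real mult_ac)
  qed
  also have "\<dots> = exp (\<i> * of_real (\<xi> * z)) * of_real (exp (- (\<xi> * \<sigma>)\<^sup>2 / 2))"
    unfolding integral_mult_right_zero ch ..
  also have "- (\<xi> * \<sigma>)\<^sup>2 / 2 = - (\<tau> * \<xi>\<^sup>2)"
    by (simp add: power_mult_distrib s2)
  finally show ?thesis .
qed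

section \<open>Identification by Gaussian tests\<close>

abbreviation lborel2 :: "(real \<times> real) measure" where
  "lborel2 \<equiv> lborel \<Otimes>\<^sub>M lborel"

lemma bessel_gauss_measurable [measurable]:
  assumes "\<alpha> > 0" "s > 0" shows "bessel_gauss k \<alpha> s z \<in> borel_measurable borel"
proof (rule borel_measurable_continuous_onI)
  show "continuous_on UNIV (bessel_gauss k \<alpha> s z)"
    by (rule DERIV_continuous_on, rule has_field_derivative_at_within, rule bessel_gauss_has_derivative[OF assms])
qed

lemma gauss_measurable [measurable (raw)]:
  assumes [measurable]: "f \<in> borel_measurable M" "g \<in> borel_measurable M"
  shows "(\<lambda>x. gauss (f x) (g x)) \<in> borel_measurable M"
  unfolding gauss_def normal_density_def by measurable

text \<open>After Fubini each time \<open>t\<close> contributes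
  \<open>exp (- (t + s) * \<xi>^2)\<close>, and the remaining integral over \<open>t\<close> is the
  subordination formula. The resulting power of \<open>1 + \<xi>^2\<close> is the reciprocal of the
  multiplier in \<open>bessel\<close>.\<close>

lemma inverse_fourier_bessel_gauss:
  assumes a: "\<alpha> > 0" and s: "s > 0"
  shows "inverse_fourier (\<lambda>x. of_real (bessel_gauss 0 \<alpha> s z x)) \<xi> =
    of_real (1 / (2 * pi)) * (exp (\<i> * of_real (\<xi> * z)) * of_real (exp (- (s * \<xi>\<^sup>2)))) *
    of_real ((1 + \<xi>\<^sup>2) powr (- (\<alpha> / 2)))"
proof -
  define v where "v t = gamma_density \<alpha> t" for t :: real
  have v0: "v t \<ge> 0" for t by (simp add: v_def)
  have [measurable]: "v \<in> borel_measurable borel" unfolding v_def[abs_def] by measurable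
  have iv: "integrable lborel v"
    using gamma_weight_integral(1)[of "\<alpha> / 2" 1] a by (simp add: v_def[abs_def])
  have G: "Gamma (\<alpha> / 2) > 0" using a by (intro Gamma_real_pos) auto
  define E where "E x = exp (\<i> * complex_of_real (\<xi> * x))" for x
  have [measurable]: "E \<in> borel_measurable borel" unfolding E_def[abs_def] by measurable
  have nE: "norm (E x) = 1" for x by (simp add: E_def)
  define h where "h t x = E x * of_real (v t * gauss (t + s) (x - z))" for t x
  have nh: "norm (h t x) = v t * gauss (t + s) (x - z)" for t x
    using v0[of t] by (simp add: h_def norm_mult nE)
  have bg: "of_real (bessel_gauss 0 \<alpha> s z x) = (LINT t|lborel. complex_of_real (v t * gauss (t + s) (x - z))) / of_real (Gamma (\<alpha> / 2))" for x
  proof -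
    have "v t * gauss_deriv 0 (t + s) (x - z) = v t * gauss (t + s) (x - z)" for t
      using s by (cases "t > 0") (auto simp: v_def gauss_deriv_0)
    then have "bessel_gauss 0 \<alpha> s z x = (LINT t|lborel. v t * gauss (t + s) (x - z)) / Gamma (\<alpha> / 2)"
      by (simp only: bessel_gauss_def v_def[symmetric])
    then show ?thesis by (simp only: of_real_divide integral_complex_of_real)
  qed
  have ih: "integrable lborel2 (case_prod h)"
  proof (rule lborel_pair.Fubini_integrable)
    show "case_prod h \<in> borel_measurable lborel2"
      unfolding h_def by measurable
    have "(LINT x|lborel. norm (case_prod h (t, x))) = v t" for t
      using s gauss_integral[of "t + s" z] by (cases "t > 0") (auto simp: nh v_def)
    then show "integrable lborel (\<lambda>t. LINT x|lborel. norm (case_prod h (t, x)))"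
      using iv by simp
    have "integrable lborel (h t)" for t
    proof (cases "t > 0")
      case True
      have "integrable lborel (\<lambda>x. v t * gauss (t + s) (x - z))"
        using True s by (intro integrable_mult_right gauss_integrable) auto
      then show ?thesis
      proof (rule Bochner_Integration.integrable_bound)
        show "h t \<in> borel_measurable lborel" unfolding h_def[abs_def] by measurable
        show "AE x in lborel. norm (h t x) \<le> norm (v t * gauss (t + s) (x - z))"
          using v0 by (intro AE_I2) (simp add: nh)
      qed
    next
      case False
      then have "h t = (\<lambda>x. 0)" by (auto simp: h_def v_def)
      then show ?thesis by simp
    qed
    then show "AE t in lborel. integrable lborel (\<lambda>x. case_prod h (t, x))"
      by simp
  qed
  have bm: "(\<lambda>x. exp (\<i> * of_real (\<xi> * x)) * of_real (bessel_gauss 0 \<alpha> s z x)) \<in> borel_measurable lborel"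
    using bessel_gauss_measurable[OF a s, of 0 z] by measurable
  have "(LINT x|lebesgue. exp (\<i> * of_real (\<xi> * x)) * of_real (bessel_gauss 0 \<alpha> s z x))
    = (LINT x|lborel. E x * of_real (bessel_gauss 0 \<alpha> s z x))"
    unfolding E_def using bm by (rule integral_completion)
  also have "\<dots> = (LINT x|lborel. (LINT t|lborel. h t x) / of_real (Gamma (\<alpha> / 2)))"
    unfolding bg h_def by simp
  also have "\<dots> = (LINT x|lborel. (LINT t|lborel. h t x)) / of_real (Gamma (\<alpha> / 2))"
    by simp
  also have "(LINT x|lborel. (LINT t|lborel. h t x)) = (LINT t|lborel. (LINT x|lborel. h t x))"
    by (rule lborel_pair.Fubini_integral[OF ih])
  also have "\<dots> = (LINT t|lborel. E z * of_real (exp (- (s * \<xi>\<^sup>2))) *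
      of_real (indicator {0<..} t * (t powr (\<alpha> / 2 - 1) * exp (- ((1 + \<xi>\<^sup>2) * t)))))"
  proof (rule Bochner_Integration.integral_cong[OF refl])
    fix t :: real
    show "(LINT x|lborel. h t x) = E z * of_real (exp (- (s * \<xi>\<^sup>2))) *
      of_real (indicator {0<..} t * (t powr (\<alpha> / 2 - 1) * exp (- ((1 + \<xi>\<^sup>2) * t))))"
    proof (cases "t > 0")
      case True
      have "(LINT x|lborel. h t x) = (LINT x|lborel. of_real (v t) * (E x * of_real (gauss (t + s) (x - z))))"
        by (simp add: h_def mult_ac)
      also have "\<dots> = of_real (v t) * (E z * of_real (exp (- ((t + s) * \<xi>\<^sup>2))))"
        unfolding integral_mult_right_zero unfolding E_def using True s by (subst gauss_fourier) auto
      also have "\<dots> = E z * of_real (v t * exp (- ((t + s) * \<xi>\<^sup>2)))" by simp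
      also have "v t * exp (- ((t + s) * \<xi>\<^sup>2)) = exp (- (s * \<xi>\<^sup>2)) *
        (indicator {0<..} t * (t powr (\<alpha> / 2 - 1) * exp (- ((1 + \<xi>\<^sup>2) * t))))"
        using True by (simp add: v_def mult_exp_exp algebra_simps)
      finally show ?thesis by simp
    next
      case False
      then show ?thesis by (simp add: h_def v_def)
    qed
  qed
  also have "\<dots> = E z * of_real (exp (- (s * \<xi>\<^sup>2))) *
      of_real (LINT t|lborel. indicator {0<..} t * (t powr (\<alpha> / 2 - 1) * exp (- ((1 + \<xi>\<^sup>2) * t))))"
    unfolding integral_mult_right_zero integral_complex_of_real ..
  also have "(LINT t|lborel. indicator {0<..} t * (t powr (\<alpha> / 2 - 1) * exp (- ((1 + \<xi>\<^sup>2) * t))))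
     = Gamma (\<alpha> / 2) * (1 + \<xi>\<^sup>2) powr (- (\<alpha> / 2))"
    using a by (intro gamma_weight_integral) (auto intro: add_pos_nonneg)
  finally show ?thesis
    using G by (simp add: inverse_fourier_def E_def mult_ac)
qed

lemma fourier_gauss:
  assumes s: "s > 0"
  shows "fourier (\<lambda>\<xi>. of_real (1 / (2 * pi)) * (exp (\<i> * of_real (\<xi> * z)) * of_real (exp (- (s * \<xi>\<^sup>2))))) x
    = of_real (gauss s (x - z))"
proof -
  \<comment> \<open>In frequency the Gaussian \<open>exp (- s * \<xi>^2)\<close> is a multiple of
    \<open>gauss\<close> at time \<open>1 / (4 * s)\<close>, so \<open>gauss_fourier\<close> applies
    once more, with frequency \<open>z - x\<close>.\<close>
  define \<tau> where "\<tau> = 1 / (4 * s)"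
  have t: "\<tau> > 0" using s by (simp add: \<tau>_def)
  have e: "exp (- (s * \<xi>\<^sup>2)) = sqrt (pi / s) * gauss \<tau> (\<xi> - 0)" for \<xi>
    using s unfolding gauss_eq[OF t] by (simp add: \<tau>_def mult.commute)
  define F where "F \<xi> = exp (- \<i> * of_real (x * \<xi>)) * (of_real (1 / (2 * pi)) * (exp (\<i> * of_real (\<xi> * z)) * of_real (exp (- (s * \<xi>\<^sup>2)))))" for \<xi>
  have eq: "F \<xi> = of_real (sqrt (pi / s) / (2 * pi)) * (exp (\<i> * of_real ((z - x) * \<xi>)) * of_real (gauss \<tau> (\<xi> - 0)))" for \<xi>
  proof -
    have 1: "exp (- \<i> * of_real (x * \<xi>)) * exp (\<i> * of_real (\<xi> * z)) = exp (\<i> * of_real ((z - x) * \<xi>))"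
      by (simp add: exp_add[symmetric] algebra_simps)
    have "F \<xi> = of_real (1 / (2 * pi)) * ((exp (- \<i> * of_real (x * \<xi>)) * exp (\<i> * of_real (\<xi> * z))) * of_real (exp (- (s * \<xi>\<^sup>2))))"
      unfolding F_def by (simp only: mult_ac)
    then have "F \<xi> = of_real (1 / (2 * pi)) * (exp (\<i> * of_real ((z - x) * \<xi>)) * of_real (exp (- (s * \<xi>\<^sup>2))))"
      unfolding 1 .
    then show ?thesis unfolding e by simp
  qed
  have "fourier (\<lambda>\<xi>. of_real (1 / (2 * pi)) * (exp (\<i> * of_real (\<xi> * z)) * of_real (exp (- (s * \<xi>\<^sup>2))))) x
    = (LINT \<xi>|lborel. F \<xi>)"
    unfolding fourier_def F_def by (rule integral_completion) measurable
  also have "\<dots> = of_real (sqrt (pi / s) / (2 * pi)) * (exp (\<i> * of_real ((z - x) * 0)) * of_real (exp (- (\<tau> * (z - x)\<^sup>2))))"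
    unfolding eq integral_mult_right_zero gauss_fourier[OF t] ..
  also have "\<dots> = of_real (sqrt (pi / s) / (2 * pi) * exp (- (\<tau> * (z - x)\<^sup>2)))" by simp
  also have "sqrt (pi / s) / (2 * pi) = 1 / sqrt (4 * pi * s)"
  proof -
    have "sqrt (pi / s) * sqrt (4 * pi * s) = sqrt ((2 * pi)\<^sup>2)"
      unfolding real_sqrt_mult[symmetric] using s by (simp add: power2_eq_square)
    also have "\<dots> = 2 * pi" by (rule real_sqrt_unique) auto
    finally have "sqrt (pi / s) * sqrt (4 * pi * s) = 2 * pi" .
    moreover have "sqrt (4 * pi * s) > 0" using s by simp
    ultimately show ?thesis by (simp add: divide_eq_eq eq_divide_eq)
  qed
  also have "1 / sqrt (4 * pi * s) * exp (- (\<tau> * (z - x)\<^sup>2)) = gauss s (x - z)"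
    unfolding gauss_eq[OF s] \<tau>_def by (simp add: power2_commute)
  finally show ?thesis .
qed

text \<open>Transposed to the test function, the operator \<open>bessel\<close> undoes the Bessel
  potential and leaves the Gaussian. The distributional identity becomes an equality of two ordinary
  integrals.\<close>

lemma bessel_density_gauss:
  assumes a: "\<alpha> > 0" and s: "s > 0" and g: "is_bessel_density q k \<alpha> p f g"
  shows "(LINT x|lebesgue. g x * of_real (bessel_gauss 0 \<alpha> s z x)) = (LINT x|lebesgue. f x * of_real (gauss s (x - z)))"
proof -
  let ?\<phi> = "\<lambda>x. complex_of_real (bessel_gauss 0 \<alpha> s z x)"
  have "(LINT x|lebesgue. g x * ?\<phi> x) = regular_distr g ?\<phi>" by (simp add: regular_distr_def)
  also have "\<dots> = bessel \<alpha> (regular_distr f) ?\<phi>"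
    using g bessel_gauss_schwartz[OF a s] by (simp add: is_bessel_density_def)
  also have "\<dots> = regular_distr f (fourier (\<lambda>\<xi>. of_real ((1 + \<bar>\<xi>\<bar>\<^sup>2) powr (\<alpha> / 2)) * inverse_fourier ?\<phi> \<xi>))"
    by (simp add: bessel_def inverse_fourier_distr_def mult_distr_def fourier_distr_def)
  also have "(\<lambda>\<xi>. of_real ((1 + \<bar>\<xi>\<bar>\<^sup>2) powr (\<alpha> / 2)) * inverse_fourier ?\<phi> \<xi>)
    = (\<lambda>\<xi>. of_real (1 / (2 * pi)) * (exp (\<i> * of_real (\<xi> * z)) * of_real (exp (- (s * \<xi>\<^sup>2)))))"
  proof
    fix \<xi> :: real
    have "(1 + \<bar>\<xi>\<bar>\<^sup>2) powr (\<alpha> / 2) * (1 + \<xi>\<^sup>2) powr (- (\<alpha> / 2)) = 1"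
      by (simp add: powr_add[symmetric]) (metis add_pos_nonneg less_numeral_extra(1) less_numeral_extra(3) zero_le_power2)
    then have 1: "complex_of_real ((1 + \<bar>\<xi>\<bar>\<^sup>2) powr (\<alpha> / 2)) * of_real ((1 + \<xi>\<^sup>2) powr (- (\<alpha> / 2))) = 1"
      by (metis of_real_1 of_real_mult)
    have "of_real ((1 + \<bar>\<xi>\<bar>\<^sup>2) powr (\<alpha> / 2)) * inverse_fourier ?\<phi> \<xi>
      = of_real (1 / (2 * pi)) * (exp (\<i> * of_real (\<xi> * z)) * of_real (exp (- (s * \<xi>\<^sup>2)))) *
        (complex_of_real ((1 + \<bar>\<xi>\<bar>\<^sup>2) powr (\<alpha> / 2)) * of_real ((1 + \<xi>\<^sup>2) powr (- (\<alpha> / 2))))"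
      unfolding inverse_fourier_bessel_gauss[OF a s] by (simp only: mult_ac)
    then show "of_real ((1 + \<bar>\<xi>\<bar>\<^sup>2) powr (\<alpha> / 2)) * inverse_fourier ?\<phi> \<xi>
      = of_real (1 / (2 * pi)) * (exp (\<i> * of_real (\<xi> * z)) * of_real (exp (- (s * \<xi>\<^sup>2))))"
      unfolding 1 mult_1_right .
  qed
  also have "fourier \<dots> = (\<lambda>x. of_real (gauss s (x - z)))"
    using fourier_gauss[OF s] by blast
  finally show ?thesis by (simp add: regular_distr_def)
qed

text \<open>Half-lines form an intersection-stable generator of the Borel sets, so the integral over
  every Borel set vanishes. The total integral enters through complements.\<close>

lemma integral_atMost_zero_imp_zero:
  fixes w :: "real \<Rightarrow> complex"
  assumes w: "integrable lborel w" and total: "(LINT x|lborel. w x) = 0"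
    and half: "\<And>a. (LINT x:{..a}|lborel. w x) = 0"
  shows "AE x in lborel. w x = 0"
proof (rule sigma_finite_measure.density_zero[OF sigma_finite_lborel w])
  fix A :: "real set" assume "A \<in> sets lborel"
  then have A: "A \<in> sigma_sets UNIV (range (\<lambda>a::real. {..a}))"
    by (simp add: borel_eq_atMost)
  have bs: "B \<in> sets borel" if "B \<in> sigma_sets UNIV (range (\<lambda>a::real. {..a}))" for B
    using that by (simp add: borel_eq_atMost)
  have si: "set_integrable lborel B w" if "B \<in> sets borel" for B
    using w that unfolding set_integrable_def by (intro integrable_mult_indicator) auto
  have "Int_stable (range (\<lambda>a::real. {..a}))"
    by (auto simp: Int_stable_def)
  moreover have "range (\<lambda>a::real. {..a}) \<subseteq> Pow UNIV" by simp
  ultimately show "(LINT x:A|lborel. w x) = 0"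
    using A
  proof (induction rule: sigma_sets_induct_disjoint)
    case (basic B)
    then show ?case using half by auto
  next
    case empty
    show ?case by (simp add: set_lebesgue_integral_def)
  next
    case (compl B)
    have "(LINT x|lborel. w x) = (LINT x:B|lborel. w x) + (LINT x:UNIV - B|lborel. w x)"
      using set_integral_Un[of B "UNIV - B" lborel w] si[OF bs[OF compl(1)]] si[of "UNIV - B"] bs[OF compl(1)]
      by (simp add: set_lebesgue_integral_def)
    then show ?case using total compl by simp
  next
    case (union B)
    have "B i \<in> sets borel" for i using union(2) bs by auto
    then have "(LINT x:(\<Union>i. B i)|lborel. w x) = (\<Sum>i. (LINT x:(B i)|lborel. w x))"
      using union(1) by (intro lebesgue_integral_countable_add si) (auto simp: disjoint_family_on_def)
    then show ?case using union by simp
  qed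
qed

text \<open>As \<open>s\<close> tends to 0 the Gaussians approximate the identity. Since
  \<open>u\<close> need not be integrable, the test functions are half-line indicators multiplied by
  \<open>jbr x powr (- K)\<close>: their Gaussian smoothings are orthogonal to \<open>u\<close> by
  Fubini, bounded by a multiple of the same power by \<open>heat_moment\<close>, and convergent off
  one point.\<close>

lemma gauss_convolution_zero_imp_zero:
  fixes u :: "real \<Rightarrow> complex"
  assumes um [measurable]: "u \<in> borel_measurable borel"
    and iu: "integrable lborel (\<lambda>x. norm (u x) * jbr x powr (- K))" and K: "K \<ge> 0"
    and z: "\<And>s z. s > 0 \<Longrightarrow> (LINT x|lborel. u x * of_real (gauss s (x - z))) = 0"
  shows "AE x in lborel. u x = 0"
proof -
  define J where "J x = jbr x powr (- K)" for x
  have J0: "J x > 0" for x by (simp add: J_def)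
  have J1: "J x \<le> 1" for x
    using powr_mono2'[of "- K" 1 "jbr x"] jbr_ge_1[of x] K by (simp add: J_def)
  have "continuous_on UNIV J"
    unfolding J_def[abs_def] by (intro continuous_intros) auto
  then have Jc: "isCont J x" for x
    by (simp add: continuous_on_eq_continuous_at)
  have [measurable]: "J \<in> borel_measurable borel" unfolding J_def[abs_def] by measurable
  obtain C where C: "C > 0" "\<And>t x. t > 0 \<Longrightarrow> integrable lborel (\<lambda>y. heat t (x - y) * J y)"
    "\<And>t x. t > 0 \<Longrightarrow> (LINT y|lborel. heat t (x - y) * J y) \<le> C * exp (- t / 2) * J x"
    using heat_moment[of "- K"] unfolding J_def[symmetric] by blast
  \<comment> \<open>Chosen so that the standard deviation \<open>sqrt (2 * S n)\<close> is
    \<open>1 / (n + 1)\<close>. Times at most 1 allow the missing damping to be restored at the cost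
    of the factor \<open>exp 1\<close>.\<close>
  define S where "S n = 1 / (2 * (real n + 1)\<^sup>2)" for n
  have S0: "S n > 0" for n by (simp add: S_def)
  have S1: "S n \<le> 1" for n
  proof -
    have "1 \<le> (real n + 1)\<^sup>2" by (rule one_le_power) simp
    then have "1 \<le> 2 * (real n + 1)\<^sup>2" by linarith
    then show ?thesis by (simp add: S_def)
  qed
  have ndh: "gauss (S n) x \<le> exp 1 * heat (S n) x" for n x
  proof -
    let ?s = "S n"
    have "gauss ?s x = exp (- (x\<^sup>2 / (4 * ?s))) * ?s powr (- 1 / 2) * (1 / sqrt (4 * pi))"
      using S0[of n] unfolding gauss_eq[OF S0]
      by (simp add: real_sqrt_mult powr_minus_divide powr_half_sqrt minus_divide_left[symmetric])
    also have "\<dots> \<le> exp (- (x\<^sup>2 / (4 * ?s))) * ?s powr (- 1 / 2) * (exp 1 * exp (- ?s))"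
    proof (rule mult_left_mono)
      have "1 / sqrt (4 * pi) \<le> 1" using pi_gt3 by (simp add: real_le_rsqrt)
      also have "1 \<le> exp 1 * exp (- ?s)" using S1[of n] by (simp add: mult_exp_exp)
      finally show "1 / sqrt (4 * pi) \<le> exp 1 * exp (- ?s)" .
    qed simp
    finally show ?thesis by (simp add: heat_def mult_ac)
  qed
  \<comment> \<open>The second condition says that the indicator of \<open>A\<close> is continuous
    off the single point \<open>a\<close>. It covers the half-lines as well as \<open>UNIV\<close>,
    where any \<open>a\<close> will do.\<close>
  have key: "(LINT x|lborel. u x * of_real (indicator A x * J x)) = 0"
    if Am [measurable]: "A \<in> sets borel"
      and Ac: "\<And>x X. x \<noteq> a \<Longrightarrow> X \<longlonglongrightarrow> x \<Longrightarrow> (\<lambda>i::nat. indicator A (X i) :: real) \<longlonglongrightarrow> indicator A x" for A a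
  proof -
    define \<psi> where "\<psi> x = indicator A x * J x" for x
    have p: "0 \<le> \<psi> x" "\<psi> x \<le> J x" "\<psi> x \<le> 1" for x
      using J0[of x] J1[of x] by (auto simp: \<psi>_def indicator_def)
    have [measurable]: "\<psi> \<in> borel_measurable borel" unfolding \<psi>_def[abs_def] by measurable
    define \<theta> where "\<theta> n x = (LINT z|lborel. \<psi> z * gauss (S n) (x - z))" for n x
    have tb: "\<psi> z * gauss (S n) (x - z) \<le> exp 1 * (heat (S n) (x - z) * J z)" for n x z
      using mult_mono[OF p(2)[of z] ndh[of n "x - z"]] J0[of z] p(1)[of z] by (simp add: mult_ac less_imp_le)
    have ti: "integrable lborel (\<lambda>z. \<psi> z * gauss (S n) (x - z))" for n x
    proof (rule Bochner_Integration.integrable_bound)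
      show "integrable lborel (\<lambda>z. exp 1 * (heat (S n) (x - z) * J z))"
        by (intro integrable_mult_right C S0)
      show "AE z in lborel. norm (\<psi> z * gauss (S n) (x - z)) \<le> norm (exp 1 * (heat (S n) (x - z) * J z))"
        using tb[of _ n x] p J0 by (intro AE_I2) (simp add: heat_nonneg less_imp_le)
    qed measurable
    have t0: "0 \<le> \<theta> n x" for n x
      unfolding \<theta>_def using p by (intro integral_nonneg_AE) auto
    have tJ: "\<theta> n x \<le> exp 1 * C * J x" for n x
    proof -
      have "\<theta> n x \<le> (LINT z|lborel. exp 1 * (heat (S n) (x - z) * J z))"
        unfolding \<theta>_def by (intro integral_mono ti tb integrable_mult_right C S0)
      also have "\<dots> = exp 1 * (LINT z|lborel. heat (S n) (x - z) * J z)" by simp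
      also have "\<dots> \<le> exp 1 * (C * exp (- S n / 2) * J x)"
        by (intro mult_left_mono C S0) auto
      also have "\<dots> \<le> exp 1 * (C * 1 * J x)"
        using C(1) S0[of n] J0[of x] by (intro mult_left_mono mult_right_mono) auto
      finally show ?thesis by simp
    qed
    have tm [measurable]: "\<theta> n \<in> borel_measurable borel" for n
      unfolding \<theta>_def[abs_def] by measurable
    have zero: "(LINT x|lborel. u x * of_real (\<theta> n x)) = 0" for n
    proof -
      define h where "h x z = u x * of_real (\<psi> z * gauss (S n) (x - z))" for x z
      have nh: "norm (h x z) = norm (u x) * (\<psi> z * gauss (S n) (x - z))" for x z
        using p by (simp add: h_def norm_mult)
      have ih: "integrable lborel2 (case_prod h)"
      proof (rule lborel_pair.Fubini_integrable)
        show "case_prod h \<in> borel_measurable lborel2"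
          unfolding h_def by measurable
        have "integrable lborel (\<lambda>x. norm (u x) * \<theta> n x)"
        proof (rule Bochner_Integration.integrable_bound)
          show "integrable lborel (\<lambda>x. exp 1 * C * (norm (u x) * J x))"
            using iu unfolding J_def by (intro integrable_mult_right)
          show "AE x in lborel. norm (norm (u x) * \<theta> n x) \<le> norm (exp 1 * C * (norm (u x) * J x))"
          proof (intro AE_I2)
            fix x
            show "norm (norm (u x) * \<theta> n x) \<le> norm (exp 1 * C * (norm (u x) * J x))"
              using mult_left_mono[OF tJ[of n x] norm_ge_zero[of "u x"]] t0[of n x] C(1) J0[of x]
              by (simp add: abs_mult mult_ac)
          qed
        qed measurable
        moreover have "(LINT z|lborel. norm (case_prod h (x, z))) = norm (u x) * \<theta> n x" for x
          by (simp add: nh \<theta>_def)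
        ultimately show "integrable lborel (\<lambda>x. LINT z|lborel. norm (case_prod h (x, z)))"
          by simp
        have "integrable lborel (h x)" for x
          unfolding h_def by (intro integrable_mult_right integrable_of_real ti)
        then show "AE x in lborel. integrable lborel (\<lambda>z. case_prod h (x, z))" by simp
      qed
      have "(LINT x|lborel. u x * of_real (\<theta> n x)) = (LINT x|lborel. (LINT z|lborel. h x z))"
        by (simp add: h_def \<theta>_def del: of_real_mult)
      also have "\<dots> = (LINT z|lborel. (LINT x|lborel. h x z))"
        by (rule lborel_pair.Fubini_integral[OF ih, symmetric])
      moreover have "(LINT x|lborel. h x z) = 0" for z
      proof -
        have "h x z = of_real (\<psi> z) * (u x * of_real (gauss (S n) (x - z)))" for x
          by (simp add: h_def)
        then show ?thesis using z[OF S0[of n], of z] by simp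
      qed
      ultimately show ?thesis by simp
    qed
    have tlim: "(\<lambda>n. \<theta> n x) \<longlonglongrightarrow> \<psi> x" if x: "x \<noteq> a" for x
    proof -
      \<comment> \<open>Rescaling moves the dependence on \<open>n\<close> from the Gaussian into
        the argument of \<psi>, so that convergence can be dominated by a fixed normal
        density.\<close>
      define X where "X n w = x + (1 / (real n + 1)) * w" for n :: nat and w
      have th: "\<theta> n x = (LINT w|lborel. \<psi> (X n w) * std_normal_density w)" for n
      proof -
        let ?c = "1 / (real n + 1)"
        have c0: "?c > 0" by simp
        have sq: "sqrt (2 * S n) = ?c"
          by (simp add: S_def real_sqrt_divide)
        have nd1: "?c * gauss (S n) (x - (x + ?c * w)) = std_normal_density w" for w
        proof -
          have "(?c * w)\<^sup>2 / (2 * ?c\<^sup>2) = w\<^sup>2 / 2"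
            using c0 unfolding power_mult_distrib by simp
          moreover have "?c * (1 / sqrt (2 * pi * ?c\<^sup>2)) = 1 / sqrt (2 * pi)"
            using c0 by (simp add: real_sqrt_mult)
          ultimately show ?thesis
            unfolding gauss_def sq normal_density_def by (simp add: std_normal_density_def)
        qed
        have "\<theta> n x = \<bar>?c\<bar> *\<^sub>R (LINT w|lborel. \<psi> (x + ?c * w) * gauss (S n) (x - (x + ?c * w)))"
          unfolding \<theta>_def by (rule lborel_integral_real_affine) simp
        also have "\<dots> = (LINT w|lborel. ?c * (\<psi> (x + ?c * w) * gauss (S n) (x - (x + ?c * w))))"
          by simp
        also have "\<dots> = (LINT w|lborel. \<psi> (X n w) * (?c * gauss (S n) (x - (x + ?c * w))))"
          unfolding X_def by (simp only: mult.left_commute)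
        finally show ?thesis unfolding nd1 .
      qed
      have "(\<lambda>n. LINT w|lborel. \<psi> (X n w) * std_normal_density w) \<longlonglongrightarrow> (LINT w|lborel. \<psi> x * std_normal_density w)"
      proof (rule integral_dominated_convergence[where w = std_normal_density])
        show "integrable lborel std_normal_density" by simp
        show "AE w in lborel. (\<lambda>n. \<psi> (X n w) * std_normal_density w) \<longlonglongrightarrow> \<psi> x * std_normal_density w"
        proof (intro AE_I2 tendsto_mult tendsto_const)
          fix w
          have "(\<lambda>n. x + (1 / (real n + 1)) * w) \<longlonglongrightarrow> x + 0 * w"
            using LIMSEQ_Suc[OF lim_1_over_n, where ?'a1 = real]
            by (intro tendsto_intros) (simp add: add.commute)
          then have Xl: "(\<lambda>n. X n w) \<longlonglongrightarrow> x" by (simp add: X_def)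
          show "(\<lambda>n. \<psi> (X n w)) \<longlonglongrightarrow> \<psi> x"
            unfolding \<psi>_def using isCont_tendsto_compose[OF Jc Xl] by (intro tendsto_mult Ac[OF x Xl])
        qed
        show "AE w in lborel. norm (\<psi> (X n w) * std_normal_density w) \<le> std_normal_density w" for n
          using p by (intro AE_I2) (simp add: mult_left_le_one_le)
        show "(\<lambda>w. \<psi> (X n w) * std_normal_density w) \<in> borel_measurable lborel" for n
          unfolding X_def by measurable
      qed measurable
      then show ?thesis unfolding th by simp
    qed
    have "(\<lambda>n. LINT x|lborel. u x * of_real (\<theta> n x)) \<longlonglongrightarrow> (LINT x|lborel. u x * of_real (\<psi> x))"
    proof (rule integral_dominated_convergence[where w = "\<lambda>x. exp 1 * C * (norm (u x) * J x)"])
      show "integrable lborel (\<lambda>x. exp 1 * C * (norm (u x) * J x))"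
        using iu unfolding J_def by (intro integrable_mult_right)
      have "AE x in lborel. x \<noteq> a" by (rule AE_lborel_singleton)
      then show "AE x in lborel. (\<lambda>n. u x * of_real (\<theta> n x)) \<longlonglongrightarrow> u x * of_real (\<psi> x)"
        by eventually_elim (intro tendsto_intros tlim)
      show "AE x in lborel. norm (u x * complex_of_real (\<theta> n x)) \<le> exp 1 * C * (norm (u x) * J x)" for n
      proof (intro AE_I2)
        fix x
        show "norm (u x * complex_of_real (\<theta> n x)) \<le> exp 1 * C * (norm (u x) * J x)"
          using mult_left_mono[OF tJ[of n x] norm_ge_zero[of "u x"]] t0[of n x]
          by (simp add: norm_mult mult_ac)
      qed
    qed measurable
    then show ?thesis unfolding zero \<psi>_def by (simp add: LIMSEQ_const_iff)
  qed
  define w where "w x = u x * of_real (J x)" for x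
  have "AE x in lborel. w x = 0"
  proof (rule integral_atMost_zero_imp_zero)
    show "integrable lborel w"
    proof (rule Bochner_Integration.integrable_bound[OF iu])
      show "AE x in lborel. norm (w x) \<le> norm (norm (u x) * jbr x powr (- K))"
        by (intro AE_I2) (simp add: w_def norm_mult J_def)
      show "w \<in> borel_measurable lborel" unfolding w_def[abs_def] by measurable
    qed
    show "(LINT x|lborel. w x) = 0"
      using key[of UNIV 0] by (simp add: w_def)
    fix a :: real
    have "(\<lambda>i. indicator {..a} (X i) :: real) \<longlonglongrightarrow> indicator {..a} x" if "x \<noteq> a" "X \<longlonglongrightarrow> x" for x and X :: "nat \<Rightarrow> real"
    proof (rule tendsto_eventually)
      show "\<forall>\<^sub>F i in sequentially. (indicator {..a} (X i) :: real) = indicator {..a} x"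
      proof (cases "x < a")
        case True
        then show ?thesis
          using order_tendstoD(2)[OF that(2) True] by (auto elim!: eventually_mono simp: indicator_def)
      next
        case False
        with that have "a < x" by simp
        then show ?thesis
          using order_tendstoD(1)[OF that(2) \<open>a < x\<close>] by (auto elim!: eventually_mono simp: indicator_def)
      qed
    qed
    then have "(LINT x|lborel. u x * of_real (indicator {..a} x * J x)) = 0"
      by (intro key[of "{..a}" a]) auto
    then show "(LINT x:{..a}|lborel. w x) = 0"
      by (simp add: set_lebesgue_integral_def w_def scaleR_conv_of_real mult_ac)
  qed
  then show ?thesis
  proof eventually_elim
    case (elim x)
    then show ?case using J0[of x] by (simp add: w_def)
  qed
qed

section \<open>Bessel potentials of weighted functions\<close>

lemma weight_powr: "weight q k x powr a = weight q (k * a) x"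
  by (simp add: weight_def powr_powr)

text \<open>The weight is split into factors with indices \<open>k / p\<close> and
  \<open>- (k / p)\<close>; the \<open>r\<close>-th power of the second is comparable with
  \<open>jbr x powr (r * (k / p))\<close>. The constant is fixed before \<open>g\<close>,
  \<open>h\<close> and \<open>B\<close>, as uniformity in \<open>f\<close> demands.\<close>

lemma weighted_holder:
  fixes q :: "real poly"
  assumes m: "m \<ge> 1" and deg: "degree q = 2 * m" and pos: "\<And>x. poly q x > 0"
    and p: "p > 1" and r: "r = p / (p - 1)"
  obtains C where "C > 0" "\<And>(g :: real \<Rightarrow> complex) (h :: real \<Rightarrow> real) B.
     g \<in> borel_measurable borel \<Longrightarrow> h \<in> borel_measurable borel \<Longrightarrow> (\<And>x. 0 \<le> h x) \<Longrightarrow> 0 \<le> B \<Longrightarrow>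
     integrable lborel (\<lambda>x. norm (g x) powr p * weight q k x) \<Longrightarrow>
     (\<integral>\<^sup>+x. ennreal (h x powr r * jbr x powr (r * (k / p))) \<partial>lborel) \<le> ennreal B \<Longrightarrow>
     (\<integral>\<^sup>+x. ennreal (norm (g x) * h x) \<partial>lborel)
       \<le> ennreal (C * (LINT x|lborel. norm (g x) powr p * weight q k x) powr (1 / p) * B powr (1 / r))"
proof -
  have r1: "r > 1" using p by (simp add: r field_simps)
  have pr: "1 / p + 1 / r = 1" using p by (simp add: r field_simps)
  obtain W where W: "W > 0" "\<And>x. weight q (- (k * r / p)) x \<le> W * jbr x powr (- (- (k * r / p)))"
    using weight_comparable[OF m deg pos, of "- (k * r / p)"] by metis
  show ?thesis
  proof
    show "W powr (1 / r) > 0" using W by simp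
    fix g :: "real \<Rightarrow> complex" and h :: "real \<Rightarrow> real" and B :: real
    assume gm [measurable]: "g \<in> borel_measurable borel" and hm [measurable]: "h \<in> borel_measurable borel"
      and h0: "\<And>x. 0 \<le> h x" and B: "0 \<le> B"
      and gi: "integrable lborel (\<lambda>x. norm (g x) powr p * weight q k x)"
      and hB: "(\<integral>\<^sup>+x. ennreal (h x powr r * jbr x powr (r * (k / p))) \<partial>lborel) \<le> ennreal B"
    define A where "A = (LINT x|lborel. norm (g x) powr p * weight q k x)"
    have A0: "A \<ge> 0" unfolding A_def by (intro integral_nonneg_AE) (simp add: weight_nonneg)
    define a where "a x = norm (g x) * weight q (k / p) x" for x
    define b where "b x = h x * weight q (- (k / p)) x" for x
    have ab: "norm (g x) * h x = a x * b x" for x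
    proof -
      have "weight q (k / p) x * weight q (- (k / p)) x = 1"
        using pos[of x] by (simp add: weight_def powr_add[symmetric])
      then show ?thesis by (simp add: a_def b_def)
    qed
    have "(\<integral>\<^sup>+x. ennreal (a x * b x) \<partial>lborel) \<le> ennreal (A powr (1 / p) * (W * B) powr (1 / r))"
    proof (rule holder_nn_integral[OF _ _ _ _ p r1 pr])
      show "a \<in> borel_measurable lborel" "b \<in> borel_measurable lborel"
        unfolding a_def[abs_def] b_def[abs_def] by measurable
      show "0 \<le> a x" "0 \<le> b x" for x using h0[of x] by (simp_all add: a_def b_def weight_nonneg)
      show "0 \<le> A" "0 \<le> W * B" using A0 B W by simp_all
      have "a x powr p = norm (g x) powr p * weight q k x" for x
        using p by (simp add: a_def powr_mult weight_nonneg weight_powr)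
      then show "(\<integral>\<^sup>+x. ennreal (a x powr p) \<partial>lborel) \<le> ennreal A"
        unfolding A_def using nn_integral_eq_integral[OF gi] by (simp add: weight_nonneg)
      have "b x powr r \<le> W * (h x powr r * jbr x powr (r * (k / p)))" for x
      proof -
        have "b x powr r = h x powr r * weight q (- (k * r / p)) x"
          using h0[of x] by (simp add: b_def powr_mult weight_nonneg weight_powr)
        also have "\<dots> \<le> h x powr r * (W * jbr x powr (- (- (k * r / p))))"
          by (intro mult_left_mono W) auto
        finally show ?thesis by (simp add: mult_ac)
      qed
      then have "(\<integral>\<^sup>+x. ennreal (b x powr r) \<partial>lborel)
        \<le> (\<integral>\<^sup>+x. ennreal W * ennreal (h x powr r * jbr x powr (r * (k / p))) \<partial>lborel)"
        using W by (intro nn_integral_mono) (simp add: ennreal_mult'[symmetric] ennreal_leI)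
      also have "\<dots> = ennreal W * (\<integral>\<^sup>+x. ennreal (h x powr r * jbr x powr (r * (k / p))) \<partial>lborel)"
        by (intro nn_integral_cmult) measurable
      also have "\<dots> \<le> ennreal W * ennreal B" by (intro mult_left_mono hB) auto
      finally show "(\<integral>\<^sup>+x. ennreal (b x powr r) \<partial>lborel) \<le> ennreal (W * B)"
        using W B by (simp add: ennreal_mult')
    qed
    also have "A powr (1 / p) * (W * B) powr (1 / r) = W powr (1 / r) * A powr (1 / p) * B powr (1 / r)"
      using W B by (simp add: powr_mult)
    finally show "(\<integral>\<^sup>+x. ennreal (norm (g x) * h x) \<partial>lborel)
       \<le> ennreal (W powr (1 / r) * (LINT x|lborel. norm (g x) powr p * weight q k x) powr (1 / p) * B powr (1 / r))"
      unfolding ab A_def .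
  qed
qed

text \<open>The power \<open>r - 1\<close> is estimated by the maximum
  \<open>t powr (- 1 / 2)\<close> of the kernel, and the remaining factor by its moment.\<close>

lemma heat_powr_moment:
  assumes r: "r > 1"
  obtains C where "C > 0" "\<And>t x. t > 0 \<Longrightarrow>
    (\<integral>\<^sup>+y. ennreal (heat t (x - y) powr r * jbr y powr d) \<partial>lborel)
      \<le> ennreal (C * t powr (- (r - 1) / 2) * exp (- t / 2) * jbr x powr d)"
proof -
  obtain C where C: "C > 0" "\<And>t x. t > 0 \<Longrightarrow> integrable lborel (\<lambda>y. heat t (x - y) * jbr y powr d)"
    "\<And>t x. t > 0 \<Longrightarrow> (LINT y|lborel. heat t (x - y) * jbr y powr d) \<le> C * exp (- t / 2) * jbr x powr d"
    using heat_moment[of d] by blast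
  show ?thesis
  proof
    show "C > 0" by fact
    fix t x :: real assume t: "t > 0"
    have le: "heat t z powr r \<le> t powr (- (r - 1) / 2) * heat t z" for z
    proof -
      have hz: "heat t z > 0" using t by (simp add: heat_def)
      have "heat t z \<le> 1 * t powr (- 1 / 2) * 1"
        unfolding heat_def using t by (intro mult_mono) auto
      then have "heat t z powr (r - 1) \<le> (t powr (- 1 / 2)) powr (r - 1)"
        using r hz by (intro powr_mono2) auto
      also have "\<dots> = t powr (- (r - 1) / 2)"
        unfolding powr_powr by (rule arg_cong[where f = "\<lambda>a. t powr a"]) linarith
      finally have "heat t z powr (r - 1) * heat t z \<le> t powr (- (r - 1) / 2) * heat t z"
        using hz by (intro mult_right_mono) auto
      then show ?thesis using hz by (simp add: powr_diff)
    qed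
    have "(\<integral>\<^sup>+y. ennreal (heat t (x - y) powr r * jbr y powr d) \<partial>lborel)
      \<le> (\<integral>\<^sup>+y. ennreal (t powr (- (r - 1) / 2) * (heat t (x - y) * jbr y powr d)) \<partial>lborel)"
      using mult_right_mono[OF le] by (intro nn_integral_mono ennreal_leI) (simp add: mult.assoc[symmetric])
    also have "\<dots> = ennreal (t powr (- (r - 1) / 2) * (LINT y|lborel. heat t (x - y) * jbr y powr d))"
      using C(2)[OF t] by (subst nn_integral_eq_integral) (auto simp: heat_nonneg)
    also have "\<dots> \<le> ennreal (t powr (- (r - 1) / 2) * (C * exp (- t / 2) * jbr x powr d))"
      by (intro ennreal_leI mult_left_mono C t) auto
    finally show "(\<integral>\<^sup>+y. ennreal (heat t (x - y) powr r * jbr y powr d) \<partial>lborel)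
      \<le> ennreal (C * t powr (- (r - 1) / 2) * exp (- t / 2) * jbr x powr d)" by (simp add: mult_ac)
  qed
qed

lemma gauss_heat: "t > 0 \<Longrightarrow> heat t z = sqrt (4 * pi) * exp (- t) * gauss t z"
  by (simp add: heat_def gauss_eq real_sqrt_mult powr_minus_divide powr_half_sqrt minus_divide_left[symmetric])

lemma gauss_minus: "gauss \<tau> (- z) = gauss \<tau> z"
  by (simp add: gauss_def normal_density_def)

lemma gauss_semigroup:
  assumes s: "s > 0" and t: "t > 0"
  shows "(LINT x|lborel. gauss s (x - z) * gauss t (x - y)) = gauss (t + s) (y - z)"
proof -
  have "(\<integral>\<^sup>+x. ennreal (gauss s (x - z) * gauss t (x - y)) \<partial>lborel)
    = ennreal \<bar>1\<bar> * (\<integral>\<^sup>+x. ennreal (gauss s (y + 1 * x - z) * gauss t (y + 1 * x - y)) \<partial>lborel)"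
    by (rule nn_integral_real_affine) auto
  also have "\<dots> = (\<integral>\<^sup>+x. ennreal (gauss s ((z - y) - x) * gauss t x) \<partial>lborel)"
  proof -
    have "gauss s (y + 1 * x - z) = gauss s ((z - y) - x)" for x
      using gauss_minus[of s "y + x - z"] by (simp add: algebra_simps)
    then show ?thesis by simp
  qed
  also have "\<dots> = ennreal (normal_density 0 (sqrt ((sqrt (2 * s))\<^sup>2 + (sqrt (2 * t))\<^sup>2)) (z - y))"
    unfolding gauss_def using s t by (intro conv_normal_density_zero_mean[THEN fun_cong]) auto
  also have "normal_density 0 (sqrt ((sqrt (2 * s))\<^sup>2 + (sqrt (2 * t))\<^sup>2)) (z - y) = gauss (t + s) (y - z)"
    using s t gauss_minus[of "t + s" "y - z"] by (simp add: gauss_def algebra_simps)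
  finally show ?thesis
    by (intro integral_eq_nn_integral[THEN trans]) auto
qed

text \<open>Unlike \<open>gamma_density\<close> this has no factor \<open>exp (- t)\<close>, which
  is already part of \<open>heat\<close>.\<close>

definition sub_density :: "real \<Rightarrow> real \<Rightarrow> real" where
  "sub_density \<alpha> t = indicator {0<..} t * t powr (\<alpha> / 2 - 1)"

lemma sub_density_nonneg [simp]: "0 \<le> sub_density \<alpha> t"
  by (simp add: sub_density_def)

lemma sub_density_measurable [measurable]: "sub_density \<alpha> \<in> borel_measurable borel"
  unfolding sub_density_def[abs_def] by measurable

text \<open>The Gamma value normalizes the subordination integral; the square root is the factor
  left out of \<open>heat\<close>.\<close>

definition bessel_const :: "real \<Rightarrow> real" where
  "bessel_const \<alpha> = 1 / (Gamma (\<alpha> / 2) * sqrt (4 * pi))"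

abbreviation bessel_kernel :: "real \<Rightarrow> real \<Rightarrow> real \<times> real \<Rightarrow> real" where
  "bessel_kernel \<alpha> x P \<equiv> sub_density \<alpha> (fst P) * heat (fst P) (x - snd P)"

text \<open>The Bessel potential of order \<open>\<alpha>\<close> of \<open>g\<close>: by subordination the Bessel kernel is the
  integral of \<open>sub_density \<alpha> t * heat t\<close> over \<open>t\<close>, up to the constant.\<close>

definition bessel_pot :: "real \<Rightarrow> (real \<Rightarrow> complex) \<Rightarrow> real \<Rightarrow> complex" where
  "bessel_pot \<alpha> g x = of_real (bessel_const \<alpha>) *
     (LINT P|lborel2. of_real (bessel_kernel \<alpha> x P) * g (snd P))"

text \<open>A Borel version \<open>g\<close> of one Bessel density is fixed. Constants obtained
  inside may depend on it, since they serve only convergence and continuity; the uniform estimate is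
  proved outside.\<close>

locale bessel_potential =
  fixes q :: "real poly" and m :: nat and \<upsilon> \<alpha> p k r :: real and g :: "real \<Rightarrow> complex"
  assumes m: "m \<ge> 1" and deg: "degree q = 2 * m" and pos: "\<And>x. poly q x > 0"
    and p: "p > 1" and \<alpha>: "\<alpha> > 1 / p"
    and k: "k = p * (\<upsilon> - 2 - 2 * \<alpha>) + 2" and r: "r = p / (p - 1)"
    and gm [measurable]: "g \<in> borel_measurable borel"
    and gi: "integrable lborel (\<lambda>x. norm (g x) powr p * weight q k x)"
begin

lemma r1: "r > 1" using p by (simp add: r field_simps)

lemma alpha_pos: "\<alpha> > 0" using \<alpha> p by (smt (verit) zero_less_divide_1_iff)

text \<open>The exponent of \<open>t\<close> arises as
  \<open>- (r - 1) / (2 * r) = - 1 / (2 * p)\<close>. This singularity is integrable against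
  \<open>sub_density\<close> precisely by \<alpha> > 1 / p.\<close>

lemma heat_conv_bound:
  obtains C where "C \<ge> 0" "\<And>t x. t > 0 \<Longrightarrow> (\<integral>\<^sup>+y. ennreal (norm (g y) * heat t (x - y)) \<partial>lborel)
    \<le> ennreal (C * jbr x powr (k / p) * (t powr (- 1 / (2 * p)) * exp (- t / (2 * r))))"
proof -
  obtain H where H: "H > 0" "\<And>g h B.
     (g :: real \<Rightarrow> complex) \<in> borel_measurable borel \<Longrightarrow> h \<in> borel_measurable borel \<Longrightarrow> (\<And>x. 0 \<le> h x) \<Longrightarrow> 0 \<le> B \<Longrightarrow>
     integrable lborel (\<lambda>x. norm (g x) powr p * weight q k x) \<Longrightarrow>
     (\<integral>\<^sup>+x. ennreal (h x powr r * jbr x powr (r * (k / p))) \<partial>lborel) \<le> ennreal B \<Longrightarrow>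
     (\<integral>\<^sup>+x. ennreal (norm (g x) * h x) \<partial>lborel)
       \<le> ennreal (H * (LINT x|lborel. norm (g x) powr p * weight q k x) powr (1 / p) * B powr (1 / r))"
    using weighted_holder[OF m deg pos p r, of k] by blast
  obtain D where D: "D > 0" "\<And>t x. t > 0 \<Longrightarrow>
    (\<integral>\<^sup>+y. ennreal (heat t (x - y) powr r * jbr y powr (r * (k / p))) \<partial>lborel)
      \<le> ennreal (D * t powr (- (r - 1) / 2) * exp (- t / 2) * jbr x powr (r * (k / p)))"
    using heat_powr_moment[OF r1, of "r * (k / p)"] by blast
  define N where "N = (LINT x|lborel. norm (g x) powr p * weight q k x) powr (1 / p)"
  show ?thesis
  proof
    show "H * N * D powr (1 / r) \<ge> 0" using H by (simp add: N_def)
    fix t x :: real assume t: "t > 0"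
    define B where "B = D * t powr (- (r - 1) / 2) * exp (- t / 2) * jbr x powr (r * (k / p))"
    have B0: "B \<ge> 0" using D by (simp add: B_def)
    have "(\<integral>\<^sup>+y. ennreal (norm (g y) * heat t (x - y)) \<partial>lborel) \<le> ennreal (H * N * B powr (1 / r))"
      unfolding N_def using D(2)[OF t] B0 by (intro H gi) (auto simp: heat_nonneg B_def)
    also have "B powr (1 / r) = D powr (1 / r) * t powr (- (r - 1) / 2 / r) * exp (- t / (2 * r)) * jbr x powr (k / p)"
      using D r1 by (simp add: B_def powr_mult powr_powr exp_powr_real)
    also have "- (r - 1) / 2 / r = - 1 / (2 * p)" using p by (simp add: r field_simps)
    finally show "(\<integral>\<^sup>+y. ennreal (norm (g y) * heat t (x - y)) \<partial>lborel)
      \<le> ennreal (H * N * D powr (1 / r) * jbr x powr (k / p) * (t powr (- 1 / (2 * p)) * exp (- t / (2 * r))))"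
      by (simp add: mult_ac)
  qed
qed

lemma sub_density_integral:
  "integrable lborel (\<lambda>t. sub_density \<alpha> t * (t powr (- 1 / (2 * p)) * exp (- t / (2 * r))))"
proof -
  have a: "\<alpha> / 2 - 1 / (2 * p) > 0" using \<alpha> by simp
  have "integrable lborel (\<lambda>t. indicator {0<..} t * (t powr ((\<alpha> / 2 - 1 / (2 * p)) - 1) * exp (- (1 / (2 * r) * t))))"
    using a r1 by (intro gamma_weight_integral) auto
  moreover have "indicator {0<..} t * (t powr ((\<alpha> / 2 - 1 / (2 * p)) - 1) * exp (- (1 / (2 * r) * t)))
    = sub_density \<alpha> t * (t powr (- 1 / (2 * p)) * exp (- t / (2 * r)))" for t
  proof -
    have "t powr ((\<alpha> / 2 - 1 / (2 * p)) - 1) = t powr (\<alpha> / 2 - 1) * t powr (- 1 / (2 * p))"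
      by (simp add: powr_add[symmetric] algebra_simps)
    then show ?thesis by (simp add: sub_density_def)
  qed
  ultimately show ?thesis by (simp only:)
qed

text \<open>Absolute convergence holds at every \<open>x\<close>, not merely almost everywhere; the
  quadrature rule evaluates the potential at single points.\<close>

lemma kernel_bound:
  obtains C where "C \<ge> 0" "\<And>x. (\<integral>\<^sup>+P. ennreal (bessel_kernel \<alpha> x P * norm (g (snd P))) \<partial>lborel2)
    \<le> ennreal (C * jbr x powr (k / p))"
proof -
  obtain D where D: "D \<ge> 0" "\<And>t x. t > 0 \<Longrightarrow> (\<integral>\<^sup>+y. ennreal (norm (g y) * heat t (x - y)) \<partial>lborel)
    \<le> ennreal (D * jbr x powr (k / p) * (t powr (- 1 / (2 * p)) * exp (- t / (2 * r))))"
    using heat_conv_bound by blast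
  define J where "J = (LINT t|lborel. sub_density \<alpha> t * (t powr (- 1 / (2 * p)) * exp (- t / (2 * r))))"
  have J0: "J \<ge> 0" unfolding J_def by (intro integral_nonneg_AE) simp
  show ?thesis
  proof
    show "D * J \<ge> 0" using D J0 by simp
    fix x
    have "(\<integral>\<^sup>+P. ennreal (bessel_kernel \<alpha> x P * norm (g (snd P))) \<partial>lborel2)
      = (\<integral>\<^sup>+t. \<integral>\<^sup>+y. ennreal (sub_density \<alpha> t * heat t (x - y) * norm (g y)) \<partial>lborel \<partial>lborel)"
      by (subst lborel.nn_integral_fst[symmetric]) auto
    also have "\<dots> \<le> (\<integral>\<^sup>+t. ennreal (D * jbr x powr (k / p) * (sub_density \<alpha> t * (t powr (- 1 / (2 * p)) * exp (- t / (2 * r))))) \<partial>lborel)"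
    proof (intro nn_integral_mono)
      fix t
      show "(\<integral>\<^sup>+y. ennreal (sub_density \<alpha> t * heat t (x - y) * norm (g y)) \<partial>lborel)
        \<le> ennreal (D * jbr x powr (k / p) * (sub_density \<alpha> t * (t powr (- 1 / (2 * p)) * exp (- t / (2 * r)))))"
      proof (cases "t > 0")
        case True
        have "(\<integral>\<^sup>+y. ennreal (sub_density \<alpha> t * heat t (x - y) * norm (g y)) \<partial>lborel)
          = (\<integral>\<^sup>+y. ennreal (sub_density \<alpha> t) * ennreal (norm (g y) * heat t (x - y)) \<partial>lborel)"
          by (simp add: ennreal_mult'[symmetric] mult_ac)
        also have "\<dots> = ennreal (sub_density \<alpha> t) * (\<integral>\<^sup>+y. ennreal (norm (g y) * heat t (x - y)) \<partial>lborel)"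
          by (intro nn_integral_cmult) measurable
        also have "\<dots> \<le> ennreal (sub_density \<alpha> t) * ennreal (D * jbr x powr (k / p) * (t powr (- 1 / (2 * p)) * exp (- t / (2 * r))))"
          by (intro mult_left_mono D True) auto
        finally show ?thesis by (simp add: ennreal_mult'[symmetric] mult_ac)
      qed (simp add: sub_density_def)
    qed
    also have "\<dots> = ennreal (D * jbr x powr (k / p) * J)"
      unfolding J_def using D(1)
      by (subst nn_integral_eq_integral[OF integrable_mult_right[OF sub_density_integral]]) auto
    finally show "(\<integral>\<^sup>+P. ennreal (bessel_kernel \<alpha> x P * norm (g (snd P))) \<partial>lborel2)
      \<le> ennreal (D * J * jbr x powr (k / p))" by (simp add: mult_ac)
  qed
qed

lemma kernel_integrable:
  "integrable lborel2 (\<lambda>P. of_real (bessel_kernel \<alpha> x P) * g (snd P))"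
proof (rule integrableI_bounded)
  obtain C where C: "C \<ge> 0" "\<And>x. (\<integral>\<^sup>+P. ennreal (bessel_kernel \<alpha> x P * norm (g (snd P))) \<partial>lborel2)
    \<le> ennreal (C * jbr x powr (k / p))"
    by (rule kernel_bound) (rule that)
  show "(\<integral>\<^sup>+P. ennreal (norm (of_real (bessel_kernel \<alpha> x P) * g (snd P))) \<partial>lborel2) < \<infinity>"
  proof -
    have "(\<integral>\<^sup>+P. ennreal (norm (of_real (bessel_kernel \<alpha> x P) * g (snd P))) \<partial>lborel2)
      \<le> ennreal (C * jbr x powr (k / p))"
      using C(2)[of x] by (simp add: norm_mult heat_nonneg abs_mult)
    then show ?thesis by (rule order.strict_trans1) simp
  qed
qed measurable

lemma bessel_pot_measurable [measurable]: "bessel_pot \<alpha> g \<in> borel_measurable borel"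
  unfolding bessel_pot_def[abs_def] by measurable

lemma bessel_const_pos: "bessel_const \<alpha> > 0"
  unfolding bessel_const_def using alpha_pos by (intro divide_pos_pos mult_pos_pos Gamma_real_pos) auto

lemma bessel_pot_bound:
  obtains C where "C \<ge> 0" "\<And>x. norm (bessel_pot \<alpha> g x) \<le> C * jbr x powr (k / p)"
proof -
  obtain C where C: "C \<ge> 0" "\<And>x. (\<integral>\<^sup>+P. ennreal (bessel_kernel \<alpha> x P * norm (g (snd P))) \<partial>lborel2)
    \<le> ennreal (C * jbr x powr (k / p))"
    by (rule kernel_bound) (rule that)
  show ?thesis
  proof
    show "bessel_const \<alpha> * C \<ge> 0" using bessel_const_pos C by simp
    fix x
    have "ennreal (norm (LINT P|lborel2. of_real (bessel_kernel \<alpha> x P) * g (snd P)))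
      \<le> (\<integral>\<^sup>+P. ennreal (norm (of_real (bessel_kernel \<alpha> x P) * g (snd P))) \<partial>lborel2)"
      by (rule integral_norm_bound_ennreal[OF kernel_integrable])
    also have "\<dots> \<le> ennreal (C * jbr x powr (k / p))"
      using C(2)[of x] by (simp add: norm_mult heat_nonneg abs_mult)
    finally have "norm (LINT P|lborel2. of_real (bessel_kernel \<alpha> x P) * g (snd P))
      \<le> C * jbr x powr (k / p)" using C(1) by simp
    then show "norm (bessel_pot \<alpha> g x) \<le> bessel_const \<alpha> * C * jbr x powr (k / p)"
      using bessel_const_pos by (simp add: bessel_pot_def norm_mult mult.assoc)
  qed
qed

text \<open>Fubini for a nonnegative weight \<omega>. It is used with the weight of the quadrature
  problem and with a Gaussian.\<close>

lemma integral_bessel_pot: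
  assumes om [measurable]: "\<omega> \<in> borel_measurable borel" and o0: "\<And>x. 0 \<le> \<omega> x"
    and oi: "integrable lborel (\<lambda>x. \<omega> x * jbr x powr (k / p))"
  shows "integrable lborel2 (\<lambda>P. of_real (sub_density \<alpha> (fst P)) * g (snd P) *
           of_real (LINT x|lborel. heat (fst P) (x - snd P) * \<omega> x))"
    and "(LINT x|lborel. bessel_pot \<alpha> g x * of_real (\<omega> x)) = of_real (bessel_const \<alpha>) *
      (LINT P|lborel2. of_real (sub_density \<alpha> (fst P)) * g (snd P) *
           of_real (LINT x|lborel. heat (fst P) (x - snd P) * \<omega> x))"
proof -
  interpret LL: pair_sigma_finite "lborel :: real measure" "lborel2 :: (real \<times> real) measure"
    by (intro pair_sigma_finite.intro sigma_finite_lborel lborel_pair.sigma_finite_measure_axioms)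
  obtain C where C: "C \<ge> 0" "\<And>x. (\<integral>\<^sup>+P. ennreal (bessel_kernel \<alpha> x P * norm (g (snd P))) \<partial>lborel2)
    \<le> ennreal (C * jbr x powr (k / p))"
    by (rule kernel_bound) (rule that)
  define h where "h x P = of_real (\<omega> x) * (of_real (bessel_kernel \<alpha> x P) * g (snd P))" for x P
  have hm [measurable]: "case_prod h \<in> borel_measurable (lborel \<Otimes>\<^sub>M lborel2)"
    unfolding h_def by measurable
  have ih: "integrable (lborel \<Otimes>\<^sub>M lborel2) (case_prod h)"
  proof (rule integrableI_bounded)
    have "(\<integral>\<^sup>+w. ennreal (norm (case_prod h w)) \<partial>(lborel \<Otimes>\<^sub>M lborel2))
      = (\<integral>\<^sup>+x. \<integral>\<^sup>+P. ennreal (norm (h x P)) \<partial>lborel2 \<partial>lborel)"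
      by (subst sigma_finite_measure.nn_integral_fst[OF lborel_pair.sigma_finite_measure_axioms, symmetric]) auto
    also have "\<dots> \<le> (\<integral>\<^sup>+x. ennreal (C * (\<omega> x * jbr x powr (k / p))) \<partial>lborel)"
    proof (intro nn_integral_mono)
      fix x
      have "(\<integral>\<^sup>+P. ennreal (norm (h x P)) \<partial>lborel2)
        = (\<integral>\<^sup>+P. ennreal (\<omega> x) * ennreal (bessel_kernel \<alpha> x P * norm (g (snd P))) \<partial>lborel2)"
        using o0[of x] by (simp add: h_def norm_mult heat_nonneg abs_mult ennreal_mult'[symmetric])
      also have "\<dots> = ennreal (\<omega> x) * (\<integral>\<^sup>+P. ennreal (bessel_kernel \<alpha> x P * norm (g (snd P))) \<partial>lborel2)"
        by (intro nn_integral_cmult) measurable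
      also have "\<dots> \<le> ennreal (\<omega> x) * ennreal (C * jbr x powr (k / p))"
        by (intro mult_left_mono C) auto
      finally show "(\<integral>\<^sup>+P. ennreal (norm (h x P)) \<partial>lborel2) \<le> ennreal (C * (\<omega> x * jbr x powr (k / p)))"
        using o0[of x] by (simp add: ennreal_mult'[symmetric] mult_ac)
    qed
    also have "\<dots> = ennreal (C * (LINT x|lborel. \<omega> x * jbr x powr (k / p)))"
      using C(1) o0 oi by (subst nn_integral_eq_integral) auto
    also have "\<dots> < \<infinity>" by simp
    finally show "(\<integral>\<^sup>+w. ennreal (norm (case_prod h w)) \<partial>(lborel \<Otimes>\<^sub>M lborel2)) < \<infinity>" .
  qed measurable
  have inner: "(LINT x|lborel. h x P) = of_real (sub_density \<alpha> (fst P)) * g (snd P) *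
           of_real (LINT x|lborel. heat (fst P) (x - snd P) * \<omega> x)" for P
  proof -
    have "h x P = (of_real (sub_density \<alpha> (fst P)) * g (snd P)) * of_real (heat (fst P) (x - snd P) * \<omega> x)" for x
      by (simp add: h_def mult_ac)
    then show ?thesis by (simp only: integral_mult_right_zero integral_complex_of_real)
  qed
  show "integrable lborel2 (\<lambda>P. of_real (sub_density \<alpha> (fst P)) * g (snd P) *
           of_real (LINT x|lborel. heat (fst P) (x - snd P) * \<omega> x))"
    using LL.integrable_snd[OF ih] unfolding inner .
  have "(LINT x|lborel. bessel_pot \<alpha> g x * of_real (\<omega> x)) = (LINT x|lborel. of_real (bessel_const \<alpha>) * (LINT P|lborel2. h x P))"
  proof (rule Bochner_Integration.integral_cong[OF refl])
    fix x
    show "bessel_pot \<alpha> g x * of_real (\<omega> x) = of_real (bessel_const \<alpha>) * (LINT P|lborel2. h x P)"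
      unfolding h_def integral_mult_right_zero bessel_pot_def by (simp only: mult_ac)
  qed
  also have "\<dots> = of_real (bessel_const \<alpha>) * (LINT x|lborel. (LINT P|lborel2. h x P))"
    by (simp only: integral_mult_right_zero)
  also have "(LINT x|lborel. (LINT P|lborel2. h x P)) = (LINT P|lborel2. (LINT x|lborel. h x P))"
    by (rule LL.Fubini_integral[OF ih, symmetric])
  finally show "(LINT x|lborel. bessel_pot \<alpha> g x * of_real (\<omega> x)) = of_real (bessel_const \<alpha>) *
      (LINT P|lborel2. of_real (sub_density \<alpha> (fst P)) * g (snd P) *
           of_real (LINT x|lborel. heat (fst P) (x - snd P) * \<omega> x))"
    unfolding inner .
qed

lemma heat_conv_integrable:
  assumes t: "t > 0"
  shows "integrable lborel (\<lambda>y. heat t (x - y) * norm (g y))"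
proof (rule integrableI_bounded)
  obtain C where C: "C \<ge> 0" "\<And>t x. t > 0 \<Longrightarrow> (\<integral>\<^sup>+y. ennreal (norm (g y) * heat t (x - y)) \<partial>lborel)
    \<le> ennreal (C * jbr x powr (k / p) * (t powr (- 1 / (2 * p)) * exp (- t / (2 * r))))"
    by (rule heat_conv_bound) (rule that)
  have "(\<integral>\<^sup>+y. ennreal (norm (heat t (x - y) * norm (g y))) \<partial>lborel)
    \<le> ennreal (C * jbr x powr (k / p) * (t powr (- 1 / (2 * p)) * exp (- t / (2 * r))))"
    using C(2)[OF t, of x] by (simp add: heat_nonneg abs_mult mult.commute)
  then show "(\<integral>\<^sup>+y. ennreal (norm (heat t (x - y) * norm (g y))) \<partial>lborel) < \<infinity>"
    by (rule order.strict_trans1) simp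
qed measurable

lemma bessel_pot_iterated:
  "bessel_pot \<alpha> g x = of_real (bessel_const \<alpha>) *
    (LINT t|lborel. of_real (sub_density \<alpha> t) * (LINT y|lborel. of_real (heat t (x - y)) * g y))"
proof -
  have ii: "integrable lborel2 (\<lambda>(t, y). of_real (sub_density \<alpha> t * heat t (x - y)) * g y)"
    using kernel_integrable[of x] by (simp only: case_prod_beta')
  have "(LINT P|lborel2. of_real (bessel_kernel \<alpha> x P) * g (snd P))
    = (LINT t|lborel. (LINT y|lborel. of_real (sub_density \<alpha> t * heat t (x - y)) * g y))"
    using lborel_pair.integral_fst[OF ii] by (simp only: case_prod_beta')
  also have "\<dots> = (LINT t|lborel. of_real (sub_density \<alpha> t) * (LINT y|lborel. of_real (heat t (x - y)) * g y))"
  proof (rule Bochner_Integration.integral_cong[OF refl])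
    fix t
    show "(LINT y|lborel. of_real (sub_density \<alpha> t * heat t (x - y)) * g y)
      = of_real (sub_density \<alpha> t) * (LINT y|lborel. of_real (heat t (x - y)) * g y)"
      unfolding integral_mult_right_zero[symmetric] by (simp only: of_real_mult mult.assoc)
  qed
  finally show ?thesis unfolding bessel_pot_def by simp
qed

text \<open>Dominated convergence twice in the iterated form: in \<open>y\<close> for fixed
  \<open>t\<close>, where the kernel at the doubled time dominates all nearby translates, and then
  in \<open>t\<close>, where Peetre's inequality makes the bound locally uniform in
  \<open>x\<close>.\<close>

lemma bessel_pot_continuous: "continuous_on UNIV (bessel_pot \<alpha> g)"
  unfolding continuous_on_eq_continuous_at[OF open_UNIV] continuous_at_sequentially
proof (intro ballI allI impI)
  fix x :: real and X :: "nat \<Rightarrow> real"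
  assume X: "X \<longlonglongrightarrow> x"
  obtain D where D: "\<And>i. \<bar>X i - x\<bar> \<le> D"
  proof -
    have "Bseq (\<lambda>i. X i - x)"
      using X by (intro convergent_imp_Bseq) (auto simp: convergent_def intro!: tendsto_intros)
    then show ?thesis using that by (auto simp: Bseq_def)
  qed
  have D0: "D \<ge> 0" using D[of 0] by linarith
  obtain C where C: "C \<ge> 0" "\<And>t x. t > 0 \<Longrightarrow> (\<integral>\<^sup>+y. ennreal (norm (g y) * heat t (x - y)) \<partial>lborel)
    \<le> ennreal (C * jbr x powr (k / p) * (t powr (- 1 / (2 * p)) * exp (- t / (2 * r))))"
    by (rule heat_conv_bound) (rule that)
  define U where "U t x = (LINT y|lborel. complex_of_real (heat t (x - y)) * g y)" for t x
  have Um [measurable]: "(\<lambda>t. U t x) \<in> borel_measurable borel" for x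
    unfolding U_def by measurable
  have Ub: "norm (U t x) \<le> C * jbr x powr (k / p) * (t powr (- 1 / (2 * p)) * exp (- t / (2 * r)))" if t: "t > 0" for t x
  proof -
    have "integrable lborel (\<lambda>y. complex_of_real (heat t (x - y)) * g y)"
      using heat_conv_integrable[OF t, of x] by (rule Bochner_Integration.integrable_bound) (auto simp: norm_mult heat_nonneg)
    then have "ennreal (norm (U t x)) \<le> (\<integral>\<^sup>+y. ennreal (norm (complex_of_real (heat t (x - y)) * g y)) \<partial>lborel)"
      unfolding U_def by (rule integral_norm_bound_ennreal)
    also have "\<dots> \<le> ennreal (C * jbr x powr (k / p) * (t powr (- 1 / (2 * p)) * exp (- t / (2 * r))))"
      using C(2)[OF t, of x] by (simp add: norm_mult heat_nonneg mult.commute)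
    finally show ?thesis using C(1) by (subst (asm) ennreal_le_iff) auto
  qed
  have Ulim: "(\<lambda>i. U t (X i)) \<longlonglongrightarrow> U t x" if t: "t > 0" for t
    unfolding U_def
  proof (rule integral_dominated_convergence)
    \<comment> \<open>The first three factors change the normalization from time \<open>t\<close> to
      \<open>2 * t\<close>; the last one comes from
      \<open>(x - y)^2 \<le> 2 * (X i - y)^2 + 2 * D^2\<close>.\<close>
    define E where "E = exp t * (2 * t) powr (1/2) * t powr (- 1/2) * exp (D\<^sup>2 / (4 * t))"
    show "integrable lborel (\<lambda>y. E * (heat (2 * t) (x - y) * norm (g y)))"
      using t by (intro integrable_mult_right heat_conv_integrable) auto
    show "AE y in lborel. (\<lambda>i. complex_of_real (heat t (X i - y)) * g y) \<longlonglongrightarrow> complex_of_real (heat t (x - y)) * g y"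
      unfolding heat_def using t by (intro AE_I2 tendsto_intros X) auto
    have le: "heat t (X i - y) \<le> E * heat (2 * t) (x - y)" for i y
    proof -
      have "(X i - x)\<^sup>2 \<le> D\<^sup>2" using D[of i] D0 by (simp add: abs_le_square_iff[symmetric])
      moreover have "(x - y)\<^sup>2 \<le> 2 * (X i - y)\<^sup>2 + 2 * (X i - x)\<^sup>2"
        using zero_le_power2[of "(X i - y) + (X i - x)"] by (simp add: power2_eq_square algebra_simps)
      ultimately have "(x - y)\<^sup>2 - 2 * D\<^sup>2 \<le> 2 * (X i - y)\<^sup>2" by linarith
      then have "((x - y)\<^sup>2 - 2 * D\<^sup>2) / (8 * t) \<le> (2 * (X i - y)\<^sup>2) / (8 * t)"
        using t by (intro divide_right_mono) auto
      then have "- ((X i - y)\<^sup>2 / (4 * t)) \<le> D\<^sup>2 / (4 * t) + - ((x - y)\<^sup>2 / (4 * (2 * t)))"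
        by (simp add: diff_divide_distrib)
      then have "exp (- ((X i - y)\<^sup>2 / (4 * t))) \<le> exp (D\<^sup>2 / (4 * t)) * exp (- ((x - y)\<^sup>2 / (4 * (2 * t))))"
        by (simp add: mult_exp_exp)
      then have "heat t (X i - y) \<le> exp (- t) * t powr (- 1 / 2) * (exp (D\<^sup>2 / (4 * t)) * exp (- ((x - y)\<^sup>2 / (4 * (2 * t)))))"
        unfolding heat_def by (intro mult_left_mono) auto
      also have "\<dots> = (exp t * exp (- (2 * t))) * ((2 * t) powr (1/2) * (2 * t) powr (- 1 / 2)) *
          (t powr (- 1 / 2) * (exp (D\<^sup>2 / (4 * t)) * exp (- ((x - y)\<^sup>2 / (4 * (2 * t))))))"
      proof -
        have "exp t * exp (- (2 * t)) = exp (- t)" by (simp add: mult_exp_exp)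
        moreover have "(2 * t) powr (1/2) * (2 * t) powr (- 1 / 2) = 1"
          using t by (simp add: powr_add[symmetric])
        ultimately show ?thesis by simp
      qed
      also have "\<dots> = E * heat (2 * t) (x - y)"
        unfolding E_def heat_def by (simp only: mult_ac)
      finally show ?thesis .
    qed
    show "AE y in lborel. norm (complex_of_real (heat t (X i - y)) * g y) \<le> E * (heat (2 * t) (x - y) * norm (g y))" for i
      using mult_right_mono[OF le norm_ge_zero] by (intro AE_I2) (simp add: norm_mult heat_nonneg mult.assoc)
  qed measurable
  have bp: "bessel_pot \<alpha> g x = of_real (bessel_const \<alpha>) * (LINT t|lborel. of_real (sub_density \<alpha> t) * U t x)" for x
    unfolding U_def by (rule bessel_pot_iterated)
  have jbX: "jbr (X i) powr (k / p) \<le> (1 + D) powr \<bar>k / p\<bar> * jbr x powr (k / p)" for i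
  proof -
    have "jbr (X i) powr (k / p) \<le> (1 + \<bar>X i - x\<bar>) powr \<bar>k / p\<bar> * jbr x powr (k / p)"
      by (rule jbr_powr_peetre)
    also have "\<dots> \<le> (1 + D) powr \<bar>k / p\<bar> * jbr x powr (k / p)"
      using D[of i] by (intro mult_right_mono powr_mono2) auto
    finally show ?thesis .
  qed
  have "(\<lambda>i. LINT t|lborel. of_real (sub_density \<alpha> t) * U t (X i)) \<longlonglongrightarrow> (LINT t|lborel. of_real (sub_density \<alpha> t) * U t x)"
  proof (rule integral_dominated_convergence)
    let ?B = "C * ((1 + D) powr \<bar>k / p\<bar> * jbr x powr (k / p))"
    show "integrable lborel (\<lambda>t. ?B * (sub_density \<alpha> t * (t powr (- 1 / (2 * p)) * exp (- t / (2 * r)))))"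
      by (rule integrable_mult_right[OF sub_density_integral])
    show "AE t in lborel. (\<lambda>i. of_real (sub_density \<alpha> t) * U t (X i)) \<longlonglongrightarrow> of_real (sub_density \<alpha> t) * U t x"
    proof (intro AE_I2)
      fix t :: real
      show "(\<lambda>i. of_real (sub_density \<alpha> t) * U t (X i)) \<longlonglongrightarrow> of_real (sub_density \<alpha> t) * U t x"
        by (cases "t > 0") (auto intro!: tendsto_intros Ulim simp: sub_density_def)
    qed
    show "AE t in lborel. norm (of_real (sub_density \<alpha> t) * U t (X i)) \<le> ?B * (sub_density \<alpha> t * (t powr (- 1 / (2 * p)) * exp (- t / (2 * r))))" for i
    proof (intro AE_I2)
      fix t :: real
      show "norm (of_real (sub_density \<alpha> t) * U t (X i)) \<le> ?B * (sub_density \<alpha> t * (t powr (- 1 / (2 * p)) * exp (- t / (2 * r))))"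
      proof (cases "t > 0")
        case True
        have "norm (U t (X i)) \<le> C * jbr (X i) powr (k / p) * (t powr (- 1 / (2 * p)) * exp (- t / (2 * r)))"
          by (rule Ub[OF True])
        also have "\<dots> \<le> ?B * (t powr (- 1 / (2 * p)) * exp (- t / (2 * r)))"
          using C(1) by (intro mult_right_mono mult_left_mono jbX) auto
        finally have "sub_density \<alpha> t * norm (U t (X i)) \<le> sub_density \<alpha> t * (?B * (t powr (- 1 / (2 * p)) * exp (- t / (2 * r))))"
          by (intro mult_left_mono) auto
        then show ?thesis by (simp add: norm_mult mult_ac)
      qed (simp add: sub_density_def)
    qed
  qed measurable
  then show "(bessel_pot \<alpha> g \<circ> X) \<longlonglongrightarrow> bessel_pot \<alpha> g x"
    unfolding comp_def bp by (intro tendsto_intros)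
qed

lemma k_div_p: "k / p = \<upsilon> - 2 - 2 * \<alpha> + 2 / p"
  using p by (simp add: k field_simps)

text \<open>The exponents give \<open>- \<upsilon> + k / p = - 2 - 2 * (\<alpha> - 1 / p)\<close>,
  which is below \<open>- 3/2\<close>. With the growth of the potential, this makes its weighted
  integral converge absolutely.\<close>

lemma weight_jbr_integrable: "integrable lborel (\<lambda>x. weight q \<upsilon> x * jbr x powr (k / p))"
proof -
  obtain W where W: "W > 0" "\<And>x. weight q \<upsilon> x \<le> W * jbr x powr (- \<upsilon>)"
    using weight_comparable[OF m deg pos, of \<upsilon>] by metis
  show ?thesis
  proof (rule Bochner_Integration.integrable_bound[OF integrable_mult_right[OF integrable_jbr_powr]])
    show "AE x in lborel. norm (weight q \<upsilon> x * jbr x powr (k / p)) \<le> norm (W * jbr x powr (- 3 / 2))"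
    proof (intro AE_I2)
      fix x
      have "weight q \<upsilon> x * jbr x powr (k / p) \<le> W * jbr x powr (- \<upsilon>) * jbr x powr (k / p)"
        by (intro mult_right_mono W) auto
      also have "\<dots> = W * jbr x powr (- \<upsilon> + k / p)" by (simp only: powr_add mult.assoc)
      also have "\<dots> \<le> W * jbr x powr (- 3 / 2)"
      proof -
        have "- \<upsilon> + k / p = - 2 - 2 * (\<alpha> - 1 / p)" by (simp add: k_div_p)
        also have "\<dots> \<le> - 3 / 2" using \<alpha> by simp
        finally show ?thesis using W jbr_ge_1[of x] by (intro mult_left_mono powr_mono) auto
      qed
      finally show "norm (weight q \<upsilon> x * jbr x powr (k / p)) \<le> norm (W * jbr x powr (- 3 / 2))"
        using W by (simp add: weight_nonneg)
    qed
  qed measurable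
qed

text \<open>The error functional is linear and passes under the superposition: Fubini treats the
  integral, absolute convergence at each node treats the finite sum.\<close>

lemma quadrature_error_bessel_pot:
  shows "(LINT x|lborel. bessel_pot \<alpha> g x * of_real (weight q \<upsilon> x)) - moebius_trapezoidal q \<gamma> \<upsilon> n (bessel_pot \<alpha> g)
    = of_real (bessel_const \<alpha>) * (LINT P|lborel2. of_real (sub_density \<alpha> (fst P)) * g (snd P) *
        of_real (quad_err q \<gamma> \<upsilon> n (fst P) (snd P)))"
    and "integrable lborel2 (\<lambda>P. of_real (sub_density \<alpha> (fst P)) * g (snd P) *
        of_real (quad_err q \<gamma> \<upsilon> n (fst P) (snd P)))"
proof -
  define N where "N = (lborel2 :: (real \<times> real) measure)"
  define X where "X j = moebius \<gamma> (node n j)" for j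
  define a where "a j = weight q \<upsilon> (X j) * moebius' \<gamma> (node n j)" for j
  define I where "I P = complex_of_real (sub_density \<alpha> (fst P)) * g (snd P) *
           of_real (LINT x|lborel. heat (fst P) (x - snd P) * weight q \<upsilon> x)" for P
  define K where "K j P = of_real (sub_density \<alpha> (fst P) * heat (fst P) (X j - snd P)) * g (snd P)" for j P
  have iI: "integrable N I" and eI: "(LINT x|lborel. bessel_pot \<alpha> g x * of_real (weight q \<upsilon> x)) = of_real (bessel_const \<alpha>) * (LINT P|N. I P)"
    unfolding I_def N_def using integral_bessel_pot[OF weight_measurable weight_nonneg weight_jbr_integrable] by blast+
  have iK: "integrable N (K j)" for j
    unfolding K_def N_def by (rule kernel_integrable)
  have iS: "integrable N (\<lambda>P. of_real (2 * pi / real n) * (\<Sum>j=1..n. K j P * of_real (a j)))"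
    by (intro integrable_mult_right Bochner_Integration.integrable_sum integrable_mult_left iK)
  have diff: "of_real (sub_density \<alpha> (fst P)) * g (snd P) * of_real (quad_err q \<gamma> \<upsilon> n (fst P) (snd P))
     = I P - of_real (2 * pi / real n) * (\<Sum>j=1..n. K j P * of_real (a j))" for P
  proof -
    have "(\<Sum>j=1..n. K j P * of_real (a j)) = of_real (sub_density \<alpha> (fst P)) * g (snd P) *
        of_real (\<Sum>j=1..n. heat (fst P) (X j - snd P) * a j)"
      unfolding K_def of_real_sum sum_distrib_left
      by (intro sum.cong refl) (simp only: of_real_mult mult_ac)
    then show ?thesis
      unfolding quad_err_def I_def X_def[symmetric] a_def[symmetric] by (simp add: algebra_simps)
  qed
  show "integrable lborel2 (\<lambda>P. of_real (sub_density \<alpha> (fst P)) * g (snd P) *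
        of_real (quad_err q \<gamma> \<upsilon> n (fst P) (snd P)))"
    unfolding diff N_def[symmetric] by (intro Bochner_Integration.integrable_diff iI iS)
  have "moebius_trapezoidal q \<gamma> \<upsilon> n (bessel_pot \<alpha> g)
    = of_real (2 * pi / real n) * (\<Sum>j=1..n. of_real (bessel_const \<alpha>) * (LINT P|N. K j P) * of_real (a j))"
    unfolding moebius_trapezoidal_def X_def[symmetric] a_def[symmetric] bessel_pot_def K_def N_def ..
  also have "\<dots> = of_real (bessel_const \<alpha>) * (of_real (2 * pi / real n) * (\<Sum>j=1..n. (LINT P|N. K j P * of_real (a j))))"
    unfolding integral_mult_left_zero mult.assoc sum_distrib_left[symmetric] by (simp only: mult.left_commute)
  also have "(\<Sum>j=1..n. (LINT P|N. K j P * of_real (a j))) = (LINT P|N. (\<Sum>j=1..n. K j P * of_real (a j)))"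
    by (intro Bochner_Integration.integral_sum[symmetric] integrable_mult_left iK)
  also have "of_real (2 * pi / real n) * \<dots> = (LINT P|N. of_real (2 * pi / real n) * (\<Sum>j=1..n. K j P * of_real (a j)))"
    by (simp only: integral_mult_right_zero)
  finally show "(LINT x|lborel. bessel_pot \<alpha> g x * of_real (weight q \<upsilon> x)) - moebius_trapezoidal q \<gamma> \<upsilon> n (bessel_pot \<alpha> g)
    = of_real (bessel_const \<alpha>) * (LINT P|lborel2. of_real (sub_density \<alpha> (fst P)) * g (snd P) *
        of_real (quad_err q \<gamma> \<upsilon> n (fst P) (snd P)))"
    unfolding eI diff N_def[symmetric] Bochner_Integration.integral_diff[OF iI iS] right_diff_distrib by simp
qed

text \<open>Symmetry of the Bessel potential, tested on a Gaussian: by the semigroup property the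
  kernel at time \<open>t\<close> smoothed by \<open>gauss s\<close> is a multiple of
  \<open>gauss (t + s)\<close>.\<close>

lemma bessel_pot_gauss_integral:
  assumes s: "s > 0"
  shows "(LINT x|lborel. bessel_pot \<alpha> g x * of_real (gauss s (x - z)))
    = (LINT y|lborel. g y * of_real (bessel_gauss 0 \<alpha> s z y))"
proof -
  obtain C where C: "C > 0" "\<And>t x. t > 0 \<Longrightarrow> integrable lborel (\<lambda>y. heat t (x - y) * jbr y powr (k / p))"
    "\<And>t x. t > 0 \<Longrightarrow> (LINT y|lborel. heat t (x - y) * jbr y powr (k / p)) \<le> C * exp (- t / 2) * jbr x powr (k / p)"
    by (rule heat_moment[of "k / p"]) (rule that)
  have ndh: "gauss s (x - z) = exp s / sqrt (4 * pi) * heat s (z - x)" for x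
    using gauss_heat[OF s, of "z - x"] gauss_minus[of s "x - z"] by (simp add: mult_exp_exp exp_minus)
  have oi: "integrable lborel (\<lambda>x. gauss s (x - z) * jbr x powr (k / p))"
    unfolding ndh mult.assoc by (intro integrable_mult_right C s)
  have om: "(\<lambda>x. gauss s (x - z)) \<in> borel_measurable borel" by measurable
  define v where "v t = gamma_density \<alpha> t" for t :: real
  have inner: "of_real (sub_density \<alpha> t) * g y * of_real (LINT x|lborel. heat t (x - y) * gauss s (x - z))
    = g y * of_real (sqrt (4 * pi) * (v t * gauss_deriv 0 (t + s) (y - z)))" for t y
  proof (cases "t > 0")
    case True
    have "(LINT x|lborel. heat t (x - y) * gauss s (x - z)) = (LINT x|lborel. sqrt (4 * pi) * exp (- t) * (gauss s (x - z) * gauss t (x - y)))"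
      unfolding gauss_heat[OF True] by (simp only: mult_ac)
    also have "\<dots> = sqrt (4 * pi) * exp (- t) * gauss (t + s) (y - z)"
      unfolding integral_mult_right_zero gauss_semigroup[OF s True] ..
    finally have 1: "(LINT x|lborel. heat t (x - y) * gauss s (x - z)) = sqrt (4 * pi) * exp (- t) * gauss (t + s) (y - z)" .
    have "gauss_deriv 0 (t + s) (y - z) = gauss (t + s) (y - z)" using True s by (intro gauss_deriv_0) auto
    moreover have "v t = sub_density \<alpha> t * exp (- t)" by (simp add: v_def sub_density_def)
    ultimately show ?thesis unfolding 1 by (simp add: mult_ac)
  next
    case False
    then show ?thesis by (simp add: sub_density_def v_def)
  qed
  have ii: "integrable lborel2 (\<lambda>(t, y). g y * of_real (sqrt (4 * pi) * (v t * gauss_deriv 0 (t + s) (y - z))))"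
    using integral_bessel_pot(1)[OF om gauss_nonneg oi] unfolding inner by (simp only: case_prod_beta')
  have "Gamma (\<alpha> / 2) > 0" using alpha_pos by (intro Gamma_real_pos) auto
  then have G: "Gamma (\<alpha> / 2) \<noteq> 0" by simp
  have bg: "(LINT t|lborel. v t * gauss_deriv 0 (t + s) (y - z)) = Gamma (\<alpha> / 2) * bessel_gauss 0 \<alpha> s z y" for y
    using G by (simp add: bessel_gauss_def v_def)
  have "(LINT x|lborel. bessel_pot \<alpha> g x * of_real (gauss s (x - z)))
    = of_real (bessel_const \<alpha>) * (LINT P|lborel2. g (snd P) * of_real (sqrt (4 * pi) * (v (fst P) * gauss_deriv 0 (fst P + s) (snd P - z))))"
    using integral_bessel_pot(2)[OF om gauss_nonneg oi] unfolding inner .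
  also have "(LINT P|lborel2. g (snd P) * of_real (sqrt (4 * pi) * (v (fst P) * gauss_deriv 0 (fst P + s) (snd P - z))))
    = (LINT y|lborel. (LINT t|lborel. g y * of_real (sqrt (4 * pi) * (v t * gauss_deriv 0 (t + s) (y - z)))))"
    using lborel_pair.integral_snd[OF ii] by (simp only: case_prod_beta')
  also have "\<dots> = (LINT y|lborel. of_real (sqrt (4 * pi) * Gamma (\<alpha> / 2)) * (g y * of_real (bessel_gauss 0 \<alpha> s z y)))"
  proof (rule Bochner_Integration.integral_cong[OF refl])
    fix y
    have "(LINT t|lborel. g y * of_real (sqrt (4 * pi) * (v t * gauss_deriv 0 (t + s) (y - z))))
      = g y * of_real (sqrt (4 * pi) * (LINT t|lborel. v t * gauss_deriv 0 (t + s) (y - z)))"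
      by (simp only: integral_mult_right_zero integral_complex_of_real)
    then show "(LINT t|lborel. g y * of_real (sqrt (4 * pi) * (v t * gauss_deriv 0 (t + s) (y - z))))
      = of_real (sqrt (4 * pi) * Gamma (\<alpha> / 2)) * (g y * of_real (bessel_gauss 0 \<alpha> s z y))"
      unfolding bg by (simp only: of_real_mult mult_ac)
  qed
  also have "of_real (bessel_const \<alpha>) * \<dots> = of_real (bessel_const \<alpha> * (sqrt (4 * pi) * Gamma (\<alpha> / 2))) *
      (LINT y|lborel. g y * of_real (bessel_gauss 0 \<alpha> s z y))"
    unfolding integral_mult_right_zero by (simp only: of_real_mult mult.assoc)
  also have "bessel_const \<alpha> * (sqrt (4 * pi) * Gamma (\<alpha> / 2)) = 1"
    using G by (simp add: bessel_const_def)
  finally show ?thesis by simp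
qed

text \<open>By \<open>dens\<close> and the symmetry of the potential, \<open>f\<close> and the
  potential of \<open>g\<close> have the same Gaussian convolutions, so their difference vanishes
  almost everywhere.\<close>

lemma eq_bessel_pot:
  assumes fm [measurable]: "f \<in> borel_measurable borel"
    and fi: "integrable lborel (\<lambda>x. norm (f x) powr p * weight q k x)"
    and dens: "\<And>s z. s > 0 \<Longrightarrow> (LINT x|lborel. g x * of_real (bessel_gauss 0 \<alpha> s z x)) = (LINT x|lborel. f x * of_real (gauss s (x - z)))"
  shows "AE x in lborel. f x = bessel_pot \<alpha> g x"
proof -
  obtain H where H: "H > 0" "\<And>g h B.
     (g :: real \<Rightarrow> complex) \<in> borel_measurable borel \<Longrightarrow> h \<in> borel_measurable borel \<Longrightarrow> (\<And>x. 0 \<le> h x) \<Longrightarrow> 0 \<le> B \<Longrightarrow>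
     integrable lborel (\<lambda>x. norm (g x) powr p * weight q k x) \<Longrightarrow>
     (\<integral>\<^sup>+x. ennreal (h x powr r * jbr x powr (r * (k / p))) \<partial>lborel) \<le> ennreal B \<Longrightarrow>
     (\<integral>\<^sup>+x. ennreal (norm (g x) * h x) \<partial>lborel)
       \<le> ennreal (H * (LINT x|lborel. norm (g x) powr p * weight q k x) powr (1 / p) * B powr (1 / r))"
    using weighted_holder[OF m deg pos p r, of k] by blast
  obtain C where C: "C \<ge> 0" "\<And>x. norm (bessel_pot \<alpha> g x) \<le> C * jbr x powr (k / p)"
    by (rule bessel_pot_bound) (rule that)
  \<comment> \<open>Large enough for both functions: against the growth
    \<open>jbr x powr (k / p)\<close> of the potential it leaves at most \<open>- 3/2\<close>, and
    in the dual norm used for \<open>f\<close> it leaves at most \<open>- r * 3/2\<close>.\<close>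
  define K where "K = \<bar>k / p\<bar> + 3/2"
  have K0: "K \<ge> 0" by (simp add: K_def)
  define J where "J = (LINT x|lborel. jbr x powr (-3/2))"
  have J0: "J \<ge> 0" unfolding J_def by (intro integral_nonneg_AE) auto
  have finf: "(\<integral>\<^sup>+x. ennreal (norm (f x) * jbr x powr (- K)) \<partial>lborel) < \<infinity>"
  proof -
    have "(\<integral>\<^sup>+x. ennreal ((jbr x powr (- K)) powr r * jbr x powr (r * (k / p))) \<partial>lborel)
      \<le> (\<integral>\<^sup>+x. ennreal (jbr x powr (-3/2)) \<partial>lborel)"
    proof (intro nn_integral_mono ennreal_leI)
      fix x
      have "k / p \<le> \<bar>k / p\<bar>" by (rule abs_ge_self)
      then have "r * (3/2) \<le> r * (K - k / p)" using r1 unfolding K_def by (intro mult_left_mono) auto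
      moreover have "1 * (3/2) \<le> r * (3/2)" using r1 by (intro mult_right_mono) auto
      ultimately have e: "- K * r + r * (k / p) \<le> - 3 / 2" by (simp add: algebra_simps)
      have "(jbr x powr (- K)) powr r * jbr x powr (r * (k / p)) = jbr x powr (- K * r + r * (k / p))"
        by (simp only: powr_powr powr_add)
      also have "\<dots> \<le> jbr x powr (-3/2)" using e jbr_ge_1[of x] by (intro powr_mono) auto
      finally show "(jbr x powr (- K)) powr r * jbr x powr (r * (k / p)) \<le> jbr x powr (-3/2)" .
    qed
    also have "\<dots> = ennreal J"
      unfolding J_def by (intro nn_integral_eq_integral integrable_jbr_powr) auto
    finally have "(\<integral>\<^sup>+x. ennreal (norm (f x) * jbr x powr (- K)) \<partial>lborel)
       \<le> ennreal (H * (LINT x|lborel. norm (f x) powr p * weight q k x) powr (1 / p) * J powr (1 / r))"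
      by (intro H fi J0) auto
    then show ?thesis by (rule order.strict_trans1) simp
  qed
  have if_: "integrable lborel (\<lambda>x. norm (f x) * jbr x powr (- K))"
    by (rule integrableI_bounded) (use finf in auto)
  have ib: "integrable lborel (\<lambda>x. norm (bessel_pot \<alpha> g x) * jbr x powr (- K))"
  proof (rule Bochner_Integration.integrable_bound[OF integrable_mult_right[OF integrable_jbr_powr]])
    show "AE x in lborel. norm (norm (bessel_pot \<alpha> g x) * jbr x powr (- K)) \<le> norm (C * jbr x powr (-3/2))"
    proof (intro AE_I2)
      fix x
      have "norm (bessel_pot \<alpha> g x) * jbr x powr (- K) \<le> C * jbr x powr (k / p) * jbr x powr (- K)"
        by (intro mult_right_mono C) auto
      also have "\<dots> = C * jbr x powr (k / p - K)" by (simp add: powr_add[symmetric])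
      also have "\<dots> \<le> C * jbr x powr (-3/2)"
      proof -
        have "k / p - K \<le> -3/2" using abs_ge_self[of "k / p"] unfolding K_def by linarith
        then show ?thesis using C(1) jbr_ge_1[of x] by (intro mult_left_mono powr_mono) auto
      qed
      finally show "norm (norm (bessel_pot \<alpha> g x) * jbr x powr (- K)) \<le> norm (C * jbr x powr (-3/2))"
        using C(1) by simp
    qed
  qed measurable
  have gauss_int: "integrable lborel (\<lambda>x. w x * of_real (gauss s (x - z)))"
    if [measurable]: "w \<in> borel_measurable borel" and iw: "integrable lborel (\<lambda>x. norm (w x) * jbr x powr (- K))" and s: "s > 0"
    for w :: "real \<Rightarrow> complex" and s z
  proof -
    obtain D where D: "D > 0" "\<And>t x y. t > 0 \<Longrightarrow> heat t (x - y) * jbr y powr K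
      \<le> D * jbr x powr K * (exp (- t / 2) * t powr (- 1 / 2) * exp (- ((y - x)\<^sup>2 / (2 * (8 * t)))))"
      by (rule heat_jbr_bound[of K]) (rule that)
    define E where "E = D * jbr z powr K * (exp (- s / 2) * s powr (- 1 / 2)) * (exp s / sqrt (4 * pi))"
    have E0: "E \<ge> 0" using D(1) by (simp add: E_def)
    have b: "gauss s (x - z) \<le> E * jbr x powr (- K)" for x
    proof -
      have "gauss s (x - z) = exp s / sqrt (4 * pi) * heat s (z - x)"
        using gauss_heat[OF s, of "z - x"] gauss_minus[of s "x - z"] by (simp add: mult_exp_exp exp_minus)
      moreover have "heat s (z - x) * jbr x powr K \<le> D * jbr z powr K * (exp (- s / 2) * s powr (- 1 / 2) * 1)"
        using D(1) s by (intro order.trans[OF D(2)[OF s]] mult_left_mono) auto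
      ultimately have "gauss s (x - z) * jbr x powr K \<le> E"
        using mult_left_mono[of "heat s (z - x) * jbr x powr K" "D * jbr z powr K * (exp (- s / 2) * s powr (- 1 / 2) * 1)" "exp s / sqrt (4 * pi)"]
        by (simp add: E_def mult_ac)
      then show ?thesis by (simp add: powr_minus_divide pos_le_divide_eq)
    qed
    show ?thesis
    proof (rule Bochner_Integration.integrable_bound[OF integrable_mult_right[OF iw]])
      show "AE x in lborel. norm (w x * of_real (gauss s (x - z))) \<le> norm (E * (norm (w x) * jbr x powr (- K)))"
      proof (intro AE_I2)
        fix x
        show "norm (w x * of_real (gauss s (x - z))) \<le> norm (E * (norm (w x) * jbr x powr (- K)))"
          using mult_left_mono[OF b[of x] norm_ge_zero[of "w x"]] E0 by (simp add: norm_mult abs_mult mult_ac)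
      qed
    qed measurable
  qed
  have "AE x in lborel. f x - bessel_pot \<alpha> g x = 0"
  proof (rule gauss_convolution_zero_imp_zero[OF _ _ K0])
    show "integrable lborel (\<lambda>x. norm (f x - bessel_pot \<alpha> g x) * jbr x powr (- K))"
    proof (rule Bochner_Integration.integrable_bound[OF Bochner_Integration.integrable_add[OF if_ ib]])
      show "AE x in lborel. norm (norm (f x - bessel_pot \<alpha> g x) * jbr x powr (- K))
        \<le> norm (norm (f x) * jbr x powr (- K) + norm (bessel_pot \<alpha> g x) * jbr x powr (- K))"
      proof (intro AE_I2)
        fix x
        have "norm (f x - bessel_pot \<alpha> g x) * jbr x powr (- K) \<le> (norm (f x) + norm (bessel_pot \<alpha> g x)) * jbr x powr (- K)"
          by (intro mult_right_mono norm_triangle_ineq4) auto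
        then show "norm (norm (f x - bessel_pot \<alpha> g x) * jbr x powr (- K))
          \<le> norm (norm (f x) * jbr x powr (- K) + norm (bessel_pot \<alpha> g x) * jbr x powr (- K))"
          by (simp add: distrib_right)
      qed
    qed measurable
    fix s z :: real assume s: "s > 0"
    have "(LINT x|lborel. (f x - bessel_pot \<alpha> g x) * of_real (gauss s (x - z)))
      = (LINT x|lborel. f x * of_real (gauss s (x - z))) - (LINT x|lborel. bessel_pot \<alpha> g x * of_real (gauss s (x - z)))"
      unfolding left_diff_distrib by (intro Bochner_Integration.integral_diff gauss_int if_ ib s fm bessel_pot_measurable)
    then show "(LINT x|lborel. (f x - bessel_pot \<alpha> g x) * of_real (gauss s (x - z))) = 0"
      using dens[OF s, of z] bessel_pot_gauss_integral[OF s, of z] by simp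
  qed measurable
  then show ?thesis by simp
qed

end

section \<open>Convergence of the quadrature rule\<close>

text \<open>Hoelder's inequality in \<open>y\<close> at each fixed time, with the dual estimate for
  the error, followed by integration in time. All constants are obtained before the density is
  introduced.\<close>

lemma bessel_quadrature_error:
  fixes q :: "real poly"
  assumes g: "\<gamma> > 0" and m: "m \<ge> 1" and deg: "degree q = 2 * m" and pos: "\<And>x. poly q x > 0"
    and p: "p > 1" and \<alpha>: "\<alpha> > 1 / p"
    and k: "k = p * (\<upsilon> - 2 - 2 * \<alpha>) + 2" and r: "r = p / (p - 1)"
  shows "\<exists>C>0. \<forall>g n. bessel_potential q m \<upsilon> \<alpha> p k r g \<longrightarrow> n \<ge> 1 \<longrightarrow>
    norm ((LINT x|lborel. bessel_pot \<alpha> g x * of_real (weight q \<upsilon> x)) - moebius_trapezoidal q \<gamma> \<upsilon> n (bessel_pot \<alpha> g))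
      \<le> C * real n powr (- \<alpha>) * (LINT x|lborel. norm (g x) powr p * weight q k x) powr (1 / p)"
proof -
  have r1: "r > 1" using p by (simp add: r field_simps)
  define s where "s = (\<alpha> - 1 / p) * r"
  have s0: "s \<ge> 0" using \<alpha> r1 by (simp add: s_def)
  have kp: "r * (\<upsilon> - 2) - 2 * s = r * (k / p)"
    using p by (simp add: s_def k field_simps)
  obtain H where H: "H > 0" "\<And>g h B.
     (g :: real \<Rightarrow> complex) \<in> borel_measurable borel \<Longrightarrow> h \<in> borel_measurable borel \<Longrightarrow> (\<And>x. 0 \<le> h x) \<Longrightarrow> 0 \<le> B \<Longrightarrow>
     integrable lborel (\<lambda>x. norm (g x) powr p * weight q k x) \<Longrightarrow>
     (\<integral>\<^sup>+x. ennreal (h x powr r * jbr x powr (r * (k / p))) \<partial>lborel) \<le> ennreal B \<Longrightarrow>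
     (\<integral>\<^sup>+x. ennreal (norm (g x) * h x) \<partial>lborel)
       \<le> ennreal (H * (LINT x|lborel. norm (g x) powr p * weight q k x) powr (1 / p) * B powr (1 / r))"
    using weighted_holder[OF m deg pos p r, of k] by blast
  obtain D where D: "D > 0" "\<And>n t. n \<ge> 1 \<Longrightarrow> t > 0 \<Longrightarrow>
    (\<integral>\<^sup>+y. ennreal (\<bar>quad_err q \<gamma> \<upsilon> n t y\<bar> powr r * jbr y powr (r * (\<upsilon> - 2) - 2 * s)) \<partial>lborel)
      \<le> ennreal (D * Theta r s (real n * sqrt t))"
    by (rule quad_err_dual_bound[OF g m deg pos r1 s0]) (rule that)
  obtain T where T: "T \<ge> 0" "\<And>n. n \<ge> 1 \<Longrightarrow>
    (\<integral>\<^sup>+t. ennreal (indicator {0<..} t * t powr (\<alpha> / 2 - 1) * Theta r s (real n * sqrt t) powr (1 / r)) \<partial>lborel)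
      = ennreal (T * real n powr (- \<alpha>))"
    by (rule Theta_integral[OF p \<alpha> r s_def]) (rule that)
  have a0: "\<alpha> > 0" using \<alpha> p by (smt (verit) zero_less_divide_1_iff)
  have c0: "bessel_const \<alpha> > 0"
    unfolding bessel_const_def using a0 by (intro divide_pos_pos mult_pos_pos Gamma_real_pos) auto
  define C where "C = bessel_const \<alpha> * (H * D powr (1 / r) * T)"
  have C0: "C \<ge> 0" using c0 H D T by (simp add: C_def)
  show ?thesis
  \<comment> \<open>\<open>T\<close> is only known to be nonnegative, so 1 is added to have a
    positive constant.\<close>
  proof (intro exI[of _ "C + 1"] conjI allI impI)
    show "C + 1 > 0" using C0 by simp
    fix g :: "real \<Rightarrow> complex" and n :: nat
    assume bp: "bessel_potential q m \<upsilon> \<alpha> p k r g" and n: "n \<ge> 1"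
    interpret bessel_potential q m \<upsilon> \<alpha> p k r g by (rule bp)
    define N where "N = (LINT x|lborel. norm (g x) powr p * weight q k x) powr (1 / p)"
    have N0: "N \<ge> 0" by (simp add: N_def)
    let ?h = "\<lambda>P. of_real (sub_density \<alpha> (fst P)) * g (snd P) * of_real (quad_err q \<gamma> \<upsilon> n (fst P) (snd P))"
    have "ennreal (norm (LINT P|lborel2. ?h P)) \<le> (\<integral>\<^sup>+P. ennreal (norm (?h P)) \<partial>lborel2)"
      by (rule integral_norm_bound_ennreal[OF quadrature_error_bessel_pot(2)])
    also have "\<dots> = (\<integral>\<^sup>+t. \<integral>\<^sup>+y. ennreal (sub_density \<alpha> t) * ennreal (norm (g y) * \<bar>quad_err q \<gamma> \<upsilon> n t y\<bar>) \<partial>lborel \<partial>lborel)"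
      by (subst lborel.nn_integral_fst[symmetric])
         (auto simp: norm_mult ennreal_mult'[symmetric] mult.assoc)
    also have "\<dots> \<le> (\<integral>\<^sup>+t. ennreal (H * N * D powr (1 / r)) *
      ennreal (indicator {0<..} t * t powr (\<alpha> / 2 - 1) * Theta r s (real n * sqrt t) powr (1 / r)) \<partial>lborel)"
    proof (intro nn_integral_mono)
      fix t :: real
      show "(\<integral>\<^sup>+y. ennreal (sub_density \<alpha> t) * ennreal (norm (g y) * \<bar>quad_err q \<gamma> \<upsilon> n t y\<bar>) \<partial>lborel)
        \<le> ennreal (H * N * D powr (1 / r)) *
          ennreal (indicator {0<..} t * t powr (\<alpha> / 2 - 1) * Theta r s (real n * sqrt t) powr (1 / r))"
      proof (cases "t > 0")
        case True
        have qm [measurable]: "quad_err q \<gamma> \<upsilon> n t \<in> borel_measurable borel"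
          unfolding quad_err_def[abs_def] by measurable
        have "(\<integral>\<^sup>+y. ennreal (sub_density \<alpha> t) * ennreal (norm (g y) * \<bar>quad_err q \<gamma> \<upsilon> n t y\<bar>) \<partial>lborel)
          = ennreal (sub_density \<alpha> t) * (\<integral>\<^sup>+y. ennreal (norm (g y) * \<bar>quad_err q \<gamma> \<upsilon> n t y\<bar>) \<partial>lborel)"
          by (intro nn_integral_cmult) measurable
        also have "(\<integral>\<^sup>+y. ennreal (norm (g y) * \<bar>quad_err q \<gamma> \<upsilon> n t y\<bar>) \<partial>lborel)
          \<le> ennreal (H * N * (D * Theta r s (real n * sqrt t)) powr (1 / r))"
          unfolding N_def
        proof (rule H(2)[OF gm _ _ _ gi])
          show "(\<lambda>y. \<bar>quad_err q \<gamma> \<upsilon> n t y\<bar>) \<in> borel_measurable borel" by measurable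
          show "0 \<le> D * Theta r s (real n * sqrt t)" using D(1) by (simp add: Theta_nonneg)
          show "(\<integral>\<^sup>+x. ennreal (\<bar>quad_err q \<gamma> \<upsilon> n t x\<bar> powr r * jbr x powr (r * (k / p))) \<partial>lborel)
            \<le> ennreal (D * Theta r s (real n * sqrt t))"
            using D(2)[OF n True] unfolding kp .
        qed simp
        also have "(D * Theta r s (real n * sqrt t)) powr (1 / r) = D powr (1 / r) * Theta r s (real n * sqrt t) powr (1 / r)"
          using D(1) by (simp add: powr_mult Theta_nonneg)
        finally have "(\<integral>\<^sup>+y. ennreal (sub_density \<alpha> t) * ennreal (norm (g y) * \<bar>quad_err q \<gamma> \<upsilon> n t y\<bar>) \<partial>lborel)
          \<le> ennreal (sub_density \<alpha> t) * ennreal (H * N * (D powr (1 / r) * Theta r s (real n * sqrt t) powr (1 / r)))"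
          by (simp add: mult_left_mono)
        also have "\<dots> = ennreal (H * N * D powr (1 / r)) *
          ennreal (indicator {0<..} t * t powr (\<alpha> / 2 - 1) * Theta r s (real n * sqrt t) powr (1 / r))"
          using H(1) N0 by (simp add: ennreal_mult'[symmetric] sub_density_def mult_ac)
        finally show ?thesis .
      qed (simp add: sub_density_def)
    qed
    also have "\<dots> = ennreal (H * N * D powr (1 / r)) * ennreal (T * real n powr (- \<alpha>))"
      unfolding T(2)[OF n, symmetric] by (intro nn_integral_cmult) (unfold Theta_def, measurable)
    also have "\<dots> = ennreal (H * D powr (1 / r) * T * real n powr (- \<alpha>) * N)"
      using H(1) N0 by (subst ennreal_mult'[symmetric]) (simp_all add: mult_ac)
    finally have b: "norm (LINT P|lborel2. ?h P) \<le> H * D powr (1 / r) * T * real n powr (- \<alpha>) * N"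
      using H(1) N0 T(1) by (subst (asm) ennreal_le_iff) auto
    have "norm ((LINT x|lborel. bessel_pot \<alpha> g x * of_real (weight q \<upsilon> x)) - moebius_trapezoidal q \<gamma> \<upsilon> n (bessel_pot \<alpha> g))
      = bessel_const \<alpha> * norm (LINT P|lborel2. ?h P)"
      unfolding quadrature_error_bessel_pot(1) using c0 by (simp add: norm_mult)
    also have "\<dots> \<le> bessel_const \<alpha> * (H * D powr (1 / r) * T * real n powr (- \<alpha>) * N)"
      using c0 b by (intro mult_left_mono) auto
    also have "\<dots> = C * (real n powr (- \<alpha>) * N)" by (simp add: C_def)
    also have "\<dots> \<le> (C + 1) * (real n powr (- \<alpha>) * N)" using N0 by (intro mult_right_mono) auto
    finally show "norm ((LINT x|lborel. bessel_pot \<alpha> g x * of_real (weight q \<upsilon> x)) - moebius_trapezoidal q \<gamma> \<upsilon> n (bessel_pot \<alpha> g))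
      \<le> (C + 1) * real n powr (- \<alpha>) * (LINT x|lborel. norm (g x) powr p * weight q k x) powr (1 / p)"
      by (simp add: N_def mult.assoc)
  qed
qed

section \<open>From Lebesgue measurable functions to Borel representatives\<close>

lemma completion_ex_borel_measurable_complex:
  fixes f :: "'a \<Rightarrow> complex"
  assumes f: "f \<in> borel_measurable (completion M)"
  obtains f' where "f' \<in> borel_measurable M" "AE x in M. f x = f' x"
proof -
  have m: "(\<lambda>x. Re (f x)) \<in> borel_measurable (completion M)" "(\<lambda>x. Im (f x)) \<in> borel_measurable (completion M)"
    using f by measurable
  obtain u where u: "u \<in> borel_measurable M" "AE x in M. Re (f x) = u x"
    using completion_ex_borel_measurable_real[OF m(1)] by blast
  obtain v where v: "v \<in> borel_measurable M" "AE x in M. Im (f x) = v x"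
    using completion_ex_borel_measurable_real[OF m(2)] by blast
  show ?thesis
  proof
    show "(\<lambda>x. of_real (u x) + \<i> * of_real (v x)) \<in> borel_measurable M"
      using u(1) v(1) by measurable
    show "AE x in M. f x = of_real (u x) + \<i> * of_real (v x)"
      using u(2) v(2) by eventually_elim (simp add: complex_eq_iff)
  qed
qed

lemma continuous_AE_eq_imp_eq:
  fixes f g :: "real \<Rightarrow> 'a :: real_normed_vector"
  assumes "continuous_on UNIV f" "continuous_on UNIV g" and ae: "AE x in lebesgue. f x = g x"
  shows "f = g"
proof (rule ccontr)
  assume "f \<noteq> g"
  then have ne: "{x. f x \<noteq> g x} \<noteq> {}" by auto
  have op: "open {x. f x \<noteq> g x}" using assms by (intro open_Collect_neq) auto
  from ae obtain N where "{x. f x \<noteq> g x} \<subseteq> N" "N \<in> null_sets lebesgue"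
    by (auto simp: eventually_ae_filter)
  then have "negligible {x. f x \<noteq> g x}"
    using negligible_iff_null_sets negligible_subset by blast
  with op ne show False using open_not_negligible by blast
qed

lemma continuous_rep_eq:
  assumes "continuous_on UNIV h" "AE x in lebesgue. f x = h x"
  shows "continuous_rep f = h"
  unfolding continuous_rep_def
proof (rule the_equality)
  show "continuous_on UNIV h \<and> (AE x in lebesgue. h x = f x)"
    using assms by (auto elim: eventually_mono)
  fix g assume g: "continuous_on UNIV g \<and> (AE x in lebesgue. g x = f x)"
  then have "AE x in lebesgue. g x = h x"
    using assms(2) by (auto elim: eventually_elim2)
  then show "g = h" using g assms(1) by (intro continuous_AE_eq_imp_eq) auto
qed

text \<open>A Borel \<open>F\<close> of two arguments covers at once the weighted norms, the
  pairings with test functions and the weighted integral.\<close>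

lemma lebesgue_integral_eq_lborel:
  fixes f f' :: "real \<Rightarrow> complex" and F :: "real \<Rightarrow> complex \<Rightarrow> 'b :: {banach, second_countable_topology}"
  assumes f: "f \<in> borel_measurable lebesgue" and f': "f' \<in> borel_measurable borel"
    and ae: "AE x in lborel. f x = f' x"
    and F: "case_prod F \<in> borel_measurable (borel \<Otimes>\<^sub>M borel)"
  shows "(LINT x|lebesgue. F x (f x)) = (LINT x|lborel. F x (f' x))"
    and "integrable lebesgue (\<lambda>x. F x (f x)) \<longleftrightarrow> integrable lborel (\<lambda>x. F x (f' x))"
proof -
  have id: "(\<lambda>x. x) \<in> borel_measurable lebesgue"
    by (rule measurable_completion) simp
  have m1: "(\<lambda>x. F x (f x)) \<in> borel_measurable lebesgue"
    using measurable_compose[OF measurable_Pair[OF id f] F] by simp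
  have m2: "(\<lambda>x. F x (f' x)) \<in> borel_measurable lborel"
    using measurable_compose[OF measurable_Pair[OF measurable_ident f'] F] by simp
  have m3: "(\<lambda>x. F x (f' x)) \<in> borel_measurable lebesgue"
    by (rule measurable_completion[OF m2])
  have ae': "AE x in lebesgue. F x (f x) = F x (f' x)"
    using AE_completion[OF ae] by (auto elim: eventually_mono)
  show "(LINT x|lebesgue. F x (f x)) = (LINT x|lborel. F x (f' x))"
    using integral_cong_AE[OF m1 m3 ae'] integral_completion[OF m2] by simp
  show "integrable lebesgue (\<lambda>x. F x (f x)) \<longleftrightarrow> integrable lborel (\<lambda>x. F x (f' x))"
    using integrable_cong_AE[OF m1 m3 ae'] integrable_completion[OF m2] by simp
qed

theorem theorem3p6:
  fixes q :: "real poly" and m :: nat and \<gamma> \<upsilon> \<alpha> p :: real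
  assumes "m \<ge> 1"
    and "degree q = 2 * m"
    and "\<And>x. poly q x > 0"
    and "\<gamma> > 0"
    and "1 < p"
    and "\<alpha> > 1 / p"
  shows "\<exists>C>0. \<forall>f \<in> weighted_sobolev q (p * (\<upsilon> - 2 - 2 * \<alpha>) + 2) \<alpha> p. \<forall>n::nat. n \<ge> 1 \<longrightarrow>
           norm (weighted_integral q \<upsilon> f - moebius_trapezoidal q \<gamma> \<upsilon> n (continuous_rep f))
             \<le> C * real n powr (- \<alpha>)
                 * weighted_sobolev_norm q (p * (\<upsilon> - 2 - 2 * \<alpha>) + 2) \<alpha> p f"
proof -
  define k where "k = p * (\<upsilon> - 2 - 2 * \<alpha>) + 2"
  define r where "r = p / (p - 1)"
  have a0: "\<alpha> > 0" using assms(5,6) by (smt (verit) zero_less_divide_1_iff)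
  have wm: "case_prod (\<lambda>x w. norm (w :: complex) powr p * weight q k x) \<in> borel_measurable (borel \<Otimes>\<^sub>M borel)"
    by measurable
  from bessel_quadrature_error[OF assms(4,1,2,3,5,6) k_def r_def]
  obtain C where C: "C > 0" "\<forall>g n. bessel_potential q m \<upsilon> \<alpha> p k r g \<longrightarrow> n \<ge> 1 \<longrightarrow>
    norm ((LINT x|lborel. bessel_pot \<alpha> g x * of_real (weight q \<upsilon> x)) - moebius_trapezoidal q \<gamma> \<upsilon> n (bessel_pot \<alpha> g))
      \<le> C * real n powr (- \<alpha>) * (LINT x|lborel. norm (g x) powr p * weight q k x) powr (1 / p)"
    by (elim exE conjE)
  have "norm (weighted_integral q \<upsilon> f - moebius_trapezoidal q \<gamma> \<upsilon> n (continuous_rep f))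
             \<le> C * real n powr (- \<alpha>) * weighted_sobolev_norm q k \<alpha> p f"
    if f: "f \<in> weighted_sobolev q k \<alpha> p" and n: "n \<ge> 1" for f n
  proof -
    \<comment> \<open>The very density selected in \<open>weighted_sobolev_norm\<close>, so that the
      estimate comes out in that norm.\<close>
    define g0 where "g0 = (SOME g. is_bessel_density q k \<alpha> p f g)"
    obtain g1 where "is_bessel_density q k \<alpha> p f g1"
      using f unfolding weighted_sobolev_def by blast
    then have g0: "is_bessel_density q k \<alpha> p f g0"
      unfolding g0_def by (rule someI[of "is_bessel_density q k \<alpha> p f"])
    have fL: "f \<in> borel_measurable lebesgue" "integrable lebesgue (\<lambda>x. norm (f x) powr p * weight q k x)"
      using f by (auto simp: weighted_sobolev_def weighted_Lp_def)
    have gL: "g0 \<in> borel_measurable lebesgue" "integrable lebesgue (\<lambda>x. norm (g0 x) powr p * weight q k x)"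
      using g0 by (auto simp: is_bessel_density_def weighted_Lp_def)
    obtain f' where f': "f' \<in> borel_measurable lborel" "AE x in lborel. f x = f' x"
      by (rule completion_ex_borel_measurable_complex[OF fL(1)])
    obtain g where g: "g \<in> borel_measurable lborel" "AE x in lborel. g0 x = g x"
      by (rule completion_ex_borel_measurable_complex[OF gL(1)])
    have f'b: "f' \<in> borel_measurable borel" and gb: "g \<in> borel_measurable borel"
      using f'(1) g(1) by simp_all
    have gi: "integrable lborel (\<lambda>x. norm (g x) powr p * weight q k x)"
      using lebesgue_integral_eq_lborel(2)[OF gL(1) gb g(2) wm] gL(2) by simp
    have fi: "integrable lborel (\<lambda>x. norm (f' x) powr p * weight q k x)"
      using lebesgue_integral_eq_lborel(2)[OF fL(1) f'b f'(2) wm] fL(2) by simp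
    have bp: "bessel_potential q m \<upsilon> \<alpha> p k r g"
      by unfold_locales (use assms gb gi in \<open>auto simp: k_def r_def\<close>)
    interpret bessel_potential q m \<upsilon> \<alpha> p k r g by (rule bp)
    have ae: "AE x in lborel. f' x = bessel_pot \<alpha> g x"
    proof (rule eq_bessel_pot[OF f'b fi])
      fix s z :: real assume s: "s > 0"
      have mb: "case_prod (\<lambda>x w. w * complex_of_real (bessel_gauss 0 \<alpha> s z x)) \<in> borel_measurable (borel \<Otimes>\<^sub>M borel)"
        using bessel_gauss_measurable[OF a0 s, of 0 z] by measurable
      have mn: "case_prod (\<lambda>x w. w * complex_of_real (gauss s (x - z))) \<in> borel_measurable (borel \<Otimes>\<^sub>M borel)"
        by measurable
      show "(LINT x|lborel. g x * of_real (bessel_gauss 0 \<alpha> s z x)) = (LINT x|lborel. f' x * of_real (gauss s (x - z)))"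
        using bessel_density_gauss[OF a0 s g0, of z]
          lebesgue_integral_eq_lborel(1)[OF gL(1) gb g(2) mb] lebesgue_integral_eq_lborel(1)[OF fL(1) f'b f'(2) mn]
        by simp
    qed
    have aef: "AE x in lborel. f x = bessel_pot \<alpha> g x"
      using f'(2) ae by eventually_elim simp
    \<comment> \<open>The potential is the continuous representative, so the quadrature rule samples
      exactly the function to which the error formula applies.\<close>
    have rep: "continuous_rep f = bessel_pot \<alpha> g"
      by (rule continuous_rep_eq[OF bessel_pot_continuous AE_completion[OF aef]])
    have mw: "case_prod (\<lambda>x w. w * complex_of_real (weight q \<upsilon> x)) \<in> borel_measurable (borel \<Otimes>\<^sub>M borel)"
      by measurable
    have wi: "weighted_integral q \<upsilon> f = (LINT x|lborel. bessel_pot \<alpha> g x * of_real (weight q \<upsilon> x))"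
      unfolding weighted_integral_def by (rule lebesgue_integral_eq_lborel(1)[OF fL(1) bessel_pot_measurable aef mw])
    have "weighted_sobolev_norm q k \<alpha> p f = (LINT x|lborel. norm (g x) powr p * weight q k x) powr (1 / p)"
      unfolding weighted_sobolev_norm_def g0_def[symmetric] weighted_Lp_norm_def
      using lebesgue_integral_eq_lborel(1)[OF gL(1) gb g(2) wm] by simp
    then show ?thesis unfolding rep wi using C(2) bp n by simp
  qed
  then show ?thesis
    using C(1) unfolding k_def[symmetric] by (intro exI[of _ C] conjI ballI allI impI)
qed

end
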